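(* There is an algorithm which, given the rank $n$ of a free group $F$ with free basis $\mathcal{B}$ and a finite list of words $w_1,\dots,w_r$ in $F$ generating a malnormal family of cyclic subgroups, with associated decomposition space $\mathcal{D}$, computes a finite presentation for the right $F$-module $\check{\mathrm{H}}^0(\mathcal{D},\mathbb{Z})$.
   Context: $F$ is a free group of finite rank $n$ with free basis $\mathcal{B}$, and $\mathcal{T}$ is the Cayley graph of $F$ with respect to $\mathcal{B}$ (a tree, on which $F$ acts on the left by isometries); $\partial_\infty F=\partial_\infty\mathcal{T}$ is its Gromov boundary. The family $\langle w_1\rangle,\dots,\langle w_r\rangle$ is malnormal: each $w_i\neq 1$, and if $g\langle w_i\rangle g^{-1}\cap\langle w_j\rangle\neq 1$ for some $g\in F$ then $i=j$ and $g\in\langle w_i\rangle$. The line pattern $\mathcal{L}$ is the set of lines $\{g w_i^k\}_{k\in\mathbb{Z}}$, $g\in F$, $1\le i\le r$, each identified with the bi-infinite geodesic of $\mathcal{T}$ with end points $\lim_{k\to\pm\infty} g w_i^{k}$. The decomposition space $\mathcal{D}$ is the quotient of $\partial_\infty F$ by the equivalence relation identifying the two end points of each line in $\mathcal{L}$, with the quotient topology. $\check{\mathrm{H}}^*(\mathcal{D},\mathbb{Z})$ is Čech cohomology: the direct limit, over open covers ordered by refinement, of the cohomology of the nerve. The action of $F$ on $\partial_\infty F$ descends to an action on $\mathcal{D}$ by homeomorphisms, and pullback $[\sigma]\cdot g=g^*[\sigma]$ makes $\check{\mathrm{H}}^*(\mathcal{D},\mathbb{Z})$ a right $F$-module (i.e.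 a right $\mathbb{Z}F$-module). Computing a finite presentation of a right $F$-module $M$ means outputting $k\in\mathbb{N}$ and a finite list of elements of $\mathbb{Z}F^k$ such that $M$ is isomorphic to the quotient of the free right module $\mathbb{Z}F^k$ by the submodule generated by that list. *)

theory Defs
  imports "HOL-Analysis.Analysis" "HOL-Algebra.Generated_Groups" "HOL-Library.Nat_Bijection"
begin

section \<open>Partial recursive functions\<close>

text \<open>Kleene's partial recursive functions in the unary presentation: several arguments are
  passed through the pairing function \<^const>\<open>prod_encode\<close>, and \<^const>\<open>None\<close> means divergence.
  In \<open>mu\<close> the search diverges if \<open>f\<close> diverges before the first zero.\<close>

inductive partial_recursive :: "(nat \<Rightarrow> nat option) \<Rightarrow> bool" where
  zero: "partial_recursive (\<lambda>x. Some 0)"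
| succ: "partial_recursive (\<lambda>x. Some (Suc x))"
| left: "partial_recursive (\<lambda>x. Some (fst (prod_decode x)))"
| right: "partial_recursive (\<lambda>x. Some (snd (prod_decode x)))"
| pair: "partial_recursive f \<Longrightarrow> partial_recursive g \<Longrightarrow>
    partial_recursive (\<lambda>x. Option.bind (f x) (\<lambda>a. Option.bind (g x) (\<lambda>b. Some (prod_encode (a, b)))))"
| comp: "partial_recursive f \<Longrightarrow> partial_recursive g \<Longrightarrow>
    partial_recursive (\<lambda>x. Option.bind (g x) f)"
| prec: "partial_recursive f \<Longrightarrow> partial_recursive g \<Longrightarrow>
    partial_recursive (\<lambda>x. rec_nat (f (fst (prod_decode x)))
      (\<lambda>m r. Option.bind r (\<lambda>i. g (prod_encode (fst (prod_decode x), prod_encode (m, i)))))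
      (snd (prod_decode x)))"
| mu: "partial_recursive f \<Longrightarrow>
    partial_recursive (\<lambda>x.
      if \<exists>y. f (prod_encode (x, y)) = Some 0 \<and> (\<forall>z<y. f (prod_encode (x, z)) \<noteq> None)
      then Some (LEAST y. f (prod_encode (x, y)) = Some 0) else None)"


section \<open>Free groups of finite rank\<close>

text \<open>The letter \<open>(i, True)\<close> is the basis element with index \<open>i\<close> and \<open>(i, False)\<close> its inverse.\<close>

type_synonym letter = "nat \<times> bool"
type_synonym word = "letter list"

definition flip :: "letter \<Rightarrow> letter" where
  "flip a = (fst a, \<not> snd a)"

definition words :: "nat \<Rightarrow> word set" where
  "words n = lists ({..<n} \<times> UNIV)"

definition reduced :: "word \<Rightarrow> bool" where
  "reduced w \<longleftrightarrow> successively (\<lambda>a b. b \<noteq> flip a) w"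

fun red_Cons :: "letter \<Rightarrow> word \<Rightarrow> word" where
  "red_Cons a [] = [a]"
| "red_Cons a (b # w) = (if b = flip a then w else a # b # w)"

definition reduce :: "word \<Rightarrow> word" where
  "reduce w = foldr red_Cons w []"

definition free_group :: "nat \<Rightarrow> word monoid" where
  "free_group n = \<lparr>carrier = {w \<in> words n. reduced w}, mult = (\<lambda>u v. reduce (u @ v)), one = []\<rparr>"

lemma flip_flip [simp]: "flip (flip a) = a"
  by (simp add: flip_def)

lemma reduced_red_Cons: "reduced w \<Longrightarrow> reduced (red_Cons a w)"
  by (cases w) (auto simp: reduced_def successively_Cons)

lemma reduced_foldr: "reduced v \<Longrightarrow> reduced (foldr red_Cons u v)"
  by (induction u) (auto intro: reduced_red_Cons)

lemma reduced_reduce: "reduced (reduce w)"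
  unfolding reduce_def by (rule reduced_foldr) (simp add: reduced_def)

lemma reduce_reduced: "reduced w \<Longrightarrow> reduce w = w"
proof (induction w)
  case (Cons a w)
  then show ?case
    by (cases w) (auto simp: reduce_def reduced_def)
qed (simp add: reduce_def)

lemma red_Cons_flip: "reduced w \<Longrightarrow> red_Cons a (red_Cons (flip a) w) = w"
proof (cases w)
  case (Cons b v)
  assume "reduced w"
  then show ?thesis
    by (cases v) (auto simp: Cons reduced_def)
qed simp

lemma foldr_red_Cons:
  assumes "reduced u" "reduced v"
  shows "foldr red_Cons (red_Cons a u) v = red_Cons a (foldr red_Cons u v)"
proof (cases u)
  case (Cons b w)
  show ?thesis
  proof (cases "b = flip a")
    case True
    then show ?thesis
      using red_Cons_flip[OF reduced_foldr[OF assms(2)]] by (simp add: Cons)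
  qed (simp add: Cons)
qed simp

lemma foldr_reduce: "reduced v \<Longrightarrow> foldr red_Cons (reduce u) v = foldr red_Cons u v"
proof (induction u)
  case (Cons a u)
  have "reduce (a # u) = red_Cons a (reduce u)"
    by (simp add: reduce_def)
  then show ?case
    using Cons by (simp add: foldr_red_Cons reduced_reduce)
qed (simp add: reduce_def)

lemma reduce_append: "reduce (u @ v) = foldr red_Cons u (reduce v)"
  by (simp add: reduce_def)

lemma reduce_append_left: "reduce (reduce u @ v) = reduce (u @ v)"
  by (simp add: reduce_append foldr_reduce reduced_reduce)

lemma reduce_append_right: "reduce (u @ reduce v) = reduce (u @ v)"
  by (simp add: reduce_append reduce_reduced reduced_reduce)

lemma reduce_words: "w \<in> words n \<Longrightarrow> reduce w \<in> words n"
proof -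
  have "red_Cons a w \<in> words n" if "a \<in> {..<n} \<times> UNIV" "w \<in> words n" for a w
    using that by (cases w) (auto simp: words_def)
  then show "w \<in> words n \<Longrightarrow> reduce w \<in> words n"
    by (induction w) (auto simp: reduce_def words_def)
qed

lemma reduce_inverse: "reduce (map flip (rev w) @ w) = []"
proof (induction w)
  case (Cons a w)
  have "reduce (flip a # a # w) = red_Cons (flip a) (red_Cons (flip (flip a)) (reduce w))"
    by (simp add: reduce_def)
  also have "\<dots> = reduce w"
    by (rule red_Cons_flip) (rule reduced_reduce)
  finally have "reduce (flip a # a # w) = reduce w" .
  then have "reduce (map flip (rev w) @ flip a # a # w) = reduce (map flip (rev w) @ w)"
    by (simp only: reduce_append)
  then show ?case
    using Cons by simp
qed (simp add: reduce_def)

lemma group_free_group: "group (free_group n)"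
proof (rule groupI)
  fix x y z
  assume "x \<in> carrier (free_group n)" "y \<in> carrier (free_group n)" "z \<in> carrier (free_group n)"
  then show "x \<otimes>\<^bsub>free_group n\<^esub> y \<otimes>\<^bsub>free_group n\<^esub> z = x \<otimes>\<^bsub>free_group n\<^esub> (y \<otimes>\<^bsub>free_group n\<^esub> z)"
    by (simp add: free_group_def reduce_append_left reduce_append_right)
next
  fix x assume x: "x \<in> carrier (free_group n)"
  then have "\<forall>a\<in>set x. a \<in> {..<n} \<times> UNIV"
    by (simp add: free_group_def words_def in_lists_conv_set)
  then have "map flip (rev x) \<in> words n"
    by (fastforce simp: words_def flip_def in_lists_conv_set)
  then have "reduce (map flip (rev x)) \<in> carrier (free_group n)"
    by (simp add: free_group_def reduce_words reduced_reduce)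
  then show "\<exists>y\<in>carrier (free_group n). y \<otimes>\<^bsub>free_group n\<^esub> x = \<one>\<^bsub>free_group n\<^esub>"
    by (rule rev_bexI) (simp add: free_group_def reduce_append_left reduce_inverse)
next
  fix x y assume "x \<in> carrier (free_group n)" "y \<in> carrier (free_group n)"
  then have "x @ y \<in> words n"
    by (auto simp: free_group_def words_def)
  then show "x \<otimes>\<^bsub>free_group n\<^esub> y \<in> carrier (free_group n)"
    by (simp add: free_group_def reduce_words reduced_reduce)
next
  show "\<one>\<^bsub>free_group n\<^esub> \<in> carrier (free_group n)"
    by (simp add: free_group_def words_def reduced_def)
next
  fix x assume "x \<in> carrier (free_group n)"
  then show "\<one>\<^bsub>free_group n\<^esub> \<otimes>\<^bsub>free_group n\<^esub> x = x"
    by (simp add: free_group_def reduce_reduced)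
qed

definition malnormal_cyclic_family :: "('a, 'b) monoid_scheme \<Rightarrow> 'a list \<Rightarrow> bool" where
  "malnormal_cyclic_family G ws \<longleftrightarrow>
     (\<forall>w\<in>set ws. w \<in> carrier G \<and> w \<noteq> \<one>\<^bsub>G\<^esub>) \<and>
     (\<forall>i<length ws. \<forall>j<length ws. \<forall>g\<in>carrier G.
        (g <#\<^bsub>G\<^esub> generate G {ws ! i} #>\<^bsub>G\<^esub> inv\<^bsub>G\<^esub> g) \<inter> generate G {ws ! j} \<noteq> {\<one>\<^bsub>G\<^esub>} \<longrightarrow>
        i = j \<and> g \<in> generate G {ws ! i})"


section \<open>The Cayley tree and its Gromov boundary\<close>

definition cayley_edges :: "nat \<Rightarrow> (word \<times> word) set" where
  "cayley_edges n = {(g, g \<otimes>\<^bsub>free_group n\<^esub> [a]) | g a. g \<in> carrier (free_group n) \<and> fst a < n}"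

definition cayley_dist :: "nat \<Rightarrow> word \<Rightarrow> word \<Rightarrow> nat" where
  "cayley_dist n g h = (LEAST k. (g, h) \<in> cayley_edges n ^^ k)"

definition gromov_product :: "nat \<Rightarrow> word \<Rightarrow> word \<Rightarrow> real" where
  "gromov_product n g h =
     (real (cayley_dist n [] g) + real (cayley_dist n [] h) - real (cayley_dist n g h)) / 2"

text \<open>Boundary points are classes of sequences converging to infinity. Sequences of vertices
  suffice, since every point of the tree is within distance 1/2 of a vertex.\<close>

definition converge_together :: "nat \<Rightarrow> (nat \<Rightarrow> word) \<Rightarrow> (nat \<Rightarrow> word) \<Rightarrow> bool" where
  "converge_together n x y \<longleftrightarrow>
     (LIM (i, j) sequentially \<times>\<^sub>F sequentially. gromov_product n (x i) (y j) :> at_top)"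

definition boundary_sequences :: "nat \<Rightarrow> (nat \<Rightarrow> word) set" where
  "boundary_sequences n = {x. range x \<subseteq> carrier (free_group n) \<and> converge_together n x x}"

definition boundary_rel :: "nat \<Rightarrow> ((nat \<Rightarrow> word) \<times> (nat \<Rightarrow> word)) set" where
  "boundary_rel n =
     {(x, y). x \<in> boundary_sequences n \<and> y \<in> boundary_sequences n \<and> converge_together n x y}"

type_synonym bpoint = "(nat \<Rightarrow> word) set"

definition boundary :: "nat \<Rightarrow> bpoint set" where
  "boundary n = boundary_sequences n // boundary_rel n"

definition boundary_lim :: "nat \<Rightarrow> (nat \<Rightarrow> word) \<Rightarrow> bpoint" where
  "boundary_lim n x = boundary_rel n `` {x}"

definition boundary_nbhd :: "nat \<Rightarrow> bpoint \<Rightarrow> real \<Rightarrow> bpoint set" where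
  "boundary_nbhd n p r = {q \<in> boundary n. \<exists>x\<in>p. \<exists>y\<in>q.
     ereal r \<le> Liminf (sequentially \<times>\<^sub>F sequentially) (\<lambda>(i, j). ereal (gromov_product n (x i) (y j)))}"

definition boundary_open :: "nat \<Rightarrow> bpoint set \<Rightarrow> bool" where
  "boundary_open n U \<longleftrightarrow> U \<subseteq> boundary n \<and> (\<forall>p\<in>U. \<exists>r. boundary_nbhd n p r \<subseteq> U)"

lemma boundary_nbhd_antimono: "r \<le> s \<Longrightarrow> boundary_nbhd n p s \<subseteq> boundary_nbhd n p r"
  unfolding boundary_nbhd_def by (blast intro: order_trans ereal_less_eq(3)[THEN iffD2])

lemma istopology_boundary_open: "istopology (boundary_open n)"
proof -
  have "boundary_open n (S \<inter> T)" if S: "boundary_open n S" and T: "boundary_open n T" for S T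
  proof -
    have "\<exists>r. boundary_nbhd n p r \<subseteq> S \<inter> T" if p: "p \<in> S \<inter> T" for p
    proof -
      from S T p obtain r s where "boundary_nbhd n p r \<subseteq> S" "boundary_nbhd n p s \<subseteq> T"
        unfolding boundary_open_def by blast
      then have "boundary_nbhd n p (max r s) \<subseteq> S \<inter> T"
        using boundary_nbhd_antimono[of r "max r s"] boundary_nbhd_antimono[of s "max r s"]
        by (meson le_infI max.cobounded1 max.cobounded2 order_trans)
      then show ?thesis ..
    qed
    then show ?thesis
      using S unfolding boundary_open_def by blast
  qed
  moreover have "boundary_open n (\<Union>\<K>)" if "\<forall>K\<in>\<K>. boundary_open n K" for \<K>
    using that unfolding boundary_open_def by (meson Sup_least Sup_upper UnionE order_trans)
  ultimately show ?thesis
    unfolding istopology_def by blast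
qed

definition boundary_topology :: "nat \<Rightarrow> bpoint topology" where
  "boundary_topology n = topology (boundary_open n)"

definition boundary_act :: "nat \<Rightarrow> word \<Rightarrow> bpoint \<Rightarrow> bpoint" where
  "boundary_act n g p = (\<lambda>x i. g \<otimes>\<^bsub>free_group n\<^esub> x i) ` p"


section \<open>The decomposition space\<close>

text \<open>A line \<open>{g w\<^sup>k}\<close> of the pattern enters only through its pair of end points.\<close>

definition line_pattern :: "nat \<Rightarrow> word list \<Rightarrow> (bpoint \<times> bpoint) set" where
  "line_pattern n ws =
     {(boundary_lim n (\<lambda>k. g \<otimes>\<^bsub>free_group n\<^esub> w [^]\<^bsub>free_group n\<^esub> int k),
       boundary_lim n (\<lambda>k. g \<otimes>\<^bsub>free_group n\<^esub> w [^]\<^bsub>free_group n\<^esub> (- int k)))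
      | g w. g \<in> carrier (free_group n) \<and> w \<in> set ws}"

definition decomp_rel :: "nat \<Rightarrow> word list \<Rightarrow> (bpoint \<times> bpoint) set" where
  "decomp_rel n ws =
     (line_pattern n ws \<union> (line_pattern n ws)\<inverse>)\<^sup>* \<inter> boundary n \<times> boundary n"

definition quotient_topology :: "'a topology \<Rightarrow> ('a \<times> 'a) set \<Rightarrow> 'a set topology" where
  "quotient_topology X R = topology (\<lambda>U. U \<subseteq> topspace X // R \<and> openin X (\<Union>U))"

lemma istopology_quotient:
  assumes R: "equiv (topspace X) R"
  shows "istopology (\<lambda>U. U \<subseteq> topspace X // R \<and> openin X (\<Union>U))"
proof -
  have "openin X (\<Union>(S \<inter> T))"
    if "S \<subseteq> topspace X // R" "T \<subseteq> topspace X // R" "openin X (\<Union>S)" "openin X (\<Union>T)" for S T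
  proof -
    have "\<Union>(S \<inter> T) = \<Union>S \<inter> \<Union>T"
    proof
      show "\<Union>S \<inter> \<Union>T \<subseteq> \<Union>(S \<inter> T)"
      proof
        fix x assume "x \<in> \<Union>S \<inter> \<Union>T"
        then obtain A B where "x \<in> A" "A \<in> S" "x \<in> B" "B \<in> T" by blast
        moreover from this have "A = B"
          using quotient_disj[OF R, of A B] that(1,2) by blast
        ultimately show "x \<in> \<Union>(S \<inter> T)" by blast
      qed
    qed blast
    then show ?thesis using that by (simp add: openin_Int)
  qed
  moreover have "openin X (\<Union>(\<Union>\<K>))" if "\<forall>K\<in>\<K>. openin X (\<Union>K)" for \<K> :: "'a set set set"
  proof -
    have "\<Union>(\<Union>\<K>) = (\<Union>K\<in>\<K>. \<Union>K)" by blast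
    moreover have "openin X (\<Union>K\<in>\<K>. \<Union>K)"
      using that by (intro openin_Union) auto
    ultimately show ?thesis by simp
  qed
  ultimately show ?thesis
    unfolding istopology_def by (meson Sup_least le_infI1)
qed

lemma topspace_boundary [simp]: "topspace (boundary_topology n) = boundary n"
proof -
  have op: "openin (boundary_topology n) = boundary_open n"
    unfolding boundary_topology_def by (rule topology_inverse'[OF istopology_boundary_open])
  have "boundary_open n (boundary n)"
    by (auto simp: boundary_open_def boundary_nbhd_def)
  moreover have "U \<subseteq> boundary n" if "boundary_open n U" for U
    using that by (simp add: boundary_open_def)
  ultimately show ?thesis
    unfolding topspace_def op by blast
qed

lemma equiv_decomp_rel: "equiv (boundary n) (decomp_rel n ws)"
proof (rule equivI)
  let ?E = "line_pattern n ws \<union> (line_pattern n ws)\<inverse>"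
  show "decomp_rel n ws \<subseteq> boundary n \<times> boundary n"
    unfolding decomp_rel_def by (rule Int_lower2)
  show "refl_on (boundary n) (decomp_rel n ws)"
    by (rule refl_onI) (simp add: decomp_rel_def)
  have "sym ?E"
    by (simp add: sym_Un_converse)
  then have "sym (?E\<^sup>*)"
    by (rule sym_rtrancl)
  then show "sym (decomp_rel n ws)"
    unfolding decomp_rel_def by (rule sym_Int) (simp add: sym_def)
  show "trans (decomp_rel n ws)"
    unfolding decomp_rel_def by (rule trans_Int[OF trans_rtrancl]) (simp add: trans_def)
qed

definition decomposition_space :: "nat \<Rightarrow> word list \<Rightarrow> bpoint set topology" where
  "decomposition_space n ws = quotient_topology (boundary_topology n) (decomp_rel n ws)"

definition decomp_act :: "nat \<Rightarrow> word \<Rightarrow> bpoint set \<Rightarrow> bpoint set" where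
  "decomp_act n g P = boundary_act n g ` P"


section \<open>Cech cohomology with integer coefficients\<close>

text \<open>The cohomology of the nerve is computed with ordered simplices (tuples of vertices that
  span a simplex, repetitions allowed).\<close>

definition open_covers :: "'a topology \<Rightarrow> 'a set set set" where
  "open_covers X = {U. (\<forall>V\<in>U. openin X V) \<and> \<Union>U = topspace X}"

definition nerve_simplices :: "'a set set \<Rightarrow> nat \<Rightarrow> 'a set list set" where
  "nerve_simplices U p = {vs. length vs = Suc p \<and> set vs \<subseteq> U \<and> \<Inter>(set vs) \<noteq> {}}"

type_synonym 'a cochain = "'a set list \<Rightarrow> int"

definition cochains :: "'a set set \<Rightarrow> nat \<Rightarrow> 'a cochain set" where
  "cochains U p = {c. \<forall>vs. vs \<notin> nerve_simplices U p \<longrightarrow> c vs = 0}"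

definition coboundary :: "'a set set \<Rightarrow> nat \<Rightarrow> 'a cochain \<Rightarrow> 'a cochain" where
  "coboundary U p c = (\<lambda>vs. if vs \<in> nerve_simplices U (Suc p)
     then \<Sum>i\<le>Suc p. (- 1) ^ i * c (take i vs @ drop (Suc i) vs) else 0)"

definition cocycles :: "'a set set \<Rightarrow> nat \<Rightarrow> 'a cochain set" where
  "cocycles U p = {c \<in> cochains U p. coboundary U p c = (\<lambda>vs. 0)}"

definition coboundaries :: "'a set set \<Rightarrow> nat \<Rightarrow> 'a cochain set" where
  "coboundaries U p = (case p of 0 \<Rightarrow> {\<lambda>vs. 0} | Suc q \<Rightarrow> coboundary U q ` cochains U q)"

definition refines_via :: "('a \<Rightarrow> 'b) \<Rightarrow> ('a set \<Rightarrow> 'b set) \<Rightarrow> 'a set set \<Rightarrow> 'b set set \<Rightarrow> bool" where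
  "refines_via f \<phi> W U \<longleftrightarrow> (\<forall>w\<in>W. \<phi> w \<in> U \<and> f ` w \<subseteq> \<phi> w)"

definition cochain_pullback ::
    "('a set \<Rightarrow> 'b set) \<Rightarrow> 'a set set \<Rightarrow> nat \<Rightarrow> 'b cochain \<Rightarrow> 'a cochain" where
  "cochain_pullback \<phi> W p c = (\<lambda>vs. if vs \<in> nerve_simplices W p then c (map \<phi> vs) else 0)"

text \<open>The direct limit: a class is represented by a cover together with a cocycle of its nerve,
  and two representatives are identified if they become cohomologous on a common refinement.\<close>

definition cech_rel :: "'a topology \<Rightarrow> nat \<Rightarrow>
    (('a set set \<times> 'a cochain) \<times> ('a set set \<times> 'a cochain)) set" where
  "cech_rel X p = {((U, c), (V, d)).
     U \<in> open_covers X \<and> c \<in> cocycles U p \<and> V \<in> open_covers X \<and> d \<in> cocycles V p \<and>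
     (\<exists>W\<in>open_covers X. \<exists>\<phi> \<psi>. refines_via id \<phi> W U \<and> refines_via id \<psi> W V \<and>
        (\<lambda>vs. cochain_pullback \<phi> W p c vs - cochain_pullback \<psi> W p d vs) \<in> coboundaries W p)}"

type_synonym 'a cech_class = "('a set set \<times> 'a cochain) set"

definition cech_cohomology :: "'a topology \<Rightarrow> nat \<Rightarrow> 'a cech_class monoid" where
  "cech_cohomology X p = \<lparr>
     carrier = {(U, c). U \<in> open_covers X \<and> c \<in> cocycles U p} // cech_rel X p,
     mult = (\<lambda>A B. cech_rel X p `` {(W, \<lambda>vs. c vs + d vs) | W c d. (W, c) \<in> A \<and> (W, d) \<in> B}),
     one = cech_rel X p `` {({topspace X}, \<lambda>vs. 0)}\<rparr>"

definition cech_pullback :: "'a topology \<Rightarrow> nat \<Rightarrow> ('a \<Rightarrow> 'b) \<Rightarrow> 'b cech_class \<Rightarrow> 'a cech_class" where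
  "cech_pullback X p f A = cech_rel X p ``
     {(W, cochain_pullback \<phi> W p c) | W \<phi> U c.
        (U, c) \<in> A \<and> W \<in> open_covers X \<and> refines_via f \<phi> W U}"


section \<open>Right modules over a group\<close>

text \<open>A right module over the integral group ring of \<open>G\<close> is an abelian group with a right action
  of \<open>G\<close> by automorphisms; submodules are the \<open>G\<close>-invariant subgroups and module homomorphisms
  the \<open>G\<close>-equivariant group homomorphisms. The addition and zero of a module
  are the \<open>mult\<close> and \<open>one\<close> of the underlying monoid record.\<close>

record ('m, 'g) right_module = "'m monoid" +
  act :: "'m \<Rightarrow> 'g \<Rightarrow> 'm"

definition right_module_isomorphic ::
    "('g, 'c) monoid_scheme \<Rightarrow> ('m, 'g) right_module \<Rightarrow> ('k, 'g) right_module \<Rightarrow> bool" where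
  "right_module_isomorphic G M N \<longleftrightarrow>
     (\<exists>\<phi>\<in>iso M N. \<forall>m\<in>carrier M. \<forall>g\<in>carrier G. \<phi> (act M m g) = act N (\<phi> m) g)"

text \<open>The free right module of rank \<open>k\<close> over the group ring: the vector \<open>x\<close> has in position
  \<open>i < k\<close> the group ring element \<open>\<Sum>h. x i h \<cdot> h\<close>, and \<open>G\<close> acts by right multiplication.\<close>

definition free_right_module ::
    "('g, 'c) monoid_scheme \<Rightarrow> nat \<Rightarrow> (nat \<Rightarrow> 'g \<Rightarrow> int, 'g) right_module" where
  "free_right_module G k = \<lparr>
     carrier = {x. (\<forall>i h. x i h \<noteq> 0 \<longrightarrow> i < k \<and> h \<in> carrier G) \<and> finite {(i, h). x i h \<noteq> 0}},
     mult = (\<lambda>x y i h. x i h + y i h),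
     one = (\<lambda>i h. 0),
     act = (\<lambda>x g i h. if h \<in> carrier G then x i (h \<otimes>\<^bsub>G\<^esub> inv\<^bsub>G\<^esub> g) else 0)\<rparr>"

definition submodule_generated ::
    "('g, 'c) monoid_scheme \<Rightarrow> ('m, 'g) right_module \<Rightarrow> 'm set \<Rightarrow> 'm set" where
  "submodule_generated G M S =
     \<Inter>{N. subgroup N M \<and> S \<subseteq> N \<and> (\<forall>x\<in>N. \<forall>g\<in>carrier G. act M x g \<in> N)}"

definition quotient_module ::
    "('m, 'g) right_module \<Rightarrow> 'm set \<Rightarrow> ('m set, 'g) right_module" where
  "quotient_module M N = \<lparr>
     carrier = carrier (M Mod N), mult = mult (M Mod N), one = one (M Mod N),
     act = (\<lambda>C g. (\<lambda>x. act M x g) ` C)\<rparr>"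

definition cech_module :: "nat \<Rightarrow> word list \<Rightarrow> nat \<Rightarrow> (bpoint set cech_class, word) right_module" where
  "cech_module n ws p = (let X = decomposition_space n ws; H = cech_cohomology X p in \<lparr>
     carrier = carrier H, mult = mult H, one = one H,
     act = (\<lambda>A g. cech_pullback X p (decomp_act n g) A)\<rparr>)"


section \<open>Finite descriptions and their codes\<close>

text \<open>A list of pairs \<open>(c, u)\<close> stands for the group ring element \<open>\<Sum> c \<cdot> u\<close>, where \<open>u\<close> need
  not be a reduced word.\<close>

type_synonym ring_expr = "(int \<times> word) list"

definition vector_of :: "ring_expr list \<Rightarrow> nat \<Rightarrow> word \<Rightarrow> int" where
  "vector_of v i h =
     (if i < length v then \<Sum>(c, u)\<leftarrow>v ! i. if reduce u = h then c else 0 else 0)"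

definition vector_exprs :: "nat \<Rightarrow> nat \<Rightarrow> ring_expr list set" where
  "vector_exprs n k = {v. length v = k \<and> (\<forall>e\<in>set v. \<forall>(c, u)\<in>set e. u \<in> words n)}"

definition presented_module ::
    "nat \<Rightarrow> nat \<Rightarrow> ring_expr list list \<Rightarrow> ((nat \<Rightarrow> word \<Rightarrow> int) set, word) right_module" where
  "presented_module n k rels =
     quotient_module (free_right_module (free_group n) k)
       (submodule_generated (free_group n) (free_right_module (free_group n) k)
         (vector_of ` set rels))"

definition word_code :: "word \<Rightarrow> nat" where
  "word_code w = list_encode (map (\<lambda>(i, b). prod_encode (i, of_bool b)) w)"

definition input_code :: "nat \<Rightarrow> word list \<Rightarrow> nat" where
  "input_code n ws = prod_encode (n, list_encode (map word_code ws))"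

definition ring_expr_code :: "ring_expr \<Rightarrow> nat" where
  "ring_expr_code e = list_encode (map (\<lambda>(c, u). prod_encode (int_encode c, word_code u)) e)"

definition presentation_code :: "nat \<Rightarrow> ring_expr list list \<Rightarrow> nat" where
  "presentation_code k rels =
     prod_encode (k, list_encode (map (\<lambda>v. list_encode (map ring_expr_code v)) rels))"

end

theory Submission
  imports Defs
begin

text \<open>
  The degree-zero cohomology of the decomposition space is the module of integer functions on the
  boundary of the free group that agree at the two ends of every line and, by compactness, are
  determined by a prefix of bounded length. For a suitable depth \<open>D\<close>, the finitely many invariant
  clopen sets of depth \<open>D\<close> generate this module: an invariant set of greater depth is cut into
  shadows, and what matters of a part in a shadow is its trace on the finitely many lines leaving the
  shadow. The set of traces realised with \<open>r\<close> further letters grows with \<open>r\<close>, and once one step does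
  not enlarge it, no later step does. Hence it is stable from an explicit \<open>r\<close> on, bounded by the
  number of letters times the number of possible traces.

  The relations between these generators are generated by those saying that a set is a disjoint union
  of two others, or a translate of another by a letter. In an arbitrary relation, the coefficient
  function of a longest group element still has depth \<open>D\<close> after a translation that shortens the
  element, which lowers the length of the relation. Both lists are found by a finite search over sets
  of words of length \<open>D\<close>.
\<close>

section \<open>Computable functions between encoded types\<close>

text \<open>The restriction of an invariant function to a shadow is in general not invariant,
  because lines leave the shadow; so the parts cannot be translated one by one. The remedy is to
  subtract an invariant set of smaller depth that has the same values at the ends of all leaving
  lines. The difference vanishes at those ends, its restriction to each shadow is invariant, and
  translating the shadow back to the identity strips the letters of its word, which brings the depth
  down to \<open>D\<close>. Equality of traces is exactly what allows a part to be exchanged for a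
  shallower one and the parts to be glued again. Traces can be counted effectively because a line
  whose ends begin with different letters passes near the identity and therefore has a base point in
  a ball of known radius. For relations, the point is that among the elements of length at most
  \<open>Suc l\<close> only \<open>b # h\<close> itself cancels \<open>Suc l\<close> letters of a
  point that begins with its inverse. All other terms still see \<open>D\<close> known letters, so
  the leading term, being minus their sum, depends on those letters alone.\<close>

definition recursive :: "(nat \<Rightarrow> nat) \<Rightarrow> bool" where
  "recursive g \<longleftrightarrow> partial_recursive (\<lambda>x. Some (g x))"

lemma recursive_Suc: "recursive Suc"
  and recursive_left: "recursive (\<lambda>x. fst (prod_decode x))"
  and recursive_right: "recursive (\<lambda>x. snd (prod_decode x))"
  unfolding recursive_def by (auto intro: partial_recursive.intros)

lemma recursive_comp: "recursive f \<Longrightarrow> recursive g \<Longrightarrow> recursive (\<lambda>x. f (g x))"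
  unfolding recursive_def using partial_recursive.comp[of "\<lambda>x. Some (f x)" "\<lambda>x. Some (g x)"] by simp

lemma recursive_pair: "recursive f \<Longrightarrow> recursive g \<Longrightarrow> recursive (\<lambda>x. prod_encode (f x, g x))"
  unfolding recursive_def using partial_recursive.pair[of "\<lambda>x. Some (f x)" "\<lambda>x. Some (g x)"] by simp

lemma recursive_id: "recursive (\<lambda>x. x)"
  using recursive_pair[OF recursive_left recursive_right] by simp

lemma recursive_const: "recursive (\<lambda>x. c)"
proof (induction c)
  case 0
  then show ?case
    unfolding recursive_def by (rule partial_recursive.zero)
next
  case (Suc c)
  then show ?case
    by (rule recursive_comp[OF recursive_Suc])
qed

text \<open>\<open>prec\<close> recurses on the second component of its argument and keeps the first
  as a parameter. Applied to the pair of \<open>x\<close> and \<open>N x\<close>, it gives a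
  recursion whose base, step and length may all depend on the whole input.\<close>

lemma recursive_rec_nat:
  assumes F: "recursive F" and H: "recursive H" and N: "recursive N"
  shows "recursive (\<lambda>x. rec_nat (F x) (\<lambda>m r. H (prod_encode (x, prod_encode (m, r)))) (N x))"
proof -
  \<comment> \<open>Total base and step functions never produce \<open>None\<close>, so the
    option-valued recursion is an ordinary one under \<open>Some\<close>.\<close>
  have "rec_nat (Some a) (\<lambda>m r. Option.bind r (\<lambda>i. Some (h m i))) n = Some (rec_nat a h n)"
    for a :: nat and h n
    by (induction n) auto
  then have "recursive (\<lambda>x. rec_nat (F (fst (prod_decode x)))
      (\<lambda>m i. H (prod_encode (fst (prod_decode x), prod_encode (m, i)))) (snd (prod_decode x)))"
    using partial_recursive.prec[of "\<lambda>x. Some (F x)" "\<lambda>x. Some (H x)"] F H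
    unfolding recursive_def by simp
  from recursive_comp[OF this recursive_pair[OF recursive_id N]] show ?thesis
    by simp
qed

text \<open>Only injectivity is asked of a code, never a decoder. The instances follow the codes
  prescribed for inputs and outputs, so that \<open>enc\<close> becomes \<open>input_code\<close>
  and \<open>presentation_code\<close> on the types in question.\<close>

class encodable =
  fixes enc :: "'a \<Rightarrow> nat"
  assumes inj_enc: "inj enc"

lemma enc_eq_iff [simp]: "enc x = enc y \<longleftrightarrow> x = y"
  by (rule inj_eq[OF inj_enc])

instantiation nat :: encodable begin
definition enc_nat :: "nat \<Rightarrow> nat" where [simp]: "enc_nat n = n"
instance by standard (simp add: inj_def)
end

instantiation bool :: encodable begin
definition enc_bool :: "bool \<Rightarrow> nat" where [simp]: "enc_bool b = of_bool b"
instance by standard (simp add: inj_def)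
end

instantiation int :: encodable begin
definition enc_int :: "int \<Rightarrow> nat" where "enc_int = int_encode"
instance by standard (simp add: enc_int_def inj_int_encode)
end

instantiation prod :: (encodable, encodable) encodable begin
definition enc_prod :: "'a \<times> 'b \<Rightarrow> nat" where "enc_prod p = prod_encode (enc (fst p), enc (snd p))"
instance by standard (auto simp: enc_prod_def inj_def)
end

instantiation list :: (encodable) encodable begin
definition enc_list :: "'a list \<Rightarrow> nat" where "enc_list xs = list_encode (map enc xs)"
instance
proof
  have "inj (list_encode \<circ> map (enc :: 'a \<Rightarrow> nat))"
    by (intro inj_compose inj_list_encode inj_mapI inj_enc)
  then show "inj (enc :: 'a list \<Rightarrow> nat)"
    by (simp add: enc_list_def inj_def)
qed
end

lemma enc_Pair [simp]: "enc (a, b) = prod_encode (enc a, enc b)"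
  by (simp add: enc_prod_def)

lemma enc_Nil [simp]: "enc [] = 0" and enc_Cons [simp]: "enc (x # xs) = Suc (prod_encode (enc x, enc xs))"
  by (simp_all add: enc_list_def)

text \<open>The code of a list is the fuel of a loop over it: that many rounds are enough, and the
  length need not be computed beforehand.\<close>

lemma length_le_enc: "length xs \<le> enc xs"
proof (induction xs)
  case (Cons x xs)
  then show ?case
    using le_prod_encode_2[of "enc xs" "enc x"] by simp
qed simp

text \<open>The values of \<open>g\<close> off the range of \<open>enc\<close> are left free, so no
  number has to be recognised as a valid code.\<close>

definition computable :: "('a::encodable \<Rightarrow> 'b::encodable) \<Rightarrow> bool" where
  "computable f \<longleftrightarrow> (\<exists>g. recursive g \<and> (\<forall>x. g (enc x) = enc (f x)))"

lemma computableI: "recursive g \<Longrightarrow> (\<And>x. g (enc x) = enc (f x)) \<Longrightarrow> computable f"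
  unfolding computable_def by blast

section \<open>Closure properties of computable functions\<close>

named_theorems computable_intros

lemma computable_id [computable_intros]: "computable (\<lambda>x. x)"
  by (rule computableI[OF recursive_id]) simp

lemma computable_const [computable_intros]: "computable (\<lambda>x. c)"
  by (rule computableI[OF recursive_const[of "enc c"]]) simp

lemma computable_comp:
  assumes "computable f" "computable g"
  shows "computable (\<lambda>x. f (g x))"
proof -
  from assms(1) obtain f' where "recursive f'" "\<And>x. f' (enc x) = enc (f x)"
    unfolding computable_def by blast
  moreover from assms(2) obtain g' where "recursive g'" "\<And>x. g' (enc x) = enc (g x)"
    unfolding computable_def by blast
  ultimately show ?thesis
    by (intro computableI[OF recursive_comp[of f' g']]) auto
qed

lemma computable_Pair [computable_intros]:
  assumes "computable f" "computable g"
  shows "computable (\<lambda>x. (f x, g x))"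
proof -
  from assms(1) obtain f' where "recursive f'" "\<And>x. f' (enc x) = enc (f x)"
    unfolding computable_def by blast
  moreover from assms(2) obtain g' where "recursive g'" "\<And>x. g' (enc x) = enc (g x)"
    unfolding computable_def by blast
  ultimately show ?thesis
    by (intro computableI[OF recursive_pair[of f' g']]) auto
qed

lemma computable_fst [computable_intros]: "computable f \<Longrightarrow> computable (\<lambda>x. fst (f x))"
  by (rule computable_comp[of fst], rule computableI[OF recursive_left]) (auto simp: enc_prod_def)

lemma computable_snd [computable_intros]: "computable f \<Longrightarrow> computable (\<lambda>x. snd (f x))"
  by (rule computable_comp[of snd], rule computableI[OF recursive_right]) (auto simp: enc_prod_def)

lemma computable_Suc [computable_intros]: "computable f \<Longrightarrow> computable (\<lambda>x. Suc (f x))"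
  by (rule computable_comp[of Suc], rule computableI[OF recursive_Suc]) auto

lemma computable_enc [computable_intros]: "computable f \<Longrightarrow> computable (\<lambda>x. enc (f x))"
  by (rule computable_comp[of enc], rule computableI[OF recursive_id]) auto

text \<open>A step function of several arguments is required to be computable as a function of one
  nested tuple. When \<open>intro\<close> works under a binder, the bound variables thus become
  projections of that tuple. The later rules with function arguments have the same form.\<close>

lemma computable_rec_nat [computable_intros]:
  assumes "computable F" "computable (\<lambda>p. H (fst p) (fst (snd p)) (snd (snd p)))" "computable N"
  shows "computable (\<lambda>x. rec_nat (F x) (H x) (N x))"
proof -
  from assms(1) obtain f where f: "recursive f" "\<And>x. f (enc x) = enc (F x)"
    unfolding computable_def by blast
  from assms(2) obtain h where h: "recursive h"
    "\<And>p. h (enc p) = enc (H (fst p) (fst (snd p)) (snd (snd p)))"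
    unfolding computable_def by blast
  from assms(3) obtain n where n: "recursive n" "\<And>x. n (enc x) = enc (N x)"
    unfolding computable_def by blast
  have "rec_nat (f (enc x)) (\<lambda>m r. h (prod_encode (enc x, prod_encode (m, r)))) k
      = enc (rec_nat (F x) (H x) k)" for x k
  proof (induction k)
    case (Suc k)
    then show ?case
      using h(2)[of "(x, k, rec_nat (F x) (H x) k)"] by simp
  qed (simp add: f)
  with n(2) show ?thesis
    by (intro computableI[OF recursive_rec_nat[OF f(1) h(1) n(1)]]) simp
qed

text \<open>The code of a truth value is 0 or 1, so a recursion on it takes at most one step and
  selects the branch.\<close>

lemma computable_If [computable_intros]:
  assumes "computable B" "computable F" "computable G"
  shows "computable (\<lambda>x. if B x then F x else G x)"
proof -
  have "computable (\<lambda>x. rec_nat (G x) (\<lambda>_ _. F x) (enc (B x)))"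
    by (intro computable_intros assms computable_comp[OF assms(2) computable_fst])
  moreover have "rec_nat (G x) (\<lambda>_ _. F x) (enc (B x)) = (if B x then F x else G x)" for x
    by simp
  ultimately show ?thesis by simp
qed

text \<open>The code of \<open>a # l\<close> is the successor of the paired codes of
  \<open>a\<close> and \<open>l\<close>, so the predecessor handed to the recursion step is exactly
  that pair; the recursive value is discarded.\<close>

lemma computable_case_list [computable_intros]:
  fixes L :: "'a::encodable \<Rightarrow> 'b::encodable list"
  assumes "computable F" "computable (\<lambda>p. H (fst p) (fst (snd p)) (snd (snd p)))" "computable L"
  shows "computable (\<lambda>x. case L x of [] \<Rightarrow> F x | a # l \<Rightarrow> H x a l)"
proof -
  from assms(1) obtain f where f: "recursive f" "\<And>x. f (enc x) = enc (F x)"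
    unfolding computable_def by blast
  from assms(2) obtain h where h: "recursive h"
    "\<And>p. h (enc p) = enc (H (fst p) (fst (snd p)) (snd (snd p)))"
    unfolding computable_def by blast
  from assms(3) obtain n where n: "recursive n" "\<And>x. n (enc x) = enc (L x)"
    unfolding computable_def by blast
  define h' where "h' = (\<lambda>p. h (prod_encode (fst (prod_decode p), fst (prod_decode (snd (prod_decode p))))))"
  have h': "recursive h'"
    unfolding h'_def
    by (intro recursive_comp[OF h(1)] recursive_pair recursive_left recursive_comp[OF recursive_left recursive_right])
  show ?thesis
  proof (rule computableI[OF recursive_rec_nat[OF f(1) h' n(1)]])
    fix x
    show "rec_nat (f (enc x)) (\<lambda>m r. h' (prod_encode (enc x, prod_encode (m, r)))) (n (enc x))
      = enc (case L x of [] \<Rightarrow> F x | a # l \<Rightarrow> H x a l)"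
    proof (cases "L x")
      case Nil
      then show ?thesis by (simp add: f(2) n(2))
    next
      case (Cons a l)
      have "h (prod_encode (enc x, prod_encode (enc a, enc l))) = enc (H x a l)"
        using h(2)[of "(x, a, l)"] by simp
      with Cons show ?thesis by (simp add: n(2) h'_def)
    qed
  qed
qed

text \<open>The loop state consists of the remaining list and the accumulator. The map
  \<open>S\<close> consumes one element and is idle on an empty list, so iterating it as often as
  the code of the list says, which may be too often, is harmless.\<close>

lemma computable_foldl [computable_intros]:
  fixes L :: "'a::encodable \<Rightarrow> 'b::encodable list" and F :: "'a \<Rightarrow> 'c::encodable"
  assumes "computable (\<lambda>p. H (fst p) (fst (snd p)) (snd (snd p)))" "computable F" "computable L"
  shows "computable (\<lambda>x. foldl (H x) (F x) (L x))"
proof -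
  define S where "S = (\<lambda>x (s :: 'b list \<times> 'c). case fst s of [] \<Rightarrow> s | a # l \<Rightarrow> (l, H x (snd s) a))"
  have "computable (\<lambda>p. H (fst (fst p)) (snd (snd (fst p))) (fst (snd p)))"
    by (rule computable_comp[OF assms(1), of "\<lambda>p. (fst (fst p), snd (snd (fst p)), fst (snd p))", simplified fst_conv snd_conv]) (intro computable_intros)
  then have "computable (\<lambda>p. S (fst p) (snd p))"
    unfolding S_def by (intro computable_intros)
  then have "computable (\<lambda>p. S (fst p) (snd (snd p)))"
    by (rule computable_comp[of "\<lambda>p. S (fst p) (snd p)" "\<lambda>p. (fst p, snd (snd p))", simplified fst_conv snd_conv])
      (intro computable_intros)
  then have *: "computable (\<lambda>x. snd (rec_nat (L x, F x) (\<lambda>_. S x) (enc (L x))))"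
    by (intro computable_intros assms)
  have "(\<lambda>s. rec_nat s (\<lambda>_. S x) k) (l, c) = ([], foldl (H x) c l)" if "length l \<le> k" for x k l c
    using that
  proof (induction k arbitrary: l c)
    case (Suc k)
    \<comment> \<open>Iterates of a single map commute with it, so the first round can be split off
      instead of the last.\<close>
    have r: "rec_nat s (\<lambda>_. S x) (Suc k) = rec_nat (S x s) (\<lambda>_. S x) k" for s
      by (induction k) auto
    show ?case
    proof (cases l)
      case Nil
      then show ?thesis
        using Suc.IH[of "[]" c] by (simp only: r) (simp add: S_def)
    next
      case (Cons a l')
      then show ?thesis
        using Suc.IH[of l' "H x c a"] Suc.prems by (simp only: r) (simp add: S_def)
    qed
  qed simp
  from this[OF length_le_enc] have "snd (rec_nat (L x, F x) (\<lambda>_. S x) (enc (L x))) = foldl (H x) (F x) (L x)" for x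
    by simp
  with * show ?thesis by simp
qed

lemma computable_Cons [computable_intros]:
  assumes "computable f" "computable g"
  shows "computable (\<lambda>x. f x # g x)"
proof -
  from assms(1) obtain f' where "recursive f'" "\<And>x. f' (enc x) = enc (f x)"
    unfolding computable_def by blast
  moreover from assms(2) obtain g' where "recursive g'" "\<And>x. g' (enc x) = enc (g x)"
    unfolding computable_def by blast
  ultimately show ?thesis
    by (intro computableI[OF recursive_comp[OF recursive_Suc recursive_pair[of f' g']]]) auto
qed

lemma computable_rev [computable_intros]:
  assumes "computable L"
  shows "computable (\<lambda>x. rev (L x))"
proof -
  have "computable (\<lambda>x. foldl (\<lambda>c a. a # c) [] (L x))"
    by (intro computable_intros assms)
  moreover have "foldl (\<lambda>c a. a # c) c l = rev l @ c" for l c :: "'b list"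
    by (induction l arbitrary: c) auto
  ultimately show ?thesis by simp
qed

lemma computable_foldr [computable_intros]:
  assumes "computable (\<lambda>p. H (fst p) (fst (snd p)) (snd (snd p)))" "computable F" "computable L"
  shows "computable (\<lambda>x. foldr (H x) (L x) (F x))"
proof -
  have "computable (\<lambda>p. H (fst p) (snd (snd p)) (fst (snd p)))"
    by (rule computable_comp[OF assms(1), of "\<lambda>p. (fst p, snd (snd p), fst (snd p))", simplified fst_conv snd_conv]) (intro computable_intros)
  then have "computable (\<lambda>x. foldl (\<lambda>c a. H x a c) (F x) (rev (L x)))"
    by (intro computable_intros assms)
  then show ?thesis by (simp add: foldl_conv_foldr)
qed

lemma computable_append [computable_intros]:
  assumes "computable L" "computable M"
  shows "computable (\<lambda>x. L x @ M x)"
proof -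
  have "computable (\<lambda>x. foldr (\<lambda>a c. a # c) (L x) (M x))"
    by (intro computable_intros assms)
  moreover have "foldr (\<lambda>a c. a # c) l m = l @ m" for l m :: "'b list"
    by (induction l) auto
  ultimately show ?thesis by simp
qed

lemma computable_map [computable_intros]:
  fixes f :: "'a::encodable \<Rightarrow> 'b::encodable \<Rightarrow> 'c::encodable"
  assumes "computable (\<lambda>p. f (fst p) (snd p))" "computable L"
  shows "computable (\<lambda>x. map (f x) (L x))"
proof -
  have "computable (\<lambda>p. f (fst p) (fst (snd p)))"
    by (rule computable_comp[OF assms(1), of "\<lambda>p. (fst p, fst (snd p))", simplified fst_conv snd_conv]) (intro computable_intros)
  then have "computable (\<lambda>x. foldr (\<lambda>a c. f x a # c) (L x) [])"
    by (intro computable_intros assms)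
  moreover have "foldr (\<lambda>a c. g a # c) l [] = map g l" for g :: "'b \<Rightarrow> 'c" and l
    by (induction l) auto
  ultimately show ?thesis by simp
qed

lemma computable_filter [computable_intros]:
  assumes "computable (\<lambda>p. f (fst p) (snd p))" "computable L"
  shows "computable (\<lambda>x. filter (f x) (L x))"
proof -
  have "computable (\<lambda>p. f (fst p) (fst (snd p)))"
    by (rule computable_comp[OF assms(1), of "\<lambda>p. (fst p, fst (snd p))", simplified fst_conv snd_conv]) (intro computable_intros)
  then have "computable (\<lambda>x. foldr (\<lambda>a c. if f x a then a # c else c) (L x) [])"
    by (intro computable_intros assms)
  moreover have "foldr (\<lambda>a c. if g a then a # c else c) l [] = filter g l" for g :: "'b \<Rightarrow> bool" and l
    by (induction l) auto
  ultimately show ?thesis by simp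
qed

lemma computable_concat [computable_intros]:
  assumes "computable L"
  shows "computable (\<lambda>x. concat (L x))"
proof -
  have "computable (\<lambda>x. foldr (\<lambda>a c. a @ c) (L x) [])"
    by (intro computable_intros assms)
  then show ?thesis by (simp add: concat_conv_foldr)
qed

lemma computable_length [computable_intros]:
  assumes "computable L"
  shows "computable (\<lambda>x. length (L x))"
proof -
  have "computable (\<lambda>x. foldr (\<lambda>a c. Suc c) (L x) 0)"
    by (intro computable_intros assms)
  moreover have "foldr (\<lambda>a c. Suc c) l 0 = length l" for l :: "'b list"
    by (induction l) auto
  ultimately show ?thesis by simp
qed

lemma computable_add [computable_intros]:
  assumes "computable f" "computable g"
  shows "computable (\<lambda>x. f x + g x :: nat)"
proof -
  have "computable (\<lambda>x. rec_nat (f x) (\<lambda>_. Suc) (g x))"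
    by (intro computable_intros assms)
  moreover have "rec_nat a (\<lambda>_. Suc) b = a + b" for a b
    by (induction b) auto
  ultimately show ?thesis by simp
qed

lemma computable_mult [computable_intros]:
  assumes "computable f" "computable g"
  shows "computable (\<lambda>x. f x * g x :: nat)"
proof -
  have "computable (\<lambda>x. rec_nat 0 (\<lambda>_ r. r + f x) (g x))"
    by (intro computable_intros assms computable_comp[OF assms(1) computable_fst])
  moreover have "rec_nat 0 (\<lambda>_ r. r + a) b = a * b" for a b :: nat
    by (induction b) auto
  ultimately show ?thesis by simp
qed

lemma computable_power [computable_intros]:
  assumes "computable f" "computable g"
  shows "computable (\<lambda>x. (f x :: nat) ^ g x)"
proof -
  have "computable (\<lambda>x. rec_nat 1 (\<lambda>_ r. r * f x) (g x))"
    by (intro computable_intros assms computable_comp[OF assms(1) computable_fst])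
  moreover have "rec_nat 1 (\<lambda>_ r. r * a) b = a ^ b" for a b :: nat
    by (induction b) auto
  ultimately show ?thesis by simp
qed

lemma computable_diff [computable_intros]:
  assumes "computable f" "computable g"
  shows "computable (\<lambda>x. f x - g x :: nat)"
proof -
  \<comment> \<open>The recursion that returns the previous index is the predecessor function;
    truncated subtraction iterates it.\<close>
  have p: "computable (\<lambda>x. rec_nat 0 (\<lambda>m _. m) (h x))" if "computable h" for h :: "'b::encodable \<Rightarrow> nat"
    by (intro computable_intros that)
  have "computable (\<lambda>x. rec_nat (f x) (\<lambda>_ r. rec_nat 0 (\<lambda>m _. m) r) (g x))"
    by (intro computable_intros assms p)
  moreover have "rec_nat a (\<lambda>_ r. rec_nat 0 (\<lambda>m _. m) r) b = a - b" for a b :: nat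
  proof (induction b)
    case (Suc b)
    then show ?case by (cases "a - b") auto
  qed simp
  ultimately show ?thesis by simp
qed

lemma computable_not [computable_intros]:
  assumes "computable f"
  shows "computable (\<lambda>x. \<not> f x)"
proof -
  have "computable (\<lambda>x. if f x then False else True)"
    by (intro computable_intros assms)
  moreover have "(if f x then False else True) = (\<not> f x)" for x by simp
  ultimately show ?thesis by simp
qed

lemma computable_conj [computable_intros]:
  assumes "computable f" "computable g"
  shows "computable (\<lambda>x. f x \<and> g x)"
proof -
  have "computable (\<lambda>x. if f x then g x else False)"
    by (intro computable_intros assms)
  moreover have "(if f x then g x else False) = (f x \<and> g x)" for x by simp
  ultimately show ?thesis by simp
qed

lemma computable_disj [computable_intros]:
  assumes "computable f" "computable g"
  shows "computable (\<lambda>x. f x \<or> g x)"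
proof -
  have "computable (\<lambda>x. \<not> (\<not> f x \<and> \<not> g x))"
    by (intro computable_intros assms)
  then show ?thesis by simp
qed

text \<open>By injectivity equality can be tested on codes, and two numbers are equal when both
  truncated differences are 0.\<close>

lemma computable_eq [computable_intros]:
  fixes f g :: "'a::encodable \<Rightarrow> 'b::encodable"
  assumes "computable f" "computable g"
  shows "computable (\<lambda>x. f x = g x)"
proof -
  have z: "computable (\<lambda>x. rec_nat True (\<lambda>_ _. False) (h x))" if "computable h" for h :: "'a \<Rightarrow> nat"
    by (intro computable_intros that)
  have "computable (\<lambda>x. rec_nat True (\<lambda>_ _. False) ((enc (f x) - enc (g x)) + (enc (g x) - enc (f x))))"
    by (intro z computable_intros assms)
  moreover have "rec_nat True (\<lambda>_ _. False) ((enc a - enc b) + (enc b - enc a)) \<longleftrightarrow> a = b" for a b :: 'b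
  proof -
    have "rec_nat True (\<lambda>_ _. False) k \<longleftrightarrow> k = 0" for k :: nat
      by (cases k) auto
    moreover have "(enc a - enc b) + (enc b - enc a) = 0 \<longleftrightarrow> enc a = enc b"
      by linarith
    ultimately show ?thesis by simp
  qed
  ultimately show ?thesis by simp
qed

lemma computable_list_all [computable_intros]:
  assumes "computable (\<lambda>p. f (fst p) (snd p))" "computable L"
  shows "computable (\<lambda>x. list_all (f x) (L x))"
proof -
  have "computable (\<lambda>p. f (fst p) (fst (snd p)))"
    by (rule computable_comp[OF assms(1), of "\<lambda>p. (fst p, fst (snd p))", simplified fst_conv snd_conv]) (intro computable_intros)
  then have "computable (\<lambda>x. foldr (\<lambda>a c. f x a \<and> c) (L x) True)"
    by (intro computable_intros assms)
  moreover have "foldr (\<lambda>a c. g a \<and> c) l True = list_all g l" for g :: "'b \<Rightarrow> bool" and l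
    by (induction l) auto
  ultimately show ?thesis by simp
qed

lemma computable_in_set [computable_intros]:
  assumes "computable f" "computable L"
  shows "computable (\<lambda>x. f x \<in> set (L x))"
proof -
  have "computable (\<lambda>x. \<not> list_all (\<lambda>a. a \<noteq> f x) (L x))"
    by (intro computable_intros assms computable_comp[OF assms(1) computable_fst])
  moreover have "(\<not> list_all (\<lambda>a. a \<noteq> b) l) = (b \<in> set l)" for b :: 'b and l
    by (auto simp: list_all_iff)
  ultimately show ?thesis by simp
qed

lemma computable_upt [computable_intros]:
  assumes "computable f"
  shows "computable (\<lambda>x. [0..<f x])"
proof -
  have "computable (\<lambda>x. rec_nat [] (\<lambda>m r. r @ [m]) (f x))"
    by (intro computable_intros assms)
  moreover have "rec_nat [] (\<lambda>m r. r @ [m]) k = [0..<k]" for k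
    by (induction k) auto
  ultimately show ?thesis by simp
qed

lemma computable_replicate [computable_intros]:
  assumes "computable f" "computable g"
  shows "computable (\<lambda>x. replicate (f x) (g x))"
proof -
  have "computable (\<lambda>x. map (\<lambda>_. g x) [0..<f x])"
    by (intro computable_intros assms computable_comp[OF assms(2) computable_fst])
  then show ?thesis by (simp add: map_replicate_const)
qed

lemma computable_take [computable_intros]:
  assumes "computable f" "computable L"
  shows "computable (\<lambda>x. take (f x) (L x))"
proof -
  have "computable (\<lambda>x. snd (foldl (\<lambda>s a. if fst s = 0 then s else (fst s - 1, snd s @ [a])) (f x, []) (L x)))"
    by (intro computable_intros assms)
  moreover have "snd (foldl (\<lambda>s a. if fst s = 0 then s else (fst s - 1, snd s @ [a])) (k, r) l) = r @ take k l"
    for k :: nat and r l :: "'b list"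
    by (induction l arbitrary: k r) (auto simp: take_Cons')
  ultimately show ?thesis by simp
qed

lemma computable_enumerate [computable_intros]:
  assumes "computable L"
  shows "computable (\<lambda>x. List.enumerate 0 (L x))"
proof -
  have "computable (\<lambda>x. snd (foldl (\<lambda>s a. (Suc (fst s), snd s @ [(fst s, a)])) (0, []) (L x)))"
    by (intro computable_intros assms)
  moreover have "snd (foldl (\<lambda>s a. (Suc (fst s), snd s @ [(fst s, a)])) (k, r) l) = r @ List.enumerate k l"
    for k :: nat and r and l :: "'b list"
    by (induction l arbitrary: k r) auto
  ultimately show ?thesis by simp
qed

lemma computable_subseqs [computable_intros]:
  assumes "computable L"
  shows "computable (\<lambda>x. subseqs (L x))"
proof -
  have "computable (\<lambda>x. foldr (\<lambda>a c. map (\<lambda>l. a # l) c @ c) (L x) [[]])"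
    by (intro computable_intros assms)
  moreover have "foldr (\<lambda>a c. map (\<lambda>l. a # l) c @ c) l [[]] = subseqs l" for l :: "'b list"
    by (induction l) (auto simp: Let_def)
  ultimately show ?thesis by simp
qed

section \<open>Reduced words\<close>

definition winv :: "word \<Rightarrow> word" where
  "winv w = map flip (rev w)"

lemma flip_neq [simp]: "flip a \<noteq> a" "a \<noteq> flip a"
  by (auto simp: flip_def prod_eq_iff)

lemma flip_eq_iff [simp]: "flip a = flip b \<longleftrightarrow> a = b"
  by (metis flip_flip)

lemma winv_simps [simp]:
  "winv [] = []" "winv (u @ v) = winv v @ winv u" "winv (winv w) = w" "length (winv w) = length w"
  "winv w = [] \<longleftrightarrow> w = []"
  by (auto simp: winv_def rev_map comp_def)

lemma winv_Cons: "winv (a # w) = winv w @ [flip a]"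
  by (simp add: winv_def)

lemma last_winv: "w \<noteq> [] \<Longrightarrow> last (winv w) = flip (hd w)"
  by (simp add: winv_def last_map last_rev)

lemma reduced_Nil [simp]: "reduced []" and reduced_singleton [simp]: "reduced [a]"
  by (simp_all add: reduced_def)

lemma reduced_append:
  "reduced (u @ v) \<longleftrightarrow> reduced u \<and> reduced v \<and> (u = [] \<or> v = [] \<or> hd v \<noteq> flip (last u))"
  by (auto simp: reduced_def successively_append_iff)

lemma reduced_Cons: "reduced (a # w) \<longleftrightarrow> reduced w \<and> (w = [] \<or> hd w \<noteq> flip a)"
  using reduced_append[of "[a]" w] by auto

lemma reduced_winv [simp]: "reduced (winv w) \<longleftrightarrow> reduced w"
proof -
  have "reduced w \<Longrightarrow> reduced (winv w)" for w
  proof (induction w)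
    case (Cons a w)
    then show ?case
      by (cases w) (auto simp: winv_Cons reduced_append reduced_Cons)
  qed simp
  from this[of w] this[of "winv w"] show ?thesis by auto
qed

lemma reduced_take: "reduced w \<Longrightarrow> reduced (take k w)" and reduced_drop: "reduced w \<Longrightarrow> reduced (drop k w)"
  by (metis append_take_drop_id reduced_append)+

lemma words_append [simp]: "u @ v \<in> words n \<longleftrightarrow> u \<in> words n \<and> v \<in> words n"
  by (auto simp: words_def)

lemma words_Cons [simp]: "a # v \<in> words n \<longleftrightarrow> fst a < n \<and> v \<in> words n"
  by (cases a) (auto simp: words_def)

lemma words_Nil [simp]: "[] \<in> words n"
  by (simp add: words_def)

lemma fst_flip [simp]: "fst (flip a) = fst a"
  by (simp add: flip_def)

lemma winv_words [simp]: "winv w \<in> words n \<longleftrightarrow> w \<in> words n"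
  by (induction w) (auto simp: winv_Cons)

lemma words_take: "w \<in> words n \<Longrightarrow> take k w \<in> words n"
  by (metis append_take_drop_id words_append)

lemma words_concat_replicate: "w \<in> words n \<Longrightarrow> concat (replicate k w) \<in> words n"
  by (induction k) auto

lemma reduce_Nil [simp]: "reduce [] = []"
  by (simp add: reduce_def)

lemma reduce_append_both: "reduce (reduce u @ reduce v) = reduce (u @ v)"
  by (simp add: reduce_append_left reduce_append_right)

lemma reduce_winv_append [simp]: "reduce (winv w @ w) = []" "reduce (w @ winv w) = []"
  using reduce_inverse[of w] reduce_inverse[of "winv w"] by (simp_all flip: winv_def)

lemma reduce_winv_cancel [simp]:
  "reduce (winv w @ w @ v) = reduce v" "reduce (w @ winv w @ v) = reduce v"
  using reduce_append_left[of "winv w @ w" v] reduce_append_left[of "w @ winv w" v] by simp_all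

lemma length_red_Cons: "length (red_Cons a w) \<le> Suc (length w)" "length w \<le> Suc (length (red_Cons a w))"
  by (cases w; simp)+

lemma length_reduce_le: "length (reduce w) \<le> length w"
proof (induction w)
  case (Cons a w)
  then show ?case
    using length_red_Cons(1)[of a "reduce w"] by (simp add: reduce_def)
qed simp

text \<open>A letter multiplied on the left cancels at most one letter, so \<open>u\<close> shortens
  \<open>v\<close> by at most its own length.\<close>

lemma length_reduce_append_ge:
  assumes "reduced v"
  shows "length v \<le> length (reduce (u @ v)) + length u"
proof (induction u)
  case (Cons a u)
  then show ?case
    using length_red_Cons(2)[of "reduce (u @ v)" a] by (simp add: reduce_def)
qed (simp add: assms reduce_reduced)

lemma take_eq_mono: "take N h = take N h' \<Longrightarrow> M \<le> N \<Longrightarrow> take M h = take M h'"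
  by (metis min.absorb1 take_take)

text \<open>The extra letter of the hypothesis pays for a possible cancellation.\<close>

lemma take_red_Cons:
  "take (Suc N) h = take (Suc N) h' \<Longrightarrow> take N (red_Cons a h) = take N (red_Cons a h')"
proof -
  assume eq: "take (Suc N) h = take (Suc N) h'"
  then have "take N (a # h) = take N (a # h')"
    by (cases N) (use take_eq_mono[OF eq, of "N - 1"] in auto)
  with eq show ?thesis
    by (cases h; cases h') auto
qed

text \<open>Each letter of \<open>g\<close> costs one letter of precision. This uniform continuity
  of left multiplication is what lets it extend to the boundary.\<close>

lemma take_reduce_append:
  assumes "reduced h" "reduced h'" "take (N + length g) h = take (N + length g) h'"
  shows "take N (reduce (g @ h)) = take N (reduce (g @ h'))"
  using assms(3)
proof (induction g arbitrary: N)
  case (Cons a g)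
  have "take (Suc N) (reduce (g @ h)) = take (Suc N) (reduce (g @ h'))"
    using Cons.prems by (intro Cons.IH) simp
  from take_red_Cons[OF this] show ?case by (simp add: reduce_def)
qed (simp add: assms reduce_reduced)

lemma common_prefix_split:
  obtains c x' y' where "x = c @ x'" "y = c @ y'" "x' = [] \<or> y' = [] \<or> hd x' \<noteq> hd y'"
proof -
  have "\<exists>c x' y'. x = c @ x' \<and> y = c @ y' \<and> (x' = [] \<or> y' = [] \<or> hd x' \<noteq> hd y')"
  proof (induction x arbitrary: y)
    case (Cons a x)
    show ?case
    proof (cases "y = [] \<or> hd y \<noteq> a")
      case True
      then show ?thesis by (intro exI[of _ "[]"] exI[of _ "a # x"] exI[of _ y]) auto
    next
      case False
      then obtain y1 where y: "y = a # y1" by (cases y) auto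
      from Cons[of y1] obtain c x' y' where "x = c @ x'" "y1 = c @ y'" "x' = [] \<or> y' = [] \<or> hd x' \<noteq> hd y'"
        by blast
      then show ?thesis by (intro exI[of _ "a # c"] exI[of _ x'] exI[of _ y']) (auto simp: y)
    qed
  qed auto
  then show ?thesis using that by blast
qed

lemma reduced_winv_append:
  assumes "reduced x" "reduced y" "x = [] \<or> y = [] \<or> hd x \<noteq> hd y"
  shows "reduced (winv x @ y)"
  using assms by (cases "x = []") (auto simp: reduced_append last_winv)

text \<open>The two geodesics from the identity branch at \<open>c\<close>, so the geodesic between
  their ends runs through \<open>c\<close> and no further cancellation happens there.\<close>

lemma reduce_winv_common_prefix:
  assumes "reduced (c @ x')" "reduced (c @ y')" "x' = [] \<or> y' = [] \<or> hd x' \<noteq> hd y'"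
  shows "reduce (winv (c @ x') @ c @ y') = winv x' @ y'"
proof -
  have "reduced (winv x' @ y')"
    using assms by (intro reduced_winv_append) (auto simp: reduced_append)
  then show ?thesis
    using reduce_append_right[of "winv x'" "winv c @ c @ y'"]
    by (simp add: reduce_append_right reduce_reduced)
qed

abbreviation rwords :: "nat \<Rightarrow> word set" where
  "rwords n \<equiv> {w \<in> words n. reduced w}"

lemma carrier_free_group [simp]: "carrier (free_group n) = rwords n"
  and mult_free_group [simp]: "g \<otimes>\<^bsub>free_group n\<^esub> h = reduce (g @ h)"
  and one_free_group [simp]: "\<one>\<^bsub>free_group n\<^esub> = []"
  by (simp_all add: free_group_def)

lemma inv_free_group: "g \<in> rwords n \<Longrightarrow> inv\<^bsub>free_group n\<^esub> g = winv g"
  by (rule group.inv_equality[OF group_free_group]) auto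

lemma pow_free_group: "w [^]\<^bsub>free_group n\<^esub> (k::nat) = reduce (concat (replicate k w))"
proof (induction k)
  case (Suc k)
  have "concat (replicate k w) @ w = concat (replicate (Suc k) w)"
    by (metis concat_append concat.simps append_Nil2 replicate_append_same replicate_Suc)
  then show ?case
    by (simp add: Suc reduce_append_left nat_pow_Suc)
qed (simp add: nat_pow_0)

section \<open>The Cayley tree\<close>

lemma reduce_mult_words: "g \<in> words n \<Longrightarrow> h \<in> words n \<Longrightarrow> reduce (g @ h) \<in> rwords n"
  by (auto intro!: reduce_words simp: reduced_reduce)

lemma cayley_edges_relpow:
  assumes "g \<in> rwords n"
  shows "(g, h) \<in> cayley_edges n ^^ k \<longleftrightarrow> (\<exists>u\<in>words n. length u = k \<and> h = reduce (g @ u))"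
proof (induction k arbitrary: h)
  case 0
  then show ?case using assms by (auto simp: reduce_reduced)
next
  case (Suc k)
  have "(g, h) \<in> cayley_edges n ^^ Suc k \<longleftrightarrow>
    (\<exists>u\<in>words n. length u = k \<and> (reduce (g @ u), h) \<in> cayley_edges n)"
    using Suc by auto
  also have "\<dots> \<longleftrightarrow> (\<exists>u\<in>words n. \<exists>a. length u = k \<and> fst a < n \<and> h = reduce (g @ u @ [a]))"
    using assms by (auto simp: cayley_edges_def reduce_append_left reduce_words reduced_reduce)
  also have "\<dots> \<longleftrightarrow> (\<exists>u\<in>words n. length u = Suc k \<and> h = reduce (g @ u))" (is "?L \<longleftrightarrow> ?R")
  proof
    assume ?R
    then obtain u where u: "u \<in> words n" "length u = Suc k" "h = reduce (g @ u)" by blast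
    then obtain v a where "u = v @ [a]" by (cases u rule: rev_cases) auto
    with u show ?L by (intro bexI[of _ v] exI[of _ a]) auto
  next
    assume ?L
    then obtain u a where "u \<in> words n" "length u = k" "fst a < n" "h = reduce (g @ u @ [a])"
      by blast
    then show ?R by (intro bexI[of _ "u @ [a]"]) auto
  qed
  finally show ?case .
qed

text \<open>A path from \<open>g\<close> spells a word and reduction never lengthens a word, so the
  reduced word is a shortest path.\<close>

lemma cayley_dist_eq:
  assumes "g \<in> rwords n" "h \<in> rwords n"
  shows "cayley_dist n g h = length (reduce (winv g @ h))"
  unfolding cayley_dist_def
proof (rule Least_equality)
  show "(g, h) \<in> cayley_edges n ^^ length (reduce (winv g @ h))"
    using assms unfolding cayley_edges_relpow[OF assms(1)]
    by (intro bexI[of _ "reduce (winv g @ h)"]) (auto simp: reduce_append_right reduce_reduced reduce_words)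
next
  fix k assume "(g, h) \<in> cayley_edges n ^^ k"
  then obtain u where "u \<in> words n" "length u = k" "h = reduce (g @ u)"
    unfolding cayley_edges_relpow[OF assms(1)] by blast
  then show "length (reduce (winv g @ h)) \<le> k"
    using length_reduce_le[of u] by (simp add: reduce_append_right)
qed

text \<open>Based at the identity of a tree, the Gromov product of two vertices is the length of
  their common prefix. The condition on \<open>length (take N x)\<close> excludes words shorter than
  \<open>N\<close>.\<close>

lemma gromov_product_ge_iff:
  assumes "x \<in> rwords n" "y \<in> rwords n"
  shows "real N \<le> gromov_product n x y \<longleftrightarrow> length (take N x) = N \<and> take N x = take N y"
proof -
  obtain c x' y' where c: "x = c @ x'" "y = c @ y'" "x' = [] \<or> y' = [] \<or> hd x' \<noteq> hd y'"
    by (rule common_prefix_split)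
  have "reduce (winv x @ y) = winv x' @ y'"
    using reduce_winv_common_prefix[of c x' y'] c assms by simp
  moreover have "reduce (winv [] @ z) = z" if "z \<in> rwords n" for z
    using that by (simp add: reduce_reduced)
  ultimately have "gromov_product n x y = length c"
    using assms by (simp add: gromov_product_def cayley_dist_eq) (simp add: c)
  moreover have "N \<le> length c \<longleftrightarrow> length (take N x) = N \<and> take N x = take N y"
  proof
    assume r: "length (take N x) = N \<and> take N x = take N y"
    show "N \<le> length c"
    proof (rule ccontr)
      assume "\<not> N \<le> length c"
      then obtain k where k: "N - length c = Suc k"
        by (cases "N - length c") auto
      then have "x' \<noteq> []" "take (Suc k) x' = take (Suc k) y'"
        using r by (auto simp: c)
      then have "x' \<noteq> [] \<and> y' \<noteq> [] \<and> hd x' = hd y'"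
        by (cases x'; cases y') simp_all
      with c(3) show False by blast
    qed
  qed (auto simp: c)
  ultimately show ?thesis by simp
qed

section \<open>Boundary points as infinite reduced words\<close>

definition limit_prefix :: "(nat \<Rightarrow> word) \<Rightarrow> word \<Rightarrow> bool" where
  "limit_prefix x u \<longleftrightarrow> (\<forall>\<^sub>F i in sequentially. take (length u) (x i) = u)"

lemma limit_prefix_unique:
  assumes "limit_prefix x u" "limit_prefix x v" "length u = length v"
  shows "u = v"
proof -
  from eventually_conj[OF assms(1,2)[unfolded limit_prefix_def]]
  have "\<exists>i. take (length u) (x i) = u \<and> take (length v) (x i) = v"
    by (rule eventually_happens'[OF trivial_limit_sequentially])
  with assms(3) show ?thesis by metis
qed

lemma limit_prefix_witness:
  assumes "limit_prefix x u"
  obtains i where "take (length u) (x i) = u"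
  using eventually_happens'[OF trivial_limit_sequentially assms[unfolded limit_prefix_def]] by blast

lemma limit_prefix_take: "limit_prefix x u \<Longrightarrow> limit_prefix x (take M u)"
  unfolding limit_prefix_def by (erule eventually_mono) (metis length_take min.commute take_take)

text \<open>If the products of all late pairs of terms are at least \<open>N\<close>, then comparing
  all terms of one sequence with a fixed late term of the other shows that both sequences settle on
  one prefix of length \<open>N\<close>.\<close>

lemma converge_together_iff:
  assumes x: "range x \<subseteq> rwords n" and y: "range y \<subseteq> rwords n"
  shows "converge_together n x y \<longleftrightarrow> (\<forall>N. \<exists>u. length u = N \<and> limit_prefix x u \<and> limit_prefix y u)"
proof -
  have "converge_together n x y \<longleftrightarrow>
    (\<forall>N. \<forall>\<^sub>F (i, j) in sequentially \<times>\<^sub>F sequentially. real N \<le> gromov_product n (x i) (y j))"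
    unfolding converge_together_def filterlim_at_top
  proof safe
    fix Z :: real
    assume "\<forall>N. \<forall>\<^sub>F (i, j) in sequentially \<times>\<^sub>F sequentially. real N \<le> gromov_product n (x i) (y j)"
    then have "\<forall>\<^sub>F (i, j) in sequentially \<times>\<^sub>F sequentially. real (nat \<lceil>Z\<rceil>) \<le> gromov_product n (x i) (y j)"
      by blast
    then show "\<forall>\<^sub>F z in sequentially \<times>\<^sub>F sequentially. Z \<le> (case z of (i, j) \<Rightarrow> gromov_product n (x i) (y j))"
      by (rule eventually_mono) (auto, linarith)
  next
    fix N
    assume "\<forall>Z. \<forall>\<^sub>F z in sequentially \<times>\<^sub>F sequentially. Z \<le> (case z of (i, j) \<Rightarrow> gromov_product n (x i) (y j))"
    then have "\<forall>\<^sub>F z in sequentially \<times>\<^sub>F sequentially. real N \<le> (case z of (i, j) \<Rightarrow> gromov_product n (x i) (y j))" ..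
    then show "\<forall>\<^sub>F (i, j) in sequentially \<times>\<^sub>F sequentially. real N \<le> gromov_product n (x i) (y j)"
      by (rule eventually_mono) auto
  qed
  also have "(\<forall>N. \<forall>\<^sub>F (i, j) in sequentially \<times>\<^sub>F sequentially. real N \<le> gromov_product n (x i) (y j)) \<longleftrightarrow>
    (\<forall>N. \<exists>K. \<forall>i\<ge>K. \<forall>j\<ge>K. length (take N (x i)) = N \<and> take N (x i) = take N (y j))"
  proof -
    have "(case z of (i, j) \<Rightarrow> real N \<le> gromov_product n (x i) (y j)) \<longleftrightarrow>
      length (take N (x (fst z))) = N \<and> take N (x (fst z)) = take N (y (snd z))" for z N
      using x y gromov_product_ge_iff[of "x (fst z)" n "y (snd z)" N] by (auto simp: case_prod_beta)
    then show ?thesis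
      unfolding eventually_prod_sequentially by (simp only: fst_conv snd_conv) blast
  qed
  also have "\<dots> \<longleftrightarrow> (\<forall>N. \<exists>u. length u = N \<and> limit_prefix x u \<and> limit_prefix y u)"
  proof (intro arg_cong[where f = All] ext iffI)
    fix N
    assume "\<exists>K. \<forall>i\<ge>K. \<forall>j\<ge>K. length (take N (x i)) = N \<and> take N (x i) = take N (y j)"
    then obtain K where K: "\<And>i j. i \<ge> K \<Longrightarrow> j \<ge> K \<Longrightarrow> length (take N (x i)) = N \<and> take N (x i) = take N (y j)"
      by blast
    show "\<exists>u. length u = N \<and> limit_prefix x u \<and> limit_prefix y u"
      unfolding limit_prefix_def eventually_sequentially using K
      by (intro exI[of _ "take N (x K)"]) (metis le_refl)
  next
    fix N
    assume "\<exists>u. length u = N \<and> limit_prefix x u \<and> limit_prefix y u"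
    then show "\<exists>K. \<forall>i\<ge>K. \<forall>j\<ge>K. length (take N (x i)) = N \<and> take N (x i) = take N (y j)"
      unfolding limit_prefix_def eventually_sequentially by (metis max.bounded_iff)
  qed
  finally show ?thesis .
qed

lemma boundary_sequences_iff:
  "x \<in> boundary_sequences n \<longleftrightarrow> range x \<subseteq> rwords n \<and> (\<forall>N. \<exists>u. length u = N \<and> limit_prefix x u)"
  unfolding boundary_sequences_def using converge_together_iff[of x n x] by auto

lemma boundary_sequences_rwords: "x \<in> boundary_sequences n \<Longrightarrow> x i \<in> rwords n"
  unfolding boundary_sequences_iff by auto

lemma limit_prefix_rwords:
  assumes "x \<in> boundary_sequences n" "limit_prefix x u"
  shows "u \<in> rwords n"
proof -
  obtain i where "take (length u) (x i) = u"
    using assms(2) by (rule limit_prefix_witness)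
  then show ?thesis
    using boundary_sequences_rwords[OF assms(1), of i] reduced_take[of "x i" "length u"] words_take[of "x i" n "length u"]
    by auto
qed

lemma boundary_rel_iff:
  "(x, y) \<in> boundary_rel n \<longleftrightarrow> x \<in> boundary_sequences n \<and> y \<in> boundary_sequences n \<and>
     (\<forall>u. limit_prefix x u \<longleftrightarrow> limit_prefix y u)"
proof -
  have "converge_together n x y \<longleftrightarrow> (\<forall>u. limit_prefix x u \<longleftrightarrow> limit_prefix y u)"
    if "x \<in> boundary_sequences n" "y \<in> boundary_sequences n"
    using that unfolding boundary_sequences_iff by (subst converge_together_iff) (simp | metis limit_prefix_unique)+
  then show ?thesis unfolding boundary_rel_def by blast
qed

lemma equiv_boundary_rel: "equiv (boundary_sequences n) (boundary_rel n)"
  by (rule equivI) (auto simp: refl_on_def sym_def trans_def boundary_rel_iff)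

text \<open>These are the first \<open>N\<close> letters of the infinite reduced word that
  represents the point. For a boundary point all representing sequences have the same limit
  prefixes, which justifies \<open>THE\<close>.\<close>

definition pref :: "bpoint \<Rightarrow> nat \<Rightarrow> word" where
  "pref p N = (THE u. length u = N \<and> (\<exists>x\<in>p. limit_prefix x u))"

lemma limit_prefix_pref:
  assumes p: "p \<in> boundary n" and x: "x \<in> p"
  shows "limit_prefix x (pref p N)" "length (pref p N) = N"
proof -
  have eq: "p = boundary_rel n `` {x}" and xs: "x \<in> boundary_sequences n"
    using p x quotient_eq_iff[OF equiv_boundary_rel] Image_singleton_iff
      equiv_class_eq_iff[OF equiv_boundary_rel]
    unfolding boundary_def quotient_def by (auto simp: boundary_rel_iff)
  from xs obtain u where u: "length u = N" "limit_prefix x u"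
    unfolding boundary_sequences_iff by blast
  have "pref p N = u"
    unfolding pref_def
  proof (rule the_equality)
    show "length u = N \<and> (\<exists>x\<in>p. limit_prefix x u)"
      using u x by blast
    fix v assume "length v = N \<and> (\<exists>x\<in>p. limit_prefix x v)"
    then obtain y where "length v = N" "y \<in> p" "limit_prefix y v" by blast
    then have "limit_prefix x v" by (simp add: eq boundary_rel_iff)
    with u \<open>length v = N\<close> show "v = u" by (auto intro: limit_prefix_unique)
  qed
  with u show "limit_prefix x (pref p N)" "length (pref p N) = N" by auto
qed

lemma boundary_point_nonempty:
  assumes "p \<in> boundary n"
  obtains x where "x \<in> p" "x \<in> boundary_sequences n" "p = boundary_rel n `` {x}"
proof -
  from assms obtain x where x: "x \<in> boundary_sequences n" "p = boundary_rel n `` {x}"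
    unfolding boundary_def quotient_def by blast
  moreover have "x \<in> p"
    using x by (auto simp: boundary_rel_iff)
  ultimately show ?thesis using that by blast
qed

lemma boundary_point_sequence:
  assumes "p \<in> boundary n" "x \<in> p"
  shows "x \<in> boundary_sequences n"
proof -
  obtain y where "p = boundary_rel n `` {y}" using boundary_point_nonempty[OF assms(1)] by metis
  with assms(2) show ?thesis by (auto simp: boundary_rel_iff)
qed

lemma length_pref [simp]: "p \<in> boundary n \<Longrightarrow> length (pref p N) = N"
  by (metis boundary_point_nonempty limit_prefix_pref(2))

lemma pref_eqI: "p \<in> boundary n \<Longrightarrow> x \<in> p \<Longrightarrow> limit_prefix x u \<Longrightarrow> length u = N \<Longrightarrow> pref p N = u"
  by (metis limit_prefix_pref limit_prefix_unique)

lemma take_pref: 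
  assumes "p \<in> boundary n" "M \<le> N"
  shows "take M (pref p N) = pref p M"
proof -
  obtain x where "x \<in> p" using boundary_point_nonempty[OF assms(1)] by blast
  with assms show ?thesis
    by (intro pref_eqI[symmetric, of p n x]) (auto intro: limit_prefix_take limit_prefix_pref)
qed

lemma pref_rwords: 
  assumes "p \<in> boundary n"
  shows "pref p N \<in> rwords n"
proof -
  obtain x where x: "x \<in> p" "x \<in> boundary_sequences n" using boundary_point_nonempty[OF assms] by blast
  then show ?thesis
    by (intro limit_prefix_rwords[OF x(2)] limit_prefix_pref[OF assms])
qed

lemma pref_words [simp]: "p \<in> boundary n \<Longrightarrow> pref p N \<in> words n"
  and pref_reduced [simp]: "p \<in> boundary n \<Longrightarrow> reduced (pref p N)"
  using pref_rwords by auto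

lemma pref_mono: "pref p N = pref q N \<Longrightarrow> p \<in> boundary n \<Longrightarrow> q \<in> boundary n \<Longrightarrow> M \<le> N \<Longrightarrow> pref p M = pref q M"
  by (metis take_pref)

lemma boundary_lim:
  assumes "x \<in> boundary_sequences n"
  shows "boundary_lim n x \<in> boundary n" "x \<in> boundary_lim n x"
  using assms by (auto simp: boundary_lim_def boundary_def quotient_def boundary_rel_iff)

text \<open>The coherent prefixes, read as vertices, are themselves a sequence converging to the
  required point.\<close>

lemma boundary_point_exists:
  assumes \<xi>: "\<And>N. \<xi> N \<in> rwords n" "\<And>N. length (\<xi> N) = N" "\<And>M N. M \<le> N \<Longrightarrow> take M (\<xi> N) = \<xi> M"
  shows "\<exists>p\<in>boundary n. \<forall>N. pref p N = \<xi> N"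
proof -
  have lim: "limit_prefix \<xi> (\<xi> N)" for N
    using assms unfolding limit_prefix_def eventually_sequentially by (intro exI[of _ N]) auto
  with \<xi> have "\<xi> \<in> boundary_sequences n"
    unfolding boundary_sequences_iff by (metis (no_types, lifting) image_subset_iff)
  note b = boundary_lim[OF this]
  show ?thesis
    by (intro bexI[of _ "boundary_lim n \<xi>"] allI) (auto intro: b pref_eqI[OF b lim \<xi>(2)])
qed

text \<open>Repeating the last letter prolongs a nonempty reduced word for ever without
  cancellation.\<close>

lemma boundary_point_extending:
  assumes "u \<in> rwords n" "u \<noteq> []"
  obtains p where "p \<in> boundary n" "pref p (length u) = u"
proof -
  define \<xi> where "\<xi> = (\<lambda>N. take N (u @ replicate N (last u)))"
  have "last u \<in> set u" using assms by simp
  then have l: "fst (last u) < n"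
    using assms by (metis (mono_tags, lifting) mem_Collect_eq split_list words_Cons words_append)
  have r: "reduced (replicate k (last u))" "replicate k (last u) \<in> words n" for k
    using l by (induction k) (auto simp: reduced_Cons hd_replicate)
  have "\<xi> N \<in> rwords n" for N
    unfolding \<xi>_def using assms r[of N]
    by (cases N) (auto intro!: reduced_take words_take simp: reduced_append)
  moreover have "length (\<xi> N) = N" for N by (simp add: \<xi>_def)
  moreover have "take M (\<xi> N) = \<xi> M" if "M \<le> N" for M N
    using that by (auto simp: \<xi>_def min_def)
  ultimately have "\<exists>p\<in>boundary n. \<forall>N. pref p N = \<xi> N"
    by (rule boundary_point_exists)
  then obtain p where "p \<in> boundary n" "\<And>N. pref p N = \<xi> N" by blast
  moreover have "\<xi> (length u) = u" by (simp add: \<xi>_def)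
  ultimately show ?thesis using that[of p] by simp
qed

lemma boundary_eqI:
  assumes "p \<in> boundary n" "q \<in> boundary n" "\<And>N. pref p N = pref q N"
  shows "p = q"
proof -
  obtain x where x: "x \<in> p" "x \<in> boundary_sequences n" "p = boundary_rel n `` {x}"
    using boundary_point_nonempty[OF assms(1)] .
  obtain y where y: "y \<in> q" "y \<in> boundary_sequences n" "q = boundary_rel n `` {y}"
    using boundary_point_nonempty[OF assms(2)] .
  have "limit_prefix x u \<longleftrightarrow> limit_prefix y u" for u
    using pref_eqI[OF assms(1) x(1), of u "length u"] pref_eqI[OF assms(2) y(1), of u "length u"]
      limit_prefix_pref[OF assms(1) x(1)] limit_prefix_pref[OF assms(2) y(1)] assms(3) by metis
  then have "(x, y) \<in> boundary_rel n"
    using x y by (simp add: boundary_rel_iff)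
  then show ?thesis
    using x y equiv_class_eq[OF equiv_boundary_rel] by metis
qed

section \<open>The action of the group on boundary points\<close>

lemma boundary_sequences_mult:
  assumes g: "g \<in> rwords n" and x: "x \<in> boundary_sequences n"
  shows "(\<lambda>i. reduce (g @ x i)) \<in> boundary_sequences n"
    and "limit_prefix x u \<Longrightarrow> length u = N + length g \<Longrightarrow>
      limit_prefix (\<lambda>i. reduce (g @ x i)) (take N (reduce (g @ u)))"
proof -
  have xr: "x i \<in> rwords n" for i
    using x unfolding boundary_sequences_iff by auto
  show *: "limit_prefix (\<lambda>i. reduce (g @ x i)) (take N (reduce (g @ u)))"
    if u: "limit_prefix x u" "length u = N + length g" for u N
  proof -
    have ru: "reduced u"
      using limit_prefix_rwords[OF x u(1)] by simp
    from length_reduce_append_ge[OF this, of g] u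
    have l: "length (take N (reduce (g @ u))) = N" by simp
    show ?thesis
      using u(1) unfolding limit_prefix_def l
    proof (rule eventually_mono)
      fix i assume "take (length u) (x i) = u"
      then show "take N (reduce (g @ x i)) = take N (reduce (g @ u))"
        using u xr[of i] ru by (intro take_reduce_append) auto
    qed
  qed
  show "(\<lambda>i. reduce (g @ x i)) \<in> boundary_sequences n"
    unfolding boundary_sequences_iff
  proof (intro conjI allI)
    show "range (\<lambda>i. reduce (g @ x i)) \<subseteq> rwords n"
      using g xr by (auto simp: reduced_reduce intro!: reduce_words)
    fix N
    obtain u where u: "length u = N + length g" "limit_prefix x u"
      using x unfolding boundary_sequences_iff by blast
    have "reduced u"
      using limit_prefix_rwords[OF x u(2)] by simp
    from length_reduce_append_ge[OF this, of g] u
    have "length (take N (reduce (g @ u))) = N" by simp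
    with *[OF u(2,1)] show "\<exists>u. length u = N \<and> limit_prefix (\<lambda>i. reduce (g @ x i)) u" by blast
  qed
qed

text \<open>\<open>boundary_act\<close> is the image of a class of sequences. To be a full class
  again it needs two facts: related sequences stay related, and multiplication by the inverse brings
  every sequence related to the image back into the original class.\<close>

lemma boundary_act_closed:
  assumes g: "g \<in> rwords n" and p: "p \<in> boundary n"
  shows "boundary_act n g p \<in> boundary n"
    and "pref (boundary_act n g p) N = take N (reduce (g @ pref p (N + length g)))"
proof -
  obtain x where x: "x \<in> p" "x \<in> boundary_sequences n" "p = boundary_rel n `` {x}"
    using boundary_point_nonempty[OF p] .
  let ?m = "\<lambda>h x i. reduce (h @ x i)"
  have inv: "?m (winv h) (?m h y) = y" if "y \<in> boundary_sequences n" for y h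
  proof
    fix i
    have "y i \<in> rwords n" using that unfolding boundary_sequences_iff by auto
    then show "?m (winv h) (?m h y) i = y i"
      by (simp add: reduce_append_right reduce_reduced)
  qed
  have rel: "(?m h y, ?m h z) \<in> boundary_rel n" if "(y, z) \<in> boundary_rel n" "h \<in> rwords n" for y z h
  proof -
    from that have yz: "y \<in> boundary_sequences n" "z \<in> boundary_sequences n"
      "\<And>u. limit_prefix y u \<longleftrightarrow> limit_prefix z u" by (auto simp: boundary_rel_iff)
    have "limit_prefix (?m h y) u \<longleftrightarrow> limit_prefix (?m h z) u" for u
    proof -
      obtain v where v: "length v = length u + length h" "limit_prefix y v"
        using yz(1) unfolding boundary_sequences_iff by blast
      let ?w = "take (length u) (reduce (h @ v))"
      have "limit_prefix (?m h y) ?w" "limit_prefix (?m h z) ?w"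
        using v yz that(2) by (auto intro: boundary_sequences_mult(2))
      moreover have "length ?w = length u"
      proof -
        have "reduced v" using limit_prefix_rwords[OF yz(1) v(2)] by simp
        from length_reduce_append_ge[OF this, of h] v(1) show ?thesis by simp
      qed
      ultimately show ?thesis by (metis limit_prefix_unique)
    qed
    then show ?thesis
      using yz that(2) by (simp add: boundary_rel_iff boundary_sequences_mult(1))
  qed
  have eq: "boundary_act n g p = boundary_rel n `` {?m g x}"
  proof (intro Set.set_eqI iffI)
    fix y assume "y \<in> boundary_act n g p"
    then obtain z where "(x, z) \<in> boundary_rel n" "y = ?m g z"
      by (auto simp: boundary_act_def x(3))
    with rel[of x z g] g show "y \<in> boundary_rel n `` {?m g x}" by simp
  next
    fix y assume "y \<in> boundary_rel n `` {?m g x}"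
    then have y: "(?m g x, y) \<in> boundary_rel n" by simp
    then have ys: "y \<in> boundary_sequences n" by (simp add: boundary_rel_iff)
    from rel[OF y, of "winv g"] g have *: "(x, ?m (winv g) y) \<in> boundary_rel n"
      using inv[OF x(2), of g] by simp
    have "?m g (?m (winv g) y) = y"
      using inv[OF ys, of "winv g"] by simp
    then have "y = (\<lambda>x i. g \<otimes>\<^bsub>free_group n\<^esub> x i) (?m (winv g) y)"
      by simp
    from image_eqI[of y "\<lambda>x i. g \<otimes>\<^bsub>free_group n\<^esub> x i" "?m (winv g) y", OF this] * show "y \<in> boundary_act n g p"
      unfolding boundary_act_def x(3) by blast
  qed
  have mx: "?m g x \<in> boundary_sequences n"
    by (rule boundary_sequences_mult(1)[OF g x(2)])
  then show cl: "boundary_act n g p \<in> boundary n"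
    unfolding eq boundary_def by (rule quotientI)
  have mem: "?m g x \<in> boundary_act n g p"
    using x by (auto simp: boundary_act_def)
  have "length (take N (reduce (g @ pref p (N + length g)))) = N"
    using length_reduce_append_ge[of "pref p (N + length g)" g] p by simp
  then show "pref (boundary_act n g p) N = take N (reduce (g @ pref p (N + length g)))"
    using p by (intro pref_eqI[OF cl mem] boundary_sequences_mult(2)[OF g x(2) limit_prefix_pref(1)[OF p x(1)]]) auto
qed

lemma boundary_act_mult:
  assumes "g \<in> rwords n" "h \<in> rwords n" "p \<in> boundary n"
  shows "boundary_act n g (boundary_act n h p) = boundary_act n (reduce (g @ h)) p"
  by (auto simp: boundary_act_def image_image reduce_append_left reduce_append_right)

lemma boundary_act_one: 
  assumes "p \<in> boundary n"
  shows "boundary_act n [] p = p"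
proof -
  have red: "reduce (x i) = x i" if "x \<in> p" for x i
  proof -
    have "x i \<in> rwords n"
      using boundary_sequences_rwords[OF boundary_point_sequence[OF assms that]] .
    then show ?thesis by (simp add: reduce_reduced)
  qed
  then have "(\<lambda>i. reduce ([] @ x i)) = x" if "x \<in> p" for x
    using that by auto
  then show ?thesis by (simp add: boundary_act_def)
qed

lemma boundary_act_winv:
  assumes "g \<in> rwords n" "p \<in> boundary n"
  shows "boundary_act n g (boundary_act n (winv g) p) = p" "boundary_act n (winv g) (boundary_act n g p) = p"
  using assms by (simp_all add: boundary_act_mult boundary_act_one)

section \<open>Locally constant functions on the boundary\<close>

text \<open>The basic neighbourhoods and the cylinders are cofinal in each other. A lower bound on a
  \<open>Liminf\<close> yields eventual bounds only below that value, hence the shift from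
  \<open>N\<close> to \<open>Suc N\<close> in the second claim.\<close>

lemma boundary_nbhd_pref:
  assumes "p \<in> boundary n" "q \<in> boundary n"
  shows "pref p N = pref q N \<Longrightarrow> q \<in> boundary_nbhd n p (real N)"
    and "q \<in> boundary_nbhd n p (real (Suc N)) \<Longrightarrow> pref p N = pref q N"
proof -
  have rw: "x i \<in> rwords n" if "x \<in> r" "r \<in> boundary n" for x r i
    using boundary_sequences_rwords[OF boundary_point_sequence[OF that(2,1)]] .
  have ev: "\<forall>\<^sub>F i in sequentially. take N (x i) = pref r N" if "x \<in> r" "r \<in> boundary n" for x r N
    using limit_prefix_pref[OF that(2,1)] unfolding limit_prefix_def by simp
  show "q \<in> boundary_nbhd n p (real N)" if eq: "pref p N = pref q N"
  proof -
    obtain x where x: "x \<in> p" by (rule boundary_point_nonempty[OF assms(1)])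
    obtain y where y: "y \<in> q" by (rule boundary_point_nonempty[OF assms(2)])
    have "\<forall>\<^sub>F z in sequentially \<times>\<^sub>F sequentially. take N (x (fst z)) = pref p N \<and> take N (y (snd z)) = pref q N"
      using ev[OF x assms(1)] ev[OF y assms(2)] by (auto intro: eventually_prodI)
    then have "\<forall>\<^sub>F z in sequentially \<times>\<^sub>F sequentially.
        ereal (real N) \<le> (case z of (i, j) \<Rightarrow> ereal (gromov_product n (x i) (y j)))"
    proof (rule eventually_mono)
      fix z :: "nat \<times> nat" assume "take N (x (fst z)) = pref p N \<and> take N (y (snd z)) = pref q N"
      then have "length (take N (x (fst z))) = N \<and> take N (x (fst z)) = take N (y (snd z))"
        using assms by (simp add: eq del: length_take)
      then have "real N \<le> gromov_product n (x (fst z)) (y (snd z))"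
        unfolding gromov_product_ge_iff[OF rw[OF x assms(1)] rw[OF y assms(2)]] .
      then show "ereal (real N) \<le> (case z of (i, j) \<Rightarrow> ereal (gromov_product n (x i) (y j)))"
        by (simp add: case_prod_beta)
    qed
    then have "ereal (real N) \<le> Liminf (sequentially \<times>\<^sub>F sequentially) (\<lambda>(i, j). ereal (gromov_product n (x i) (y j)))"
      by (rule Liminf_bounded)
    with x y assms(2) show ?thesis by (auto simp: boundary_nbhd_def)
  qed
  show "pref p N = pref q N" if nb: "q \<in> boundary_nbhd n p (real (Suc N))"
  proof -
    obtain x y where x: "x \<in> p" and y: "y \<in> q" and
      "ereal (real (Suc N)) \<le> Liminf (sequentially \<times>\<^sub>F sequentially) (\<lambda>(i, j). ereal (gromov_product n (x i) (y j)))"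
      using nb by (auto simp: boundary_nbhd_def)
    then have "ereal (real N) < Liminf (sequentially \<times>\<^sub>F sequentially) (\<lambda>(i, j). ereal (gromov_product n (x i) (y j)))"
      by (rule_tac less_le_trans) auto
    then have "\<forall>\<^sub>F z in sequentially \<times>\<^sub>F sequentially. 
        ereal (real N) < (case z of (i, j) \<Rightarrow> ereal (gromov_product n (x i) (y j)))"
      by (rule less_LiminfD)
    moreover have "\<forall>\<^sub>F z in sequentially \<times>\<^sub>F sequentially. take N (x (fst z)) = pref p N \<and> take N (y (snd z)) = pref q N"
      using ev[OF x assms(1)] ev[OF y assms(2)] by (auto intro: eventually_prodI)
    ultimately have "\<forall>\<^sub>F z in sequentially \<times>\<^sub>F sequentially. pref p N = pref q N"
    proof (rule eventually_elim2)
      fix z :: "nat \<times> nat"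
      assume "ereal (real N) < (case z of (i, j) \<Rightarrow> ereal (gromov_product n (x i) (y j)))"
        and *: "take N (x (fst z)) = pref p N \<and> take N (y (snd z)) = pref q N"
      then have "real N \<le> gromov_product n (x (fst z)) (y (snd z))"
        by (auto simp: case_prod_beta)
      then show "pref p N = pref q N"
        using rw[OF x assms(1)] rw[OF y assms(2)] * gromov_product_ge_iff[of "x (fst z)" n "y (snd z)" N] by simp
    qed
    then show ?thesis
      by (simp add: eventually_const prod_filter_eq_bot)
  qed
qed

lemma openin_boundary: 
  "openin (boundary_topology n) U \<longleftrightarrow>
    U \<subseteq> boundary n \<and> (\<forall>p\<in>U. \<exists>N. \<forall>q\<in>boundary n. pref p N = pref q N \<longrightarrow> q \<in> U)"
proof -
  have "openin (boundary_topology n) U \<longleftrightarrow> boundary_open n U"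
    unfolding boundary_topology_def by (simp add: topology_inverse'[OF istopology_boundary_open])
  also have "\<dots> \<longleftrightarrow> U \<subseteq> boundary n \<and> (\<forall>p\<in>U. \<exists>N. \<forall>q\<in>boundary n. pref p N = pref q N \<longrightarrow> q \<in> U)"
    unfolding boundary_open_def
  proof (intro conj_cong refl ball_cong iffI)
    fix p assume U: "U \<subseteq> boundary n" and p: "p \<in> U"
    {
      assume "\<exists>r. boundary_nbhd n p r \<subseteq> U"
      then obtain r where r: "boundary_nbhd n p r \<subseteq> U" ..
      have "boundary_nbhd n p (real (nat \<lceil>r\<rceil>)) \<subseteq> boundary_nbhd n p r"
        by (rule boundary_nbhd_antimono) linarith
      with r U p show "\<exists>N. \<forall>q\<in>boundary n. pref p N = pref q N \<longrightarrow> q \<in> U"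
        by (intro exI[of _ "nat \<lceil>r\<rceil>"]) (use boundary_nbhd_pref(1) in blast)
    next
      assume "\<exists>N. \<forall>q\<in>boundary n. pref p N = pref q N \<longrightarrow> q \<in> U"
      then obtain N where "\<forall>q\<in>boundary n. pref p N = pref q N \<longrightarrow> q \<in> U" ..
      moreover have "q \<in> boundary n" if "q \<in> boundary_nbhd n p r" for q r
        using that by (simp add: boundary_nbhd_def)
      ultimately show "\<exists>r. boundary_nbhd n p r \<subseteq> U"
        using U p boundary_nbhd_pref(2) by (intro exI[of _ "real (Suc N)"]) blast
    }
  qed
  finally show ?thesis .
qed

text \<open>Local constancy with a uniform bound. A set is treated through its membership predicate,
  so the same notion serves clopen sets and integer functions.\<close>

definition depth :: "nat \<Rightarrow> nat \<Rightarrow> (bpoint \<Rightarrow> 'a) \<Rightarrow> bool" where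
  "depth n N f \<longleftrightarrow> (\<forall>p\<in>boundary n. \<forall>q\<in>boundary n. pref p N = pref q N \<longrightarrow> f p = f q)"

lemma depth_mono: "depth n N f \<Longrightarrow> N \<le> M \<Longrightarrow> depth n M f"
  unfolding depth_def by (metis pref_mono)

text \<open>Compactness of the boundary, by Koenig's lemma: otherwise the words below which the function
  is not determined by finitely many letters contain an infinite branch.\<close>

lemma locally_constant_depth:
  assumes f: "\<And>z. openin (boundary_topology n) {p \<in> boundary n. f p = z}"
  shows "\<exists>N. depth n N f"
proof (rule ccontr)
  assume no: "\<nexists>N. depth n N f"
  \<comment> \<open>Below \<open>u\<close>, the value of \<open>f\<close> is determined by
    \<open>M\<close> letters. For \<open>M\<close> smaller than \<open>length u\<close> the
    condition is vacuous, which is why bad words are tested only from \<open>length u\<close>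
    on.\<close>
  define good where "good = (\<lambda>u M. \<forall>p\<in>boundary n. \<forall>q\<in>boundary n.
    pref p (length u) = u \<longrightarrow> pref p M = pref q M \<longrightarrow> length u \<le> M \<longrightarrow> f p = f q)"
  have mono: "good u M'" if "good u M" "M \<le> M'" "length u \<le> M" for u M M'
    unfolding good_def
  proof (intro ballI impI)
    fix p q assume pq: "p \<in> boundary n" "q \<in> boundary n" "pref p (length u) = u" "pref p M' = pref q M'"
    from pref_mono[OF pq(4,1,2) that(2)] have "pref p M = pref q M" .
    from that(1)[unfolded good_def, rule_format, OF pq(1-3) this that(3)] show "f p = f q" .
  qed
  let ?bad = "\<lambda>u. u \<in> rwords n \<and> (\<forall>M\<ge>length u. \<not> good u M)"
  have ext: "\<exists>a. ?bad (u @ [a])" if u: "?bad u" for u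
  proof (rule ccontr)
    assume ne: "\<nexists>a. ?bad (u @ [a])"
    define A where "A = {a :: letter. fst a < n \<and> u @ [a] \<in> rwords n}"
    have "A \<subseteq> {..<n} \<times> UNIV" by (auto simp: A_def)
    then have fin: "finite A" by (rule finite_subset) simp
    have "\<exists>M. M \<ge> Suc (length u) \<and> good (u @ [a]) M" if "a \<in> A" for a
    proof -
      have "u @ [a] \<in> rwords n" using that unfolding A_def by blast
      with ne obtain M where "M \<ge> length (u @ [a])" "good (u @ [a]) M" by blast
      then show ?thesis by (intro exI[of _ M]) simp
    qed
    then have "\<forall>a\<in>A. \<exists>M. M \<ge> Suc (length u) \<and> good (u @ [a]) M"
      by blast
    from bchoice[OF this] obtain M where M: "\<forall>a\<in>A. M a \<ge> Suc (length u) \<and> good (u @ [a]) (M a)" ..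
    \<comment> \<open>Only finitely many letters can extend \<open>u\<close>, so one bound serves
      for all of them. The inserted value keeps the maximum defined and above
      \<open>length u\<close> even if there is no extension.\<close>
    define M' where "M' = Max (insert (Suc (length u)) (M ` A))"
    have "good u M'"
      unfolding good_def
    proof (intro ballI impI)
      fix p q assume p: "p \<in> boundary n" and q: "q \<in> boundary n" and pu: "pref p (length u) = u"
        and pq: "pref p M' = pref q M'"
      have "length (drop (length u) (pref p (Suc (length u)))) = Suc 0"
        using p by simp
      then obtain a where "drop (length u) (pref p (Suc (length u))) = [a]"
        unfolding length_Suc_conv length_0_conv by blast
      then have a: "pref p (Suc (length u)) = u @ [a]"
        using append_take_drop_id[of "length u" "pref p (Suc (length u))"]
          take_pref[OF p, of "length u" "Suc (length u)"] pu by simp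
      have aA: "a \<in> A"
        using pref_rwords[OF p, of "Suc (length u)"] unfolding a by (simp add: A_def)
      have "M a \<le> M'" unfolding M'_def using fin aA by (intro Max_ge finite.insertI finite_imageI insertI2 imageI)
      moreover have *: "good (u @ [a]) (M a)" "length (u @ [a]) \<le> M a"
        using M aA by simp_all
      ultimately have "length (u @ [a]) \<le> M'" by linarith
      moreover have "pref p (length (u @ [a])) = u @ [a]"
        by (simp add: a)
      ultimately show "f p = f q"
        using mono[OF *(1) \<open>M a \<le> M'\<close> *(2), unfolded good_def, rule_format, OF p q _ pq] by blast
    qed
    moreover have "length u \<le> M'"
    proof -
      have "Suc (length u) \<le> M'" unfolding M'_def using fin by (intro Max_ge finite.insertI finite_imageI insertI1)
      then show ?thesis by simp
    qed
    ultimately show False using u by blast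
  qed
  have "?bad []"
  proof -
    have "pref p 0 = []" if "p \<in> boundary n" for p
      using length_pref[OF that, of 0] by simp
    then have "good [] M \<Longrightarrow> depth n M f" for M
      unfolding good_def depth_def list.size by blast
    with no show ?thesis by auto
  qed
  define nxt where "nxt = (\<lambda>u. SOME a. ?bad (u @ [a]))"
  have nxt: "?bad (u @ [nxt u])" if "?bad u" for u
    unfolding nxt_def by (rule someI_ex[OF ext[OF that]])
  define \<xi> where "\<xi> = rec_nat [] (\<lambda>_ u. u @ [nxt u])"
  have \<xi>_0: "\<xi> 0 = []" and \<xi>_Suc: "\<xi> (Suc N) = \<xi> N @ [nxt (\<xi> N)]" for N
    by (simp_all add: \<xi>_def)
  have \<xi>: "?bad (\<xi> N)" for N
  proof (induction N)
    case 0
    show ?case unfolding \<xi>_0 by (rule \<open>?bad []\<close>)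
  next
    case (Suc N)
    show ?case unfolding \<xi>_Suc by (rule nxt[OF Suc])
  qed
  have len: "length (\<xi> N) = N" for N
    by (induction N) (simp_all add: \<xi>_0 \<xi>_Suc)
  have tk: "take M (\<xi> N) = \<xi> M" if "M \<le> N" for M N
    using that
  proof (induction N)
    case (Suc N)
    show ?case
    proof (cases "M = Suc N")
      case True
      show ?thesis unfolding True using len[of "Suc N"] by (intro take_all) simp
    next
      case False
      with Suc.prems have "M \<le> N" by simp
      then show ?thesis using Suc.IH len[of N] by (simp add: \<xi>_Suc)
    qed
  qed (simp add: \<xi>_0)
  have "\<xi> N \<in> rwords n" for N
    using \<xi> by blast
  from boundary_point_exists[OF this len tk]
  obtain p where p: "p \<in> boundary n" "\<And>N. pref p N = \<xi> N" by blast
  have "p \<in> {q \<in> boundary n. f q = f p}" using p(1) by simp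
  with f[of "f p"] obtain N where N: "\<forall>q\<in>boundary n. pref p N = pref q N \<longrightarrow> q \<in> {q \<in> boundary n. f q = f p}"
    unfolding openin_boundary by blast
  have "good (\<xi> N) N"
    unfolding good_def len
  proof (intro ballI impI)
    fix q q' assume "q \<in> boundary n" "q' \<in> boundary n" "pref q N = \<xi> N" "pref q N = pref q' N"
    with N p(2)[of N] show "f q = f q'" by simp
  qed
  moreover have "length (\<xi> N) \<le> N" by (simp add: len)
  ultimately show False using \<xi>[of N] by blast
qed

lemma depth_openin:
  assumes "depth n N f"
  shows "openin (boundary_topology n) {p \<in> boundary n. f p \<in> Z}"
  unfolding openin_boundary
proof (intro conjI ballI exI[of _ N] impI)
  fix p q assume "p \<in> {p \<in> boundary n. f p \<in> Z}" and q: "q \<in> boundary n" "pref p N = pref q N"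
  then have "f p = f q" "f p \<in> Z"
    using assms unfolding depth_def by blast+
  with q(1) show "q \<in> {p \<in> boundary n. f p \<in> Z}" by simp
qed blast

section \<open>End points of lines\<close>

text \<open>As long as the first and last letters are inverse to each other, both are stripped and
  become part of the conjugator \<open>u\<close>.\<close>

lemma cyclic_reduction:
  assumes "reduced w" "w \<noteq> []"
  obtains u c where "w = u @ c @ winv u" "c \<noteq> []" "hd c \<noteq> flip (last c)"
proof -
  have "\<exists>u c. w = u @ c @ winv u \<and> c \<noteq> [] \<and> hd c \<noteq> flip (last c)"
    using assms
  proof (induction w rule: length_induct)
    case (1 w)
    show ?case
    proof (cases "hd w \<noteq> flip (last w)")
      case True
      with 1 show ?thesis by (intro exI[of _ "[]"] exI[of _ w]) simp
    next
      case False
      then obtain a v where w: "w = a # v" "v \<noteq> []" using 1(3)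
        by (cases w) (auto split: if_splits)
      then obtain v' b where v: "v = v' @ [b]" by (cases v rule: rev_cases) auto
      with False w have b: "b = flip a" by (metis flip_flip last_ConsR last_snoc list.sel(1))
      have "v' \<noteq> []" using 1(2) w v b by (auto simp: reduced_Cons)
      moreover have "reduced v'" using 1(2) w v by (auto simp: reduced_Cons reduced_append)
      ultimately obtain u c where "v' = u @ c @ winv u" "c \<noteq> []" "hd c \<noteq> flip (last c)"
        using 1(1)[rule_format, of v'] w v by auto
      then show ?thesis
        using w v b by (intro exI[of _ "a # u"] exI[of _ c]) (simp add: winv_Cons)
    qed
  qed
  then show ?thesis using that by blast
qed

lemma concat_replicate_Suc: "concat (replicate (Suc k) w) = w @ concat (replicate k w)"
  and concat_replicate_Suc': "concat (replicate (Suc k) w) = concat (replicate k w) @ w"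
  by (simp, induction k) simp_all

lemma reduced_cyclic_power:
  assumes "reduced c" "c \<noteq> []" "hd c \<noteq> flip (last c)" "j > 0"
  shows "reduced (concat (replicate j c))" "concat (replicate j c) \<noteq> []"
    "hd (concat (replicate j c)) = hd c" "last (concat (replicate j c)) = last c"
proof -
  have "reduced (concat (replicate (Suc i) c)) \<and> concat (replicate (Suc i) c) \<noteq> [] \<and>
    hd (concat (replicate (Suc i) c)) = hd c \<and> last (concat (replicate (Suc i) c)) = last c" for i
  proof (induction i)
    case 0
    then show ?case using assms by simp
  next
    case (Suc i)
    then show ?case
      using assms by (subst (1 2 3 4) concat_replicate_Suc) (simp add: reduced_append del: replicate.simps)
  qed
  from this[of "j - 1"] assms(4) show "reduced (concat (replicate j c))" "concat (replicate j c) \<noteq> []"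
    "hd (concat (replicate j c)) = hd c" "last (concat (replicate j c)) = last c"
    by simp_all
qed

text \<open>With \<open>w\<close> conjugate by \<open>u\<close> to a cyclically reduced
  \<open>c\<close>, the power \<open>j\<close> is \<open>u\<close>, then \<open>j\<close> copies of
  \<open>c\<close>, then the inverse of \<open>u\<close>, and this word is reduced for positive
  \<open>j\<close>. All powers from \<open>k\<close> on therefore begin with \<open>u\<close> and
  \<open>k\<close> copies of \<open>c\<close>, and \<open>c\<close> has at least one letter.\<close>

lemma power_common_prefix:
  assumes "reduced w" "w \<noteq> []"
  shows "\<exists>s. k \<le> length s \<and> (\<forall>j\<ge>k. \<exists>t. reduce (concat (replicate j w)) = s @ t)"
proof (cases k)
  case 0
  then show ?thesis by (intro exI[of _ "[]"]) auto
next
  case (Suc k')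
  obtain u c where w: "w = u @ c @ winv u" and c: "c \<noteq> []" "hd c \<noteq> flip (last c)"
    by (rule cyclic_reduction[OF assms])
  have rc: "reduced u" "reduced c" "reduced (winv u)"
    "u = [] \<or> hd c \<noteq> flip (last u)" "u = [] \<or> hd (winv u) \<noteq> flip (last c)"
    using assms(1) c(1) by (auto simp: w reduced_append)
  note p = reduced_cyclic_power[OF rc(2) c]
  have r: "reduced (u @ concat (replicate j c) @ winv u)" if "j > 0" for j
    using rc p[OF that] by (simp add: reduced_append)
  have eq: "reduce (concat (replicate (Suc i) w)) = u @ concat (replicate (Suc i) c) @ winv u" for i
  proof (induction i)
    case 0
    then show ?case using assms(1) by (simp add: w reduce_reduced)
  next
    case (Suc i)
    have "reduce (concat (replicate (Suc (Suc i)) w)) = reduce (w @ reduce (concat (replicate (Suc i) w)))"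
      by (simp only: concat_replicate_Suc[of "Suc i"] reduce_append_right)
    also have "\<dots> = reduce (w @ (u @ concat (replicate (Suc i) c) @ winv u))"
      by (simp only: Suc)
    also have "\<dots> = reduce ((u @ c) @ winv u @ u @ (concat (replicate (Suc i) c) @ winv u))"
      by (subst w) (simp only: append_assoc)
    also have "\<dots> = reduce ((u @ c) @ reduce (winv u @ u @ (concat (replicate (Suc i) c) @ winv u)))"
      by (simp only: reduce_append_right)
    also have "\<dots> = reduce (u @ concat (replicate (Suc (Suc i)) c) @ winv u)"
      by (simp only: reduce_winv_cancel reduce_append_right) simp
    also have "\<dots> = u @ concat (replicate (Suc (Suc i)) c) @ winv u"
      by (rule reduce_reduced[OF r]) simp
    finally show ?case .
  qed
  have len: "k \<le> length (concat (replicate k c))" for k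
  proof -
    have "length (concat (replicate k c)) = k * length c"
      by (induction k) simp_all
    then show ?thesis using c(1) by (cases c) simp_all
  qed
  show ?thesis
  proof (rule exI[of _ "u @ concat (replicate k c)"], intro conjI allI impI)
    show "k \<le> length (u @ concat (replicate k c))"
      using len[of k] by (simp add: trans_le_add2)
    fix j assume "k \<le> j"
    then obtain d where j: "j = k + d" using le_Suc_ex by blast
    have "reduce (concat (replicate j w)) = u @ concat (replicate j c) @ winv u"
      using eq[of "j - 1"] \<open>k \<le> j\<close> Suc by (cases j) simp_all
    also have "\<dots> = (u @ concat (replicate k c)) @ concat (replicate d c) @ winv u"
      by (simp add: j replicate_add)
    finally show "\<exists>t. reduce (concat (replicate j w)) = (u @ concat (replicate k c)) @ t" by blast
  qed
qed

text \<open>The power \<open>N + length g\<close> settles at least that many letters of the ray, and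
  \<open>g\<close> destroys at most \<open>length g\<close> of them. So a finite computation
  replaces the limit.\<close>

definition ray_prefix :: "nat \<Rightarrow> word \<Rightarrow> word \<Rightarrow> word" where
  "ray_prefix N g w = take N (reduce (g @ concat (replicate (N + length g) w)))"

text \<open>Only natural exponents occur; the other end of the line is obtained with
  \<open>winv w\<close> in place of \<open>w\<close>.\<close>

definition line_end :: "nat \<Rightarrow> word \<Rightarrow> word \<Rightarrow> bpoint" where
  "line_end n g w = boundary_lim n (\<lambda>k. reduce (g @ concat (replicate k w)))"

lemma line_sequence:
  assumes g: "g \<in> rwords n" and w: "w \<in> rwords n" "w \<noteq> []"
  defines "x \<equiv> \<lambda>k. reduce (g @ concat (replicate k w))"
  shows "x \<in> boundary_sequences n" "limit_prefix x (ray_prefix N g w)" "length (ray_prefix N g w) = N"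
proof -
  define y where "y = (\<lambda>k. reduce (concat (replicate k w)))"
  have y: "limit_prefix y (take K (y K)) \<and> length (take K (y K)) = K" for K
  proof -
    obtain s where s: "K \<le> length s" "\<forall>j\<ge>K. \<exists>t. y j = s @ t"
      unfolding y_def using power_common_prefix[of w K] w by auto
    then have tk: "take K (y j) = take K s" if "j \<ge> K" for j
      using that by force
    have l: "length (take K s) = K" using s by simp
    show ?thesis
      unfolding limit_prefix_def eventually_sequentially tk[OF order_refl] l
      by (intro conjI exI[of _ K] allI impI tk refl)
  qed
  have "range y \<subseteq> rwords n"
    using w by (auto simp: y_def reduced_reduce intro!: reduce_words words_concat_replicate)
  with y have yb: "y \<in> boundary_sequences n"
    unfolding boundary_sequences_iff by blast
  have x: "x = (\<lambda>k. reduce (g @ y k))"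
    by (simp add: x_def y_def reduce_append_right)
  show "x \<in> boundary_sequences n"
    unfolding x by (rule boundary_sequences_mult(1)[OF g yb])
  let ?u = "take (N + length g) (y (N + length g))"
  have u: "limit_prefix y ?u" "length ?u = N + length g"
    using y by blast+
  have ry: "reduced (y k)" for k by (simp add: y_def reduced_reduce)
  have "take N (reduce (g @ ?u)) = take N (reduce (g @ y (N + length g)))"
    by (rule take_reduce_append) (simp_all add: ry reduced_take)
  then have eq: "take N (reduce (g @ ?u)) = ray_prefix N g w"
    by (simp add: ray_prefix_def y_def reduce_append_right)
  from boundary_sequences_mult(2)[OF g yb u] show "limit_prefix x (ray_prefix N g w)"
    unfolding x eq .
  have "N + length g \<le> length (reduce (g @ ?u)) + length g"
    using length_reduce_append_ge[of ?u g] ry u(2) by (simp add: reduced_take)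
  then show "length (ray_prefix N g w) = N"
    unfolding eq[symmetric] by simp
qed

lemma line_end_boundary:
  assumes "g \<in> rwords n" "w \<in> rwords n" "w \<noteq> []"
  shows "line_end n g w \<in> boundary n" "pref (line_end n g w) N = ray_prefix N g w"
proof -
  note b = boundary_lim[OF line_sequence(1)[OF assms]]
  show "line_end n g w \<in> boundary n"
    unfolding line_end_def by (rule b)
  show "pref (line_end n g w) N = ray_prefix N g w"
    unfolding line_end_def by (rule pref_eqI[OF b line_sequence(2,3)[OF assms]])
qed

lemma boundary_eq_of_common_sequence:
  assumes "p \<in> boundary n" "q \<in> boundary n" "x \<in> p" "x \<in> q"
  shows "p = q"
  by (rule boundary_eqI[OF assms(1,2)])
    (rule pref_eqI[OF assms(1,3) limit_prefix_pref(1)[OF assms(2,4)] length_pref[OF assms(2)]])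

lemma boundary_act_line_end:
  assumes "h \<in> rwords n" "g \<in> rwords n" "w \<in> rwords n" "w \<noteq> []"
  shows "boundary_act n h (line_end n g w) = line_end n (reduce (h @ g)) w"
proof (rule boundary_eq_of_common_sequence)
  let ?x = "\<lambda>k. reduce (g @ concat (replicate k w))"
  have hg: "reduce (h @ g) \<in> rwords n"
    using assms by (intro reduce_mult_words) auto
  show "boundary_act n h (line_end n g w) \<in> boundary n" "line_end n (reduce (h @ g)) w \<in> boundary n"
    using assms hg by (simp_all add: boundary_act_closed line_end_boundary)
  have "?x \<in> line_end n g w"
    unfolding line_end_def by (rule boundary_lim[OF line_sequence(1)[OF assms(2-4)]])
  then show "(\<lambda>k. reduce (h @ ?x k)) \<in> boundary_act n h (line_end n g w)"
    by (auto simp: boundary_act_def)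
  have "(\<lambda>k. reduce (h @ ?x k)) = (\<lambda>k. reduce (reduce (h @ g) @ concat (replicate k w)))"
    by (simp add: reduce_append_left reduce_append_right)
  then show "(\<lambda>k. reduce (h @ ?x k)) \<in> line_end n (reduce (h @ g)) w"
    unfolding line_end_def using boundary_lim(2)[OF line_sequence(1)[OF hg assms(3,4)]] by simp
qed

lemma limit_prefix_Suc: "limit_prefix (\<lambda>k. x (Suc k)) u \<longleftrightarrow> limit_prefix x u"
  unfolding limit_prefix_def by (rule eventually_sequentially_Suc)

text \<open>Replacing \<open>g\<close> by \<open>g\<close> times \<open>w\<close> reparametrises the
  same line: the vertex sequences differ by a shift of one index, in opposite directions at the two
  ends.\<close>

lemma line_end_shift:
  assumes "g \<in> rwords n" "w \<in> rwords n" "w \<noteq> []"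
  shows "line_end n (reduce (g @ w)) w = line_end n g w"
    and "line_end n (reduce (g @ w)) (winv w) = line_end n g (winv w)"
proof -
  have gw: "reduce (g @ w) \<in> rwords n"
    using assms by (intro reduce_mult_words) auto
  have w': "winv w \<in> rwords n" "winv w \<noteq> []"
    using assms by simp_all
  let ?seq = "\<lambda>g w k. reduce (g @ concat (replicate k w))"
  have eqI: "line_end n h v = line_end n h' v"
    if "h \<in> rwords n" "h' \<in> rwords n" "v \<in> rwords n" "v \<noteq> []" "?seq h v = (\<lambda>k. ?seq h' v (Suc k))" for h h' v
  proof (rule boundary_eqI)
    show "line_end n h v \<in> boundary n" "line_end n h' v \<in> boundary n"
      using that by (simp_all add: line_end_boundary)
    fix N
    have "limit_prefix (?seq h v) (ray_prefix N h' v)"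
      using line_sequence(2)[OF that(2-4)] limit_prefix_Suc[of "?seq h' v"] that(5) by simp
    then have "ray_prefix N h v = ray_prefix N h' v"
      using line_sequence[OF that(1,3,4)] line_sequence[OF that(2-4)] by (intro limit_prefix_unique) auto
    then show "pref (line_end n h v) N = pref (line_end n h' v) N"
      using that by (simp add: line_end_boundary)
  qed
  show "line_end n (reduce (g @ w)) w = line_end n g w"
    by (rule eqI[OF gw assms]) (simp add: reduce_append_left)
  have "reduce (g @ concat (replicate k (winv w))) = reduce (reduce (g @ w) @ concat (replicate (Suc k) (winv w)))" for k
  proof -
    have "reduce (reduce (g @ w) @ concat (replicate (Suc k) (winv w))) =
      reduce (g @ reduce (w @ winv w @ concat (replicate k (winv w))))"
      by (simp only: reduce_append_left reduce_append_right concat_replicate_Suc append_assoc)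
    then show ?thesis
      by (simp only: reduce_winv_cancel reduce_append_right)
  qed
  then show "line_end n (reduce (g @ w)) (winv w) = line_end n g (winv w)"
    by (intro eqI[symmetric] assms gw w') (rule ext)
qed

text \<open>Right multiplication by \<open>w\<close> cancels only a suffix of \<open>h\<close> that
  is no longer than \<open>w\<close>.\<close>

lemma take_reduce_append_right:
  assumes "reduced h" "reduced w" "D + length w \<le> length h"
  shows "take D (reduce (h @ w)) = take D h"
proof -
  obtain c x y where c: "winv h = c @ x" "w = c @ y" "x = [] \<or> y = [] \<or> hd x \<noteq> hd y"
    by (rule common_prefix_split)
  have h: "h = winv x @ winv c"
    using c(1) by (metis winv_simps(2,3))
  have "reduce (h @ w) = winv x @ y"
    using reduce_winv_common_prefix[of c x y] c assms by (metis reduced_winv winv_simps(3))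
  moreover have "D \<le> length (winv x)"
    using assms(3) unfolding h by (simp add: c(2))
  ultimately show ?thesis by (simp add: h)
qed

text \<open>A line whose ends have different prefixes of length \<open>D\<close> passes through the ball of radius \<open>D\<close>
  around the identity, so one of its translates by a power of \<open>w\<close> starts near that ball.\<close>

lemma line_end_near:
  assumes g: "g \<in> rwords n" and w: "w \<in> rwords n" "w \<noteq> []"
    and neq: "pref (line_end n g w) D \<noteq> pref (line_end n g (winv w)) D"
  obtains g' where "g' \<in> rwords n" "length g' \<le> D + length w"
    "line_end n g' w = line_end n g w" "line_end n g' (winv w) = line_end n g (winv w)"
proof -
  let ?seq = "\<lambda>w k. reduce (g @ concat (replicate k w))"
  have rw: "?seq v k \<in> rwords n" if "v \<in> rwords n" for v k
    using that g by (intro reduce_mult_words) (auto intro: words_concat_replicate)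
  have step: "?seq v (Suc k) = reduce (?seq v k @ v)" for v k
    by (simp only: concat_replicate_Suc' reduce_append_left append_assoc)
  have w': "winv w \<in> rwords n" "winv w \<noteq> []" using w by simp_all
  \<comment> \<open>If all vertices of the ray are longer than \<open>D + length w\<close>, then
    each step alters only letters beyond the first \<open>D\<close>, so the prefix of length
    \<open>D\<close> is that of \<open>g\<close> throughout.\<close>
  have far: "take D (?seq v k) = take D g" if "\<forall>k. D + length w < length (?seq v k)" "length v = length w" "v \<in> rwords n" for v k
  proof (induction k)
    case 0
    then show ?case using g by (simp add: reduce_reduced)
  next
    case (Suc k)
    have "take D (?seq v (Suc k)) = take D (?seq v k)"
      unfolding step using that rw[OF that(3), of k]
      by (intro take_reduce_append_right) (auto simp: less_imp_le)
    with Suc show ?case by simp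
  qed
  have far': "pref (line_end n g v) D = take D g"
    if "\<forall>k. D + length w < length (?seq v k)" "length v = length w" "v \<in> rwords n" "v \<noteq> []" for v
  proof -
    have "limit_prefix (?seq v) (take D g)"
      unfolding limit_prefix_def using far[OF that(1-3)] that(1)[rule_format, of 0] g
      by (simp add: reduce_reduced)
    moreover have "length (take D g) = D"
      using that(1)[rule_format, of 0] g by (simp add: reduce_reduced)
    ultimately have "ray_prefix D g v = take D g"
      using line_sequence[OF g that(3,4)] by (intro limit_prefix_unique) auto
    then show ?thesis
      using line_end_boundary[OF g that(3,4)] by simp
  qed
  \<comment> \<open>If both rays stayed far away, both ends would have the prefix of
    \<open>g\<close>, contrary to the assumption on the ends.\<close>
  have near: "\<exists>k. length (?seq w k) \<le> D + length w \<or> length (?seq (winv w) k) \<le> D + length w"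
  proof (rule ccontr)
    assume "\<not> ?thesis"
    then have "pref (line_end n g w) D = take D g" "pref (line_end n g (winv w)) D = take D g"
      using w w' by (auto intro!: far' simp: not_le)
    with neq show False by simp
  qed
  have shift: "line_end n (?seq v k) v = line_end n g v \<and> line_end n (?seq v k) (winv v) = line_end n g (winv v)"
    if "v \<in> rwords n" "v \<noteq> []" for v k
  proof (induction k)
    case 0
    then show ?case using g by (simp add: reduce_reduced)
  next
    case (Suc k)
    then show ?case
      unfolding step using line_end_shift[OF rw[OF that(1), of k] that] by simp
  qed
  from near obtain k where "length (?seq w k) \<le> D + length w \<or> length (?seq (winv w) k) \<le> D + length w" ..
  then show ?thesis
  proof
    assume "length (?seq w k) \<le> D + length w"
    then show ?thesis
      using shift[OF w, of k] rw[OF w(1), of k] by (intro that[of "?seq w k"]) auto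
  next
    assume "length (?seq (winv w) k) \<le> D + length w"
    then show ?thesis
      using shift[OF w', of k] rw[OF w'(1), of k] by (intro that[of "?seq (winv w) k"]) auto
  qed
qed

text \<open>Negative powers of \<open>w\<close> become natural powers of its inverse, so both ends
  are values of \<open>line_end\<close>.\<close>

lemma line_pattern_eq:
  assumes "set ws \<subseteq> rwords n"
  shows "line_pattern n ws = {(line_end n g w, line_end n g (winv w)) | g w. g \<in> rwords n \<and> w \<in> set ws}"
proof -
  interpret F: group "free_group n" by (rule group_free_group)
  have 1: "(\<lambda>k. g \<otimes>\<^bsub>free_group n\<^esub> w [^]\<^bsub>free_group n\<^esub> int k) = (\<lambda>k. reduce (g @ concat (replicate k w)))" for g w
    by (simp add: int_pow_int pow_free_group reduce_append_right)
  have 2: "(\<lambda>k. g \<otimes>\<^bsub>free_group n\<^esub> w [^]\<^bsub>free_group n\<^esub> (- int k)) = (\<lambda>k. reduce (g @ concat (replicate k (winv w))))"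
    if "w \<in> rwords n" for g w
  proof
    fix k
    have "w [^]\<^bsub>free_group n\<^esub> (- int k) = inv\<^bsub>free_group n\<^esub> (w [^]\<^bsub>free_group n\<^esub> int k)"
      using that by (intro F.int_pow_neg) simp
    also have "\<dots> = (inv\<^bsub>free_group n\<^esub> w) [^]\<^bsub>free_group n\<^esub> k"
      using that by (simp add: int_pow_int F.nat_pow_inv)
    also have "\<dots> = reduce (concat (replicate k (winv w)))"
      using that by (simp only: inv_free_group pow_free_group)
    finally show "g \<otimes>\<^bsub>free_group n\<^esub> w [^]\<^bsub>free_group n\<^esub> (- int k) = reduce (g @ concat (replicate k (winv w)))"
      by (simp add: reduce_append_right)
  qed
  show ?thesis
  proof -
    have eq: "(boundary_lim n (\<lambda>k. g \<otimes>\<^bsub>free_group n\<^esub> w [^]\<^bsub>free_group n\<^esub> int k),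
        boundary_lim n (\<lambda>k. g \<otimes>\<^bsub>free_group n\<^esub> w [^]\<^bsub>free_group n\<^esub> (- int k))) =
      (line_end n g w, line_end n g (winv w))" if "w \<in> set ws" for g w
      unfolding line_end_def 1 using 2[of w g] that assms by (simp only: subset_iff)
    show ?thesis
      unfolding line_pattern_def carrier_free_group
    proof (intro Set.set_eqI iffI, goal_cases)
      case (1 z)
      then obtain g w where gw: "g \<in> rwords n" "w \<in> set ws" and z: "z =
        (boundary_lim n (\<lambda>k. g \<otimes>\<^bsub>free_group n\<^esub> w [^]\<^bsub>free_group n\<^esub> int k),
        boundary_lim n (\<lambda>k. g \<otimes>\<^bsub>free_group n\<^esub> w [^]\<^bsub>free_group n\<^esub> (- int k)))"
        by blast
      from z have "z = (line_end n g w, line_end n g (winv w))"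
        unfolding eq[OF gw(2)] .
      with gw show ?case by blast
    next
      case (2 z)
      then obtain g w where gw: "g \<in> rwords n" "w \<in> set ws" and z: "z = (line_end n g w, line_end n g (winv w))"
        by blast
      from z have "z = (boundary_lim n (\<lambda>k. g \<otimes>\<^bsub>free_group n\<^esub> w [^]\<^bsub>free_group n\<^esub> int k),
        boundary_lim n (\<lambda>k. g \<otimes>\<^bsub>free_group n\<^esub> w [^]\<^bsub>free_group n\<^esub> (- int k)))"
        unfolding eq[OF gw(2), symmetric] .
      with gw show ?case by blast
    qed
  qed
qed

lemma reduced_append_nonempty:
  "reduced (y @ u) \<Longrightarrow> reduced (u @ v) \<Longrightarrow> u \<noteq> [] \<Longrightarrow> reduced (y @ u @ v)"
  by (auto simp: reduced_append)

text \<open>Reducedness concerns adjacent letters only. Since \<open>s > 0\<close>, the seam between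
  \<open>y\<close> and the point is already visible in \<open>pref p s\<close>, and no longer prefix
  can cause a cancellation.\<close>

lemma pref_act:
  assumes "p \<in> boundary n" "y \<in> words n" "reduced (y @ pref p s)" "s > 0"
  shows "pref (boundary_act n y p) (length y + s) = y @ pref p s"
proof -
  have y: "y \<in> rwords n" using assms by (simp add: reduced_append)
  let ?K = "length y + s + length y"
  have split: "pref p ?K = pref p s @ drop s (pref p ?K)"
    using take_pref[OF assms(1), of s ?K] append_take_drop_id[of s "pref p ?K"] by simp
  have "reduced (y @ pref p s @ drop s (pref p ?K))"
    using assms split pref_reduced[OF assms(1), of ?K]
    by (intro reduced_append_nonempty) (auto simp: length_0_conv[symmetric] simp del: length_0_conv)
  then have "reduce (y @ pref p ?K) = y @ pref p ?K"
    using split by (metis reduce_reduced)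
  then show ?thesis
    using boundary_act_closed(2)[OF y assms(1), of "length y + s"] take_pref[OF assms(1), of s ?K] by simp
qed

lemma pref_act_winv:
  assumes "p \<in> boundary n" "pref p (length y + s) = y @ t"
  shows "pref (boundary_act n (winv y) p) s = t"
proof -
  have r: "reduced (y @ t)" "y @ t \<in> words n"
    using pref_rwords[OF assms(1), of "length y + s"] assms(2) by auto
  then have y: "winv y \<in> rwords n" by (auto simp: reduced_append)
  have "length (y @ t) = length y + s"
    using assms length_pref by metis
  then have "take s (reduce (winv y @ y @ t)) = t"
    using r by (simp add: reduced_append reduce_reduced)
  then show ?thesis
    using boundary_act_closed(2)[OF y assms(1), of s] assms(2) by (simp add: add.commute)
qed

section \<open>Cech cohomology in degree zero\<close>

text \<open>The value 0 off the space makes equality of functions the same as equality on the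
  space.\<close>

definition lc_functions :: "'a topology \<Rightarrow> ('a \<Rightarrow> int) set" where
  "lc_functions X = {f. (\<forall>x. x \<notin> topspace X \<longrightarrow> f x = 0) \<and> (\<forall>z. openin X {x \<in> topspace X. f x = z})}"

text \<open>The function to which a cocycle of degree zero glues. A cocycle has equal values on
  overlapping members, so the choice of the member does not matter.\<close>

definition cech_value :: "'a set set \<Rightarrow> 'a cochain \<Rightarrow> 'a \<Rightarrow> int" where
  "cech_value U c x = (if \<exists>V\<in>U. x \<in> V then c [SOME V. V \<in> U \<and> x \<in> V] else 0)"

lemma nerve_simplices_0: "vs \<in> nerve_simplices U 0 \<longleftrightarrow> (\<exists>V\<in>U. V \<noteq> {} \<and> vs = [V])"
  by (auto simp: nerve_simplices_def length_Suc_conv)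

lemma nerve_simplices_1: "vs \<in> nerve_simplices U (Suc 0) \<longleftrightarrow> (\<exists>V\<in>U. \<exists>W\<in>U. V \<inter> W \<noteq> {} \<and> vs = [V, W])"
  by (auto simp: nerve_simplices_def length_Suc_conv)

lemma coboundary_0: "[V, W] \<in> nerve_simplices U (Suc 0) \<Longrightarrow> coboundary U 0 c [V, W] = c [W] - c [V]"
  by (simp add: coboundary_def)

lemma cocycles_0D:
  assumes "c \<in> cocycles U 0" "V \<in> U" "W \<in> U" "x \<in> V" "x \<in> W"
  shows "c [V] = c [W]"
proof -
  have s: "[V, W] \<in> nerve_simplices U (Suc 0)"
    using assms unfolding nerve_simplices_1 by blast
  have "coboundary U 0 c [V, W] = 0"
    using assms(1) by (simp add: cocycles_def)
  with coboundary_0[OF s, of c] show ?thesis by simp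
qed

lemma cocycles_0I:
  assumes "\<And>vs. vs \<notin> nerve_simplices U 0 \<Longrightarrow> c vs = 0"
    and "\<And>V W x. V \<in> U \<Longrightarrow> W \<in> U \<Longrightarrow> x \<in> V \<Longrightarrow> x \<in> W \<Longrightarrow> c [V] = c [W]"
  shows "c \<in> cocycles U 0"
proof -
  have "coboundary U 0 c vs = 0" for vs
  proof (cases "vs \<in> nerve_simplices U (Suc 0)")
    case True
    then obtain V W x where vs: "V \<in> U" "W \<in> U" "x \<in> V" "x \<in> W" "vs = [V, W]"
      unfolding nerve_simplices_1 by blast
    then show ?thesis
      using coboundary_0[of V W U c] True assms(2)[OF vs(1-4)] by simp
  qed (simp add: coboundary_def)
  with assms(1) show ?thesis by (auto simp: cocycles_def cochains_def)
qed

lemma cocycles_0_outside: "c \<in> cocycles U 0 \<Longrightarrow> vs \<notin> nerve_simplices U 0 \<Longrightarrow> c vs = 0"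
  by (simp add: cocycles_def cochains_def)

lemma cech_value_eq:
  assumes "c \<in> cocycles U 0" "V \<in> U" "x \<in> V"
  shows "cech_value U c x = c [V]"
proof -
  have "(SOME V. V \<in> U \<and> x \<in> V) \<in> U \<and> x \<in> (SOME V. V \<in> U \<and> x \<in> V)"
    by (rule someI[of _ V]) (use assms in blast)
  then have "c [SOME V. V \<in> U \<and> x \<in> V] = c [V]"
    using cocycles_0D[OF assms(1) _ assms(2) _ assms(3)] by blast
  then show ?thesis using assms by (auto simp: cech_value_def)
qed

lemma open_coversD:
  assumes "U \<in> open_covers X"
  shows "V \<in> U \<Longrightarrow> openin X V" "x \<in> topspace X \<longleftrightarrow> (\<exists>V\<in>U. x \<in> V)"
  using assms by (auto simp: open_covers_def)

lemma cech_value_lc: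
  assumes "U \<in> open_covers X" "c \<in> cocycles U 0"
  shows "cech_value U c \<in> lc_functions X"
proof -
  have "{x \<in> topspace X. cech_value U c x = z} = \<Union>{V \<in> U. c [V] = z}" for z
    using open_coversD(2)[OF assms(1)] cech_value_eq[OF assms(2)] by auto
  moreover have "openin X (\<Union>{V \<in> U. c [V] = z})" for z
    using open_coversD(1)[OF assms(1)] by (intro openin_Union) auto
  moreover have "cech_value U c x = 0" if "x \<notin> topspace X" for x
    using that open_coversD(2)[OF assms(1)] by (auto simp: cech_value_def)
  ultimately show ?thesis
    unfolding lc_functions_def by simp
qed

text \<open>The only coboundary in degree zero is 0, so equivalent cocycles agree on a common
  refinement, and this can be read off pointwise from the glued functions.\<close>

lemma cech_rel_0_iff:
  "((U, c), (V, d)) \<in> cech_rel X 0 \<longleftrightarrow>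
    (U \<in> open_covers X \<and> c \<in> cocycles U 0) \<and> (V \<in> open_covers X \<and> d \<in> cocycles V 0) \<and>
    cech_value U c = cech_value V d"
proof -
  have "(\<exists>W\<in>open_covers X. \<exists>\<phi> \<psi>. refines_via id \<phi> W U \<and> refines_via id \<psi> W V \<and>
        (\<lambda>vs. cochain_pullback \<phi> W 0 c vs - cochain_pullback \<psi> W 0 d vs) \<in> coboundaries W 0) \<longleftrightarrow>
      cech_value U c = cech_value V d" (is "?L \<longleftrightarrow> ?R")
    if U: "U \<in> open_covers X" "c \<in> cocycles U 0" and V: "V \<in> open_covers X" "d \<in> cocycles V 0"
  proof
    assume ?L
    then obtain W \<phi> \<psi> where W: "W \<in> open_covers X" "refines_via id \<phi> W U" "refines_via id \<psi> W V"
      and "(\<lambda>vs. cochain_pullback \<phi> W 0 c vs - cochain_pullback \<psi> W 0 d vs) \<in> coboundaries W 0" by blast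
    then have 0: "cochain_pullback \<phi> W 0 c vs - cochain_pullback \<psi> W 0 d vs = 0" for vs
      by (simp add: coboundaries_def fun_eq_iff)
    show ?R
    proof
      fix x
      show "cech_value U c x = cech_value V d x"
      proof (cases "x \<in> topspace X")
        case True
        then obtain w where w: "w \<in> W" "x \<in> w" using open_coversD(2)[OF W(1)] by blast
        then have "[w] \<in> nerve_simplices W 0" by (auto simp: nerve_simplices_0)
        with 0[of "[w]"] have "c [\<phi> w] = d [\<psi> w]" by (simp add: cochain_pullback_def)
        moreover have "\<phi> w \<in> U" "x \<in> \<phi> w" "\<psi> w \<in> V" "x \<in> \<psi> w"
          using W(2,3) w by (auto simp: refines_via_def)
        ultimately show ?thesis
          using cech_value_eq[OF U(2)] cech_value_eq[OF V(2)] by simp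
      next
        case False
        then show ?thesis
          using open_coversD(2)[OF U(1)] open_coversD(2)[OF V(1)] by (auto simp: cech_value_def)
      qed
    qed
  next
    assume R: ?R
    \<comment> \<open>The pairwise intersections refine both covers, and on a nonempty member both
      pulled-back cochains take the common value of the glued functions at any of its
      points.\<close>
    define W where "W = {u \<inter> v | u v. u \<in> U \<and> v \<in> V}"
    define \<phi> where "\<phi> = (\<lambda>w. SOME u. u \<in> U \<and> w \<subseteq> u)"
    define \<psi> where "\<psi> = (\<lambda>w. SOME v. v \<in> V \<and> w \<subseteq> v)"
    have "\<Union>W = topspace X"
    proof -
      have "x \<in> \<Union>W \<longleftrightarrow> (\<exists>u\<in>U. x \<in> u) \<and> (\<exists>v\<in>V. x \<in> v)" for x
        by (auto simp: W_def)
      then show ?thesis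
        using open_coversD(2)[OF U(1)] open_coversD(2)[OF V(1)] by blast
    qed
    moreover have "openin X w" if "w \<in> W" for w
      using that open_coversD(1)[OF U(1)] open_coversD(1)[OF V(1)] by (auto simp: W_def)
    ultimately have W: "W \<in> open_covers X" by (auto simp: open_covers_def)
    have \<phi>: "\<phi> w \<in> U \<and> w \<subseteq> \<phi> w" if "w \<in> W" for w
      unfolding \<phi>_def by (rule someI_ex) (use that in \<open>auto simp: W_def\<close>)
    have \<psi>: "\<psi> w \<in> V \<and> w \<subseteq> \<psi> w" if "w \<in> W" for w
      unfolding \<psi>_def by (rule someI_ex) (use that in \<open>auto simp: W_def\<close>)
    have "cochain_pullback \<phi> W 0 c vs - cochain_pullback \<psi> W 0 d vs = 0" for vs
    proof (cases "vs \<in> nerve_simplices W 0")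
      case True
      then obtain w x where w: "w \<in> W" "x \<in> w" "vs = [w]" by (auto simp: nerve_simplices_0)
      have "c [\<phi> w] = cech_value U c x" "d [\<psi> w] = cech_value V d x"
        using \<phi>[OF w(1)] \<psi>[OF w(1)] w(2) cech_value_eq[OF U(2)] cech_value_eq[OF V(2)] by auto
      then show ?thesis using R w True by (simp add: cochain_pullback_def)
    qed (simp add: cochain_pullback_def)
    then have "(\<lambda>vs. cochain_pullback \<phi> W 0 c vs - cochain_pullback \<psi> W 0 d vs) \<in> coboundaries W 0"
      by (simp add: coboundaries_def)
    moreover have "refines_via id \<phi> W U" "refines_via id \<psi> W V"
      using \<phi> \<psi> by (auto simp: refines_via_def)
    ultimately show ?L using W by blast
  qed
  then show ?thesis unfolding cech_rel_def by auto
qed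

definition cech_class :: "'a topology \<Rightarrow> ('a \<Rightarrow> int) \<Rightarrow> 'a cech_class" where
  "cech_class X f = {(U, c). U \<in> open_covers X \<and> c \<in> cocycles U 0 \<and> cech_value U c = f}"

text \<open>The value at an arbitrary point of the member; it is meant for covers on whose members
  \<open>f\<close> is constant.\<close>

definition sampled_cochain :: "('a \<Rightarrow> int) \<Rightarrow> 'a set set \<Rightarrow> 'a cochain" where
  "sampled_cochain f W = (\<lambda>vs. if vs \<in> nerve_simplices W 0 then f (SOME x. x \<in> hd vs) else 0)"

lemma sampled_cochain_class:
  assumes f: "f \<in> lc_functions X" and W: "W \<in> open_covers X"
    and const: "\<And>w x y. w \<in> W \<Longrightarrow> x \<in> w \<Longrightarrow> y \<in> w \<Longrightarrow> f x = f y"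
  shows "(W, sampled_cochain f W) \<in> cech_class X f"
proof -
  have val: "sampled_cochain f W [w] = f x" if "w \<in> W" "x \<in> w" for w x
  proof -
    have "(SOME y. y \<in> w) \<in> w" by (rule someI[of _ x]) (rule that(2))
    then have "f (SOME y. y \<in> w) = f x" using const[OF that(1)] that(2) by blast
    moreover have "[w] \<in> nerve_simplices W 0" using that by (auto simp: nerve_simplices_0)
    ultimately show ?thesis by (simp add: sampled_cochain_def)
  qed
  have c: "sampled_cochain f W \<in> cocycles W 0"
  proof (rule cocycles_0I)
    fix V V' x assume "V \<in> W" "V' \<in> W" "x \<in> V" "x \<in> V'"
    then show "sampled_cochain f W [V] = sampled_cochain f W [V']" using val[of _ x] by simp
  qed (simp add: sampled_cochain_def)
  have "cech_value W (sampled_cochain f W) x = f x" for x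
  proof (cases "x \<in> topspace X")
    case True
    then obtain w where "w \<in> W" "x \<in> w" using open_coversD(2)[OF W] by blast
    then show ?thesis using cech_value_eq[OF c] val by simp
  next
    case False
    then show ?thesis
      using f open_coversD(2)[OF W] by (auto simp: cech_value_def lc_functions_def)
  qed
  then show ?thesis using c W by (auto simp: cech_class_def)
qed

text \<open>Two functions are made constant on the same members because the sum of two classes is
  formed from representatives over one common cover.\<close>

definition level_cover :: "'a topology \<Rightarrow> ('a \<Rightarrow> int) \<Rightarrow> ('a \<Rightarrow> int) \<Rightarrow> 'a set set" where
  "level_cover X f g = {{x \<in> topspace X. f x = y \<and> g x = z} | y z. True}"

lemma level_cover_const:
  assumes "w \<in> level_cover X f g" "x \<in> w" "y \<in> w"
  shows "f x = f y" "g x = g y"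
  using assms by (auto simp: level_cover_def)

lemma level_cover_open:
  assumes "f \<in> lc_functions X" "g \<in> lc_functions X"
  shows "level_cover X f g \<in> open_covers X"
proof -
  let ?W = "level_cover X f g"
  have "openin X ({x \<in> topspace X. f x = y} \<inter> {x \<in> topspace X. g x = z})" for y z
    using assms(1,2) by (intro openin_Int) (auto simp: lc_functions_def)
  moreover have "{x \<in> topspace X. f x = y} \<inter> {x \<in> topspace X. g x = z} = {x \<in> topspace X. f x = y \<and> g x = z}" for y z
    by blast
  ultimately have "openin X w" if "w \<in> ?W" for w
    using that unfolding level_cover_def by auto
  moreover have "\<Union>?W = topspace X" by (auto simp: level_cover_def)
  ultimately show ?thesis by (auto simp: open_covers_def)
qed

lemma sampled_level_cochain:
  assumes "f \<in> lc_functions X" "g \<in> lc_functions X"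
  shows "(level_cover X f g, sampled_cochain f (level_cover X f g)) \<in> cech_class X f"
    and "(level_cover X f g, sampled_cochain g (level_cover X f g)) \<in> cech_class X g"
  by (rule sampled_cochain_class[OF assms(1) level_cover_open[OF assms]], erule (2) level_cover_const)
    (rule sampled_cochain_class[OF assms(2) level_cover_open[OF assms]], erule (2) level_cover_const)

lemma cech_class_nonempty:
  assumes "f \<in> lc_functions X"
  shows "cech_class X f \<noteq> {}"
  using sampled_level_cochain(1)[OF assms assms] by blast

lemma inj_on_cech_class: "inj_on (cech_class X) (lc_functions X)"
proof (rule inj_onI)
  fix f g assume "f \<in> lc_functions X" "g \<in> lc_functions X" "cech_class X f = cech_class X g"
  then obtain U c where "(U, c) \<in> cech_class X f" "(U, c) \<in> cech_class X g"
    using cech_class_nonempty by fastforce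
  then show "f = g" by (simp add: cech_class_def)
qed

text \<open>The group operation, the unit and the pullback are all written as images of sets of
  representatives under \<open>cech_rel\<close>. For each of them it is then enough to exhibit one
  representative and to see that all of them glue to the same function.\<close>

lemma cech_rel_Image:
  assumes "S \<noteq> {}" "S \<subseteq> cech_class X f"
  shows "cech_rel X 0 `` S = cech_class X f"
proof
  show "cech_rel X 0 `` S \<subseteq> cech_class X f"
    using assms by (auto simp: cech_class_def cech_rel_0_iff)
  obtain U c where Uc: "(U, c) \<in> S" using assms(1) by auto
  show "cech_class X f \<subseteq> cech_rel X 0 `` S"
  proof
    fix z assume "z \<in> cech_class X f"
    with assms(2) Uc have "((U, c), z) \<in> cech_rel X 0"
      by (cases z) (auto simp: cech_class_def cech_rel_0_iff)
    with Uc show "z \<in> cech_rel X 0 `` S" by blast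
  qed
qed

lemma carrier_cech_0: "carrier (cech_cohomology X 0) = cech_class X ` lc_functions X"
proof -
  let ?V = "{(U, c). U \<in> open_covers X \<and> c \<in> cocycles U 0}"
  have 1: "cech_rel X 0 `` {(U, c)} = cech_class X (cech_value U c)" if "(U, c) \<in> ?V" for U c
    using that by (intro cech_rel_Image) (auto simp: cech_class_def)
  have "?V // cech_rel X 0 = cech_class X ` lc_functions X"
  proof (intro Set.set_eqI iffI)
    fix A assume "A \<in> ?V // cech_rel X 0"
    then obtain U c where Uc: "(U, c) \<in> ?V" "A = cech_rel X 0 `` {(U, c)}"
      unfolding quotient_def by auto
    then show "A \<in> cech_class X ` lc_functions X"
      using 1[OF Uc(1)] cech_value_lc[of U X c] by auto
  next
    fix A assume "A \<in> cech_class X ` lc_functions X"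
    then obtain f where f: "f \<in> lc_functions X" "A = cech_class X f" by blast
    then obtain U c where "(U, c) \<in> cech_class X f" using cech_class_nonempty by fastforce
    then have "(U, c) \<in> ?V" "cech_value U c = f" by (auto simp: cech_class_def)
    with 1[OF this(1)] f show "A \<in> ?V // cech_rel X 0"
      unfolding quotient_def by auto
  qed
  then show ?thesis by (simp add: cech_cohomology_def)
qed

lemma lc_functions_add:
  assumes "f \<in> lc_functions X" "g \<in> lc_functions X"
  shows "(\<lambda>x. f x + g x) \<in> lc_functions X"
proof -
  have "{x \<in> topspace X. f x + g x = z} = (\<Union>y. {x \<in> topspace X. f x = y} \<inter> {x \<in> topspace X. g x = z - y})" for z
    by auto
  moreover have "openin X (\<Union>y. {x \<in> topspace X. f x = y} \<inter> {x \<in> topspace X. g x = z - y})" for z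
    using assms by (intro openin_Union) (auto simp: lc_functions_def)
  ultimately show ?thesis using assms by (simp add: lc_functions_def)
qed

lemma lc_functions_uminus: "f \<in> lc_functions X \<Longrightarrow> (\<lambda>x. - f x) \<in> lc_functions X"
proof -
  assume f: "f \<in> lc_functions X"
  have "{x \<in> topspace X. - f x = z} = {x \<in> topspace X. f x = - z}" for z by auto
  with f show ?thesis by (simp add: lc_functions_def)
qed

lemma lc_functions_zero: "(\<lambda>x. 0) \<in> lc_functions X"
proof -
  have "{x \<in> topspace X. 0 = z} = (if z = 0 then topspace X else {})" for z :: int by auto
  then show ?thesis by (auto simp: lc_functions_def)
qed

lemma cech_class_mult:
  assumes f: "f \<in> lc_functions X" and g: "g \<in> lc_functions X"
  shows "cech_class X f \<otimes>\<^bsub>cech_cohomology X 0\<^esub> cech_class X g = cech_class X (\<lambda>x. f x + g x)"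
proof -
  let ?S = "{(W, \<lambda>vs. c vs + d vs) | W c d. (W, c) \<in> cech_class X f \<and> (W, d) \<in> cech_class X g}"
  have "(W, \<lambda>vs. c vs + d vs) \<in> cech_class X (\<lambda>x. f x + g x)"
    if "(W, c) \<in> cech_class X f" "(W, d) \<in> cech_class X g" for W c d
  proof -
    from that have W: "W \<in> open_covers X" "c \<in> cocycles W 0" "d \<in> cocycles W 0"
      and v: "cech_value W c = f" "cech_value W d = g" by (auto simp: cech_class_def)
    have cd: "(\<lambda>vs. c vs + d vs) \<in> cocycles W 0"
    proof (rule cocycles_0I)
      fix V V' x assume V: "V \<in> W" "V' \<in> W" "x \<in> V" "x \<in> V'"
      show "c [V] + d [V] = c [V'] + d [V']"
        using cocycles_0D[OF W(2) V] cocycles_0D[OF W(3) V] by simp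
    next
      fix vs assume "vs \<notin> nerve_simplices W 0"
      then show "c vs + d vs = 0"
        using cocycles_0_outside[OF W(2)] cocycles_0_outside[OF W(3)] by simp
    qed
    have "cech_value W (\<lambda>vs. c vs + d vs) x = f x + g x" for x
      unfolding v[symmetric] by (simp add: cech_value_def)
    with W(1) cd show ?thesis by (auto simp: cech_class_def)
  qed
  then have "?S \<subseteq> cech_class X (\<lambda>x. f x + g x)" by blast
  moreover have "?S \<noteq> {}"
    using sampled_level_cochain[OF f g] by blast
  ultimately show ?thesis
    using cech_rel_Image[of ?S X] by (simp add: cech_cohomology_def)
qed

lemma cech_class_one: "\<one>\<^bsub>cech_cohomology X 0\<^esub> = cech_class X (\<lambda>x. 0)"
proof -
  have "(\<lambda>vs. 0) \<in> cocycles {topspace X} 0" by (rule cocycles_0I) simp_all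
  moreover have "cech_value {topspace X} (\<lambda>vs. 0) = (\<lambda>x. 0)" by (auto simp: cech_value_def)
  ultimately have "({topspace X}, \<lambda>vs. 0) \<in> cech_class X (\<lambda>x. 0)"
    by (auto simp: cech_class_def open_covers_def)
  then show ?thesis
    using cech_rel_Image[of "{({topspace X}, \<lambda>vs. 0)}" X "\<lambda>x. 0"] by (simp add: cech_cohomology_def)
qed

lemma cech_class_pullback:
  assumes f: "f \<in> lc_functions Y" and g: "g ` topspace X \<subseteq> topspace Y"
    and fg: "(\<lambda>x. if x \<in> topspace X then f (g x) else 0) \<in> lc_functions X"
  shows "cech_pullback X 0 g (cech_class Y f) = cech_class X (\<lambda>x. if x \<in> topspace X then f (g x) else 0)"
proof -
  let ?h = "\<lambda>x. if x \<in> topspace X then f (g x) else 0"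
  let ?S = "{(W, cochain_pullback \<phi> W 0 c) | W \<phi> U c.
        (U, c) \<in> cech_class Y f \<and> W \<in> open_covers X \<and> refines_via g \<phi> W U}"
  have "(W, cochain_pullback \<phi> W 0 c) \<in> cech_class X ?h"
    if Uc: "(U, c) \<in> cech_class Y f" and W: "W \<in> open_covers X" and ref: "refines_via g \<phi> W U" for W \<phi> U c
  proof -
    from Uc have U: "U \<in> open_covers Y" "c \<in> cocycles U 0" "cech_value U c = f"
      by (auto simp: cech_class_def)
    have val: "cochain_pullback \<phi> W 0 c [w] = f (g x)" if w: "w \<in> W" "x \<in> w" for w x
    proof -
      have "[w] \<in> nerve_simplices W 0" using w by (auto simp: nerve_simplices_0)
      moreover have "\<phi> w \<in> U" "g x \<in> \<phi> w"
        using ref w by (auto simp: refines_via_def)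
      ultimately show ?thesis
        using cech_value_eq[OF U(2)] U(3) by (simp add: cochain_pullback_def)
    qed
    have c: "cochain_pullback \<phi> W 0 c \<in> cocycles W 0"
    proof (rule cocycles_0I)
      fix V V' x assume "V \<in> W" "V' \<in> W" "x \<in> V" "x \<in> V'"
      then show "cochain_pullback \<phi> W 0 c [V] = cochain_pullback \<phi> W 0 c [V']" using val[of _ x] by simp
    qed (simp add: cochain_pullback_def)
    have "cech_value W (cochain_pullback \<phi> W 0 c) x = ?h x" for x
    proof (cases "x \<in> topspace X")
      case True
      then obtain w where "w \<in> W" "x \<in> w" using open_coversD(2)[OF W] by blast
      then show ?thesis using True cech_value_eq[OF c] val by simp
    next
      case False
      then show ?thesis using open_coversD(2)[OF W] by (auto simp: cech_value_def)
    qed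
    with c W show ?thesis by (auto simp: cech_class_def)
  qed
  then have "?S \<subseteq> cech_class X ?h" by blast
  moreover have "?S \<noteq> {}"
  proof -
    let ?U = "level_cover Y f f" and ?W = "level_cover X ?h ?h"
    \<comment> \<open>A level set of the pulled-back function goes to the level set of
      \<open>f\<close> with the same value. The empty member gets the value 0 by convention, and the
      doubled condition matches the shape of \<open>level_cover Y f f\<close>.\<close>
    define \<phi> where "\<phi> = (\<lambda>w. let z = (if w = {} then 0 else ?h (SOME x. x \<in> w)) in {y \<in> topspace Y. f y = z \<and> f y = z})"
    have "(?U, sampled_cochain f ?U) \<in> cech_class Y f"
      by (rule sampled_level_cochain[OF f f])
    moreover have "?W \<in> open_covers X"
      by (rule level_cover_open[OF fg fg])
    moreover have "refines_via g \<phi> ?W ?U"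
      unfolding refines_via_def
    proof (intro ballI conjI subsetI)
      fix w assume w: "w \<in> ?W"
      show "\<phi> w \<in> ?U" unfolding \<phi>_def level_cover_def Let_def by blast
      fix y assume "y \<in> g ` w"
      then obtain x where x: "x \<in> w" "y = g x" by blast
      have xX: "x \<in> topspace X" using w x(1) by (auto simp: level_cover_def)
      have "(SOME x. x \<in> w) \<in> w" by (rule someI[of _ x]) (rule x(1))
      from level_cover_const(1)[OF w this x(1)] have "?h (SOME x. x \<in> w) = f (g x)"
        using xX by simp
      moreover have "w \<noteq> {}" "g x \<in> topspace Y" using x xX g by auto
      ultimately show "y \<in> \<phi> w" unfolding \<phi>_def Let_def x(2) by simp
    qed
    ultimately show ?thesis by blast
  qed
  ultimately show ?thesis
    using cech_rel_Image[of ?S X ?h] by (simp add: cech_pullback_def)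
qed

lemma group_cech_0: "group (cech_cohomology X 0)"
proof (rule groupI)
  fix A B C
  assume "A \<in> carrier (cech_cohomology X 0)" "B \<in> carrier (cech_cohomology X 0)" "C \<in> carrier (cech_cohomology X 0)"
  then obtain f g h where *: "f \<in> lc_functions X" "g \<in> lc_functions X" "h \<in> lc_functions X"
    "A = cech_class X f" "B = cech_class X g" "C = cech_class X h"
    unfolding carrier_cech_0 by blast
  then show "A \<otimes>\<^bsub>cech_cohomology X 0\<^esub> B \<otimes>\<^bsub>cech_cohomology X 0\<^esub> C =
      A \<otimes>\<^bsub>cech_cohomology X 0\<^esub> (B \<otimes>\<^bsub>cech_cohomology X 0\<^esub> C)"
    by (simp add: cech_class_mult lc_functions_add add.assoc)
next
  fix A B
  assume "A \<in> carrier (cech_cohomology X 0)" "B \<in> carrier (cech_cohomology X 0)"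
  then show "A \<otimes>\<^bsub>cech_cohomology X 0\<^esub> B \<in> carrier (cech_cohomology X 0)"
    unfolding carrier_cech_0 by (auto simp: cech_class_mult lc_functions_add)
next
  show "\<one>\<^bsub>cech_cohomology X 0\<^esub> \<in> carrier (cech_cohomology X 0)"
    unfolding carrier_cech_0 cech_class_one by (simp add: lc_functions_zero)
next
  fix A assume "A \<in> carrier (cech_cohomology X 0)"
  then obtain f where f: "f \<in> lc_functions X" "A = cech_class X f"
    unfolding carrier_cech_0 by blast
  then show "\<one>\<^bsub>cech_cohomology X 0\<^esub> \<otimes>\<^bsub>cech_cohomology X 0\<^esub> A = A"
    by (simp add: cech_class_one cech_class_mult lc_functions_zero)
  show "\<exists>B\<in>carrier (cech_cohomology X 0). B \<otimes>\<^bsub>cech_cohomology X 0\<^esub> A = \<one>\<^bsub>cech_cohomology X 0\<^esub>"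
    unfolding carrier_cech_0 cech_class_one using f
    by (intro bexI[of _ "cech_class X (\<lambda>x. - f x)"]) (simp_all add: cech_class_mult lc_functions_uminus)
qed

section \<open>Invariant functions and bounded depth\<close>

abbreviation sphere :: "nat \<Rightarrow> nat \<Rightarrow> word set" where
  "sphere n k \<equiv> {w \<in> rwords n. length w = k}"

lemma finite_sphere: "finite (sphere n k)"
proof (rule finite_subset)
  show "sphere n k \<subseteq> {w. set w \<subseteq> {..<n} \<times> UNIV \<and> length w = k}"
    by (auto simp: words_def)
  show "finite {w :: word. set w \<subseteq> {..<n} \<times> UNIV \<and> length w = k}"
    by (rule finite_lists_length_eq) simp
qed

lemma pref_sphere: "p \<in> boundary n \<Longrightarrow> pref p k \<in> sphere n k"
  by simp

lemma sphere_pref: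
  assumes "u \<in> sphere n k" "k > 0"
  obtains p where "p \<in> boundary n" "pref p k = u"
  using assms boundary_point_extending[of u n] by auto

text \<open>This is the abstract form of a line pattern: a symmetric relation on the boundary that
  the group preserves. The words reappear when the crossing end points have to be counted.\<close>

locale pattern =
  fixes n :: nat and \<Lambda> :: "(bpoint \<times> bpoint) set"
  assumes pattern_boundary: "(p, q) \<in> \<Lambda> \<Longrightarrow> p \<in> boundary n" "(p, q) \<in> \<Lambda> \<Longrightarrow> q \<in> boundary n"
    and pattern_sym: "(p, q) \<in> \<Lambda> \<Longrightarrow> (q, p) \<in> \<Lambda>"
    and pattern_act: "(p, q) \<in> \<Lambda> \<Longrightarrow> g \<in> rwords n \<Longrightarrow> (boundary_act n g p, boundary_act n g q) \<in> \<Lambda>"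
begin

definition invariant :: "(bpoint \<Rightarrow> 'a) \<Rightarrow> bool" where
  "invariant f \<longleftrightarrow> (\<forall>p q. (p, q) \<in> \<Lambda> \<longrightarrow> f p = f q)"

lemma invariantD: "invariant f \<Longrightarrow> (p, q) \<in> \<Lambda> \<Longrightarrow> f p = f q"
  unfolding invariant_def by blast

text \<open>An invariant set decomposes into its parts in the shadows of the words of a fixed length, and by
  translation each part becomes a set in the shadow of a letter. Parts in different shadows interact
  only through their traces on the end points in \<open>crossing\<close>.\<close>

definition local_sets :: "nat \<Rightarrow> letter \<Rightarrow> bpoint set set" where
  "local_sets r a = {A. A \<subseteq> {p \<in> boundary n. pref p 1 = [a]} \<and> depth n (Suc r) (\<lambda>p. p \<in> A) \<and>
     (\<forall>p q. (p, q) \<in> \<Lambda> \<longrightarrow> pref p 1 = [a] \<longrightarrow> pref q 1 = [a] \<longrightarrow> (p \<in> A \<longleftrightarrow> q \<in> A))}"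

definition crossing :: "letter \<Rightarrow> bpoint set" where
  "crossing a = {p \<in> boundary n. pref p 1 = [a] \<and> (\<exists>q. (p, q) \<in> \<Lambda> \<and> pref q 1 \<noteq> [a])}"

definition traces :: "nat \<Rightarrow> letter \<Rightarrow> bpoint set set" where
  "traces r a = (\<lambda>A. A \<inter> crossing a) ` local_sets r a"

text \<open>The part of \<open>A\<close> in the shadow of \<open>x\<close>, translated to the
  identity up to the last letter. That letter is kept because it decides which letters may follow,
  so parts are compared within the shadow of one letter.\<close>

definition shadow_part :: "bpoint set \<Rightarrow> word \<Rightarrow> bpoint set" where
  "shadow_part A x = {p \<in> boundary n. pref p 1 = [last x] \<and> boundary_act n (butlast x) p \<in> A}"

lemma depthD: "depth n N f \<Longrightarrow> p \<in> boundary n \<Longrightarrow> q \<in> boundary n \<Longrightarrow> pref p N = pref q N \<Longrightarrow> f p = f q"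
  unfolding depth_def by blast

lemma depthI: "(\<And>p q. p \<in> boundary n \<Longrightarrow> q \<in> boundary n \<Longrightarrow> pref p N = pref q N \<Longrightarrow> f p = f q) \<Longrightarrow> depth n N f"
  unfolding depth_def by blast

lemma depth_comp: "depth n N f \<Longrightarrow> depth n N (\<lambda>p. g (f p))"
  by (intro depthI arg_cong[of _ _ g]) (rule depthD)

lemma invariant_comp: "invariant f \<Longrightarrow> invariant (\<lambda>p. g (f p))"
  unfolding invariant_def by (intro allI impI arg_cong[of _ _ g]) blast

lemma local_setsD:
  assumes "A \<in> local_sets r a"
  shows "p \<in> A \<Longrightarrow> p \<in> boundary n" "p \<in> A \<Longrightarrow> pref p 1 = [a]" "depth n (Suc r) (\<lambda>p. p \<in> A)"
    "(p, q) \<in> \<Lambda> \<Longrightarrow> pref p 1 = [a] \<Longrightarrow> pref q 1 = [a] \<Longrightarrow> p \<in> A \<longleftrightarrow> q \<in> A"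
  using assms unfolding local_sets_def by blast+

lemma traces_mono: "traces r a \<subseteq> traces (Suc r) a"
proof -
  have "local_sets r a \<subseteq> local_sets (Suc r) a"
    unfolding local_sets_def using depth_mono[of n "Suc r" _ "Suc (Suc r)"] by auto
  then show ?thesis unfolding traces_def by (rule image_mono)
qed

lemma sphere_split:
  assumes "x \<in> sphere n m" "m > 0"
  shows "x = butlast x @ [last x]" "butlast x \<in> rwords n" "length (butlast x) = m - 1" "fst (last x) < n"
proof -
  have "x \<noteq> []" using assms by auto
  then show x: "x = butlast x @ [last x]" by simp
  then have "butlast x @ [last x] \<in> rwords n" using assms by auto
  then show "butlast x \<in> rwords n" "fst (last x) < n" by (auto simp: reduced_append)
  show "length (butlast x) = m - 1" using assms by simp
qed

text \<open>Translation by \<open>butlast x\<close> carries the shadow of the letter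
  \<open>last x\<close> onto that of \<open>x\<close> and adds \<open>m - 1\<close> letters to each
  prefix.\<close>

lemma pref_act_butlast:
  assumes x: "x \<in> sphere n m" "m > 0" and p: "p \<in> boundary n" "pref p 1 = [last x]"
  shows "pref (boundary_act n (butlast x) p) (m + r) = butlast x @ pref p (Suc r)"
proof -
  note s = sphere_split[OF x]
  have tk: "pref p (Suc r) = [last x] @ drop 1 (pref p (Suc r))"
    using take_pref[OF p(1), of 1 "Suc r"] p(2) append_take_drop_id[of 1 "pref p (Suc r)"] by simp
  have "reduced (butlast x @ [last x] @ drop 1 (pref p (Suc r)))"
    using s(1) x(1) tk pref_reduced[OF p(1), of "Suc r"] by (intro reduced_append_nonempty) auto
  then have "reduced (butlast x @ pref p (Suc r))" using tk by simp
  from pref_act[OF p(1) _ this] s show ?thesis using x(2) by simp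
qed

lemma pref_act_winv_butlast:
  assumes "x \<in> sphere n m" "m > 0" "p \<in> boundary n" "pref p m = x"
  shows "pref (boundary_act n (winv (butlast x)) p) (Suc r) = drop (m - 1) (pref p (m + r))"
    "pref (boundary_act n (winv (butlast x)) p) 1 = [last x]"
proof -
  note s = sphere_split[OF assms(1,2)]
  have *: "pref p (length (butlast x) + Suc r) = butlast x @ drop (m - 1) (pref p (m + r))" for r
  proof -
    have "take (m - 1) (pref p (m + r)) = butlast x"
    proof -
      have "take (m - 1) (pref p (m + r)) = take (m - 1) (take m (pref p (m + r)))"
        by simp
      also have "\<dots> = take (m - 1) x"
        using take_pref[OF assms(3), of m "m + r"] assms(4) by simp
      also have "\<dots> = butlast x"
        using assms(1) by (simp add: butlast_conv_take)
      finally show ?thesis .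
    qed
    then show ?thesis
      using append_take_drop_id[of "m - 1" "pref p (m + r)"] s(3) assms(2) by simp
  qed
  from pref_act_winv[OF assms(3) *[of r]]
  show "pref (boundary_act n (winv (butlast x)) p) (Suc r) = drop (m - 1) (pref p (m + r))" .
  from pref_act_winv[OF assms(3) *[of 0]]
  have "pref (boundary_act n (winv (butlast x)) p) 1 = drop (m - 1) (pref p m)" by simp
  also have "\<dots> = drop (m - 1) (butlast x @ [last x])" using s(1) assms(4) by simp
  also have "\<dots> = [last x]" using s(3) by simp
  finally show "pref (boundary_act n (winv (butlast x)) p) 1 = [last x]" .
qed

text \<open>Each part of the set is replaced by one of smaller depth with the same trace, so the values at
  the ends of lines that connect different shadows do not change.\<close>

lemma gluing:
  assumes m: "m > 0"
    and A: "\<And>x. x \<in> sphere n m \<Longrightarrow> shadow_part A x \<in> local_sets (Suc r) (last x)"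
    and T: "\<And>a. fst a < n \<Longrightarrow> traces (Suc r) a \<subseteq> traces r a"
  shows "\<exists>A'. A' \<subseteq> boundary n \<and> depth n (m + r) (\<lambda>p. p \<in> A') \<and>
    (\<forall>p q. (p, q) \<in> \<Lambda> \<longrightarrow> pref p m \<noteq> pref q m \<longrightarrow> (p \<in> A' \<longleftrightarrow> p \<in> A)) \<and>
    (\<forall>p q. (p, q) \<in> \<Lambda> \<longrightarrow> pref p m = pref q m \<longrightarrow> (p \<in> A' \<longleftrightarrow> q \<in> A'))"
proof -
  have "\<forall>x\<in>sphere n m. \<exists>B. B \<in> local_sets r (last x) \<and> B \<inter> crossing (last x) = shadow_part A x \<inter> crossing (last x)"
  proof
    fix x assume x: "x \<in> sphere n m"
    have "shadow_part A x \<inter> crossing (last x) \<in> traces (Suc r) (last x)"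
      unfolding traces_def using A[OF x] by blast
    then have "shadow_part A x \<inter> crossing (last x) \<in> traces r (last x)"
      using T[OF sphere_split(4)[OF x m]] by blast
    then show "\<exists>B. B \<in> local_sets r (last x) \<and> B \<inter> crossing (last x) = shadow_part A x \<inter> crossing (last x)"
      unfolding traces_def by blast
  qed
  from bchoice[OF this] obtain C where
    C: "\<And>x. x \<in> sphere n m \<Longrightarrow> C x \<in> local_sets r (last x)"
      "\<And>x. x \<in> sphere n m \<Longrightarrow> C x \<inter> crossing (last x) = shadow_part A x \<inter> crossing (last x)" by blast
  \<comment> \<open>The replacement \<open>C x\<close> lives in the shadow of the last letter of
    \<open>x\<close>, so membership in \<open>A'\<close> is decided after moving the point
    there.\<close>
  define pull where "pull = (\<lambda>x q. boundary_act n (winv (butlast x)) q)"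
  define A' where "A' = {q \<in> boundary n. pull (pref q m) q \<in> C (pref q m)}"
  have yw: "butlast x \<in> rwords n" "winv (butlast x) \<in> rwords n" if "x \<in> sphere n m" for x
    using sphere_split(2)[OF that m] by simp_all
  have pull: "pull x q \<in> boundary n" "pref (pull x q) 1 = [last x]" "boundary_act n (butlast x) (pull x q) = q"
    if "q \<in> boundary n" "pref q m = x" for x q
  proof -
    have x: "x \<in> sphere n m" using pref_sphere[OF that(1), of m] that(2) by simp
    show "pull x q \<in> boundary n" unfolding pull_def by (rule boundary_act_closed[OF yw(2)[OF x] that(1)])
    show "pref (pull x q) 1 = [last x]" unfolding pull_def by (rule pref_act_winv_butlast(2)[OF x m that])
    show "boundary_act n (butlast x) (pull x q) = q"
      unfolding pull_def by (rule boundary_act_winv(1)[OF yw(1)[OF x] that(1)])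
  qed
  show ?thesis
  proof (rule exI[of _ A'], intro conjI allI impI)
    show "A' \<subseteq> boundary n" by (auto simp: A'_def)
    show "depth n (m + r) (\<lambda>p. p \<in> A')"
    proof (rule depthI)
      fix p q assume pq: "p \<in> boundary n" "q \<in> boundary n" "pref p (m + r) = pref q (m + r)"
      then have eq: "pref p m = pref q m" using pref_mono[OF pq(3,1,2), of m] by simp
      let ?x = "pref q m"
      have x: "?x \<in> sphere n m" by (rule pref_sphere[OF pq(2)])
      have "pref (pull ?x p) (Suc r) = pref (pull ?x q) (Suc r)"
        unfolding pull_def using pref_act_winv_butlast(1)[OF x m pq(1) eq, of r]
          pref_act_winv_butlast(1)[OF x m pq(2) refl, of r] pq(3) by simp
      from depthD[OF local_setsD(3)[OF C(1)[OF x]] pull(1)[OF pq(1) eq] pull(1)[OF pq(2) refl] this]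
      show "(p \<in> A') = (q \<in> A')"
        using pq eq by (simp add: A'_def)
    qed
  next
    fix p q assume pq: "(p, q) \<in> \<Lambda>" "pref p m \<noteq> pref q m"
    note b = pattern_boundary[OF pq(1)]
    let ?x = "pref p m"
    have x: "?x \<in> sphere n m" by (rule pref_sphere[OF b(1)])
    have l: "(pull ?x p, pull ?x q) \<in> \<Lambda>"
      unfolding pull_def by (rule pattern_act[OF pq(1) yw(2)[OF x]])
    have qb: "pull ?x q \<in> boundary n" by (rule pattern_boundary(2)[OF l])
    \<comment> \<open>The translated line still leaves the shadow of the letter; otherwise moving it
      back would put \<open>q\<close> into the shadow of \<open>?x\<close>. So its end is a crossing
      point, where \<open>C ?x\<close> and the part of \<open>A\<close> agree.\<close>
    have "pref (pull ?x q) 1 \<noteq> [last ?x]"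
    proof
      assume q1: "pref (pull ?x q) 1 = [last ?x]"
      have "pref (boundary_act n (butlast ?x) (pull ?x q)) m = butlast ?x @ [last ?x]"
        using pref_act_butlast[OF x m qb q1, of 0] q1 by simp
      moreover have "boundary_act n (butlast ?x) (pull ?x q) = q"
        unfolding pull_def by (rule boundary_act_winv(1)[OF yw(1)[OF x] b(2)])
      ultimately show False using pq(2) sphere_split(1)[OF x m] by simp
    qed
    then have "pull ?x p \<in> crossing (last ?x)"
      unfolding crossing_def using pull(1,2)[OF b(1) refl] l by blast
    then have "pull ?x p \<in> C ?x \<longleftrightarrow> pull ?x p \<in> shadow_part A ?x"
      using C(2)[OF x] by blast
    also have "\<dots> \<longleftrightarrow> p \<in> A"
      using pull[OF b(1) refl] by (simp add: shadow_part_def)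
    finally show "p \<in> A' \<longleftrightarrow> p \<in> A"
      using b(1) by (simp add: A'_def)
  next
    fix p q assume pq: "(p, q) \<in> \<Lambda>" "pref p m = pref q m"
    note b = pattern_boundary[OF pq(1)]
    let ?x = "pref q m"
    have x: "?x \<in> sphere n m" by (rule pref_sphere[OF b(2)])
    have l: "(pull ?x p, pull ?x q) \<in> \<Lambda>"
      unfolding pull_def by (rule pattern_act[OF pq(1) yw(2)[OF x]])
    from local_setsD(4)[OF C(1)[OF x] l pull(2)[OF b(1) pq(2)] pull(2)[OF b(2) refl]]
    show "p \<in> A' \<longleftrightarrow> q \<in> A'"
      using b pq(2) by (simp add: A'_def)
  qed
qed

text \<open>Lines inside the shadow of the letter are translates of lines inside the shadow of
  \<open>x\<close>, so invariance is needed only for the latter. Of the depth \<open>m + r\<close>,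
  the \<open>m - 1\<close> letters of \<open>butlast x\<close> are lost, which leaves
  \<open>Suc r\<close>.\<close>

lemma shadow_part_local:
  assumes x: "x \<in> sphere n m" "m > 0" and d: "depth n (m + r) (\<lambda>p. p \<in> A)"
    and inv: "\<And>p q. (p, q) \<in> \<Lambda> \<Longrightarrow> pref p m = x \<Longrightarrow> pref q m = x \<Longrightarrow> p \<in> A \<longleftrightarrow> q \<in> A"
  shows "shadow_part A x \<in> local_sets r (last x)"
proof -
  note s = sphere_split[OF x]
  have ab: "boundary_act n (butlast x) p \<in> boundary n" if "p \<in> boundary n" for p
    by (rule boundary_act_closed[OF s(2) that])
  have pm: "pref (boundary_act n (butlast x) p) m = x" if "p \<in> boundary n" "pref p 1 = [last x]" for p
    using pref_act_butlast[OF x that, of 0] that s(1) by simp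
  have 1: "shadow_part A x \<subseteq> {p \<in> boundary n. pref p 1 = [last x]}"
    unfolding shadow_part_def by blast
  have 2: "depth n (Suc r) (\<lambda>p. p \<in> shadow_part A x)"
  proof (rule depthI)
    fix p q assume pq: "p \<in> boundary n" "q \<in> boundary n" "pref p (Suc r) = pref q (Suc r)"
    have eq: "pref p 1 = pref q 1" using pref_mono[OF pq(3,1,2), of 1] by simp
    show "(p \<in> shadow_part A x) = (q \<in> shadow_part A x)"
    proof (cases "pref q 1 = [last x]")
      case True
      with eq have p1: "pref p 1 = [last x]" by simp
      have "pref (boundary_act n (butlast x) p) (m + r) = pref (boundary_act n (butlast x) q) (m + r)"
        using pref_act_butlast[OF x pq(1) p1, of r] pref_act_butlast[OF x pq(2) True, of r] pq(3) by simp
      from depthD[OF d ab[OF pq(1)] ab[OF pq(2)] this] show ?thesis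
        using pq p1 True by (simp add: shadow_part_def)
    next
      case False
      with eq show ?thesis by (simp add: shadow_part_def)
    qed
  qed
  have 3: "p \<in> shadow_part A x \<longleftrightarrow> q \<in> shadow_part A x"
    if l: "(p, q) \<in> \<Lambda>" and p1: "pref p 1 = [last x]" and q1: "pref q 1 = [last x]" for p q
  proof -
    note b = pattern_boundary[OF l]
    from inv[OF pattern_act[OF l s(2)] pm[OF b(1) p1] pm[OF b(2) q1]] show ?thesis
      using b p1 q1 by (simp add: shadow_part_def)
  qed
  from 1 2 3 show ?thesis unfolding local_sets_def by blast
qed

text \<open>A local set is cut along the shadows of words of length 2. Its parts have one letter of
  depth less, so the hypothesis replaces them by shallower ones, and gluing gives a shallower set.
  The trace survives because a line leaving the shadow of \<open>a\<close> also leaves the smaller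
  shadow.\<close>

lemma traces_stable_step:
  assumes T: "\<And>a. fst a < n \<Longrightarrow> traces (Suc r) a \<subseteq> traces r a" and a: "fst a < n"
  shows "traces (Suc (Suc r)) a \<subseteq> traces (Suc r) a"
proof
  fix X assume "X \<in> traces (Suc (Suc r)) a"
  then obtain A where A: "A \<in> local_sets (Suc (Suc r)) a" and X: "X = A \<inter> crossing a"
    unfolding traces_def by blast
  have d: "depth n (2 + Suc r) (\<lambda>p. p \<in> A)" using local_setsD(3)[OF A] by simp
  have pref1: "pref p 1 = take 1 (pref p 2)" if "p \<in> boundary n" for p
    using take_pref[OF that, of 1 2] by simp
  have loc: "shadow_part A x \<in> local_sets (Suc r) (last x)" if x: "x \<in> sphere n 2" for x
  proof (rule shadow_part_local[OF x _ d])
    fix p q assume l: "(p, q) \<in> \<Lambda>" and p2: "pref p 2 = x" and q2: "pref q 2 = x"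
    note b = pattern_boundary[OF l]
    have eq: "pref p 1 = pref q 1" using pref1[OF b(1)] pref1[OF b(2)] p2 q2 by simp
    show "p \<in> A \<longleftrightarrow> q \<in> A"
    proof (cases "pref q 1 = [a]")
      case True
      with eq show ?thesis using local_setsD(4)[OF A l] by simp
    next
      case False
      with eq show ?thesis using local_setsD(2)[OF A] by metis
    qed
  qed simp
  from gluing[where m = 2, OF zero_less_numeral loc T] obtain B where B: "B \<subseteq> boundary n" "depth n (2 + r) (\<lambda>p. p \<in> B)"
    "\<And>p q. (p, q) \<in> \<Lambda> \<Longrightarrow> pref p 2 \<noteq> pref q 2 \<Longrightarrow> p \<in> B \<longleftrightarrow> p \<in> A"
    "\<And>p q. (p, q) \<in> \<Lambda> \<Longrightarrow> pref p 2 = pref q 2 \<Longrightarrow> p \<in> B \<longleftrightarrow> q \<in> B"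
    by auto
  \<comment> \<open>Outside the shadow of \<open>a\<close> the replacements have empty trace but
    need not be empty, so the glued set is cut down to that shadow.\<close>
  define B' where "B' = B \<inter> {p \<in> boundary n. pref p 1 = [a]}"
  have "depth n (Suc (Suc r)) (\<lambda>p. p \<in> B')"
  proof (rule depthI)
    fix p q assume pq: "p \<in> boundary n" "q \<in> boundary n" "pref p (Suc (Suc r)) = pref q (Suc (Suc r))"
    have "pref p 1 = pref q 1" using pref_mono[OF pq(3,1,2), of 1] by simp
    moreover have "(p \<in> B) = (q \<in> B)" using depthD[OF B(2) pq(1,2)] pq(3) by simp
    ultimately show "(p \<in> B') = (q \<in> B')" using pq by (simp add: B'_def)
  qed
  moreover have "p \<in> B' \<longleftrightarrow> q \<in> B'" if l: "(p, q) \<in> \<Lambda>" and p1: "pref p 1 = [a]" and q1: "pref q 1 = [a]" for p q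
  proof -
    note b = pattern_boundary[OF l]
    have "p \<in> B \<longleftrightarrow> q \<in> B"
    proof (cases "pref p 2 = pref q 2")
      case True
      then show ?thesis by (rule B(4)[OF l])
    next
      case False
      then show ?thesis
        using B(3)[OF l False] B(3)[OF pattern_sym[OF l]] local_setsD(4)[OF A l p1 q1] by simp
    qed
    then show ?thesis using b p1 q1 by (simp add: B'_def)
  qed
  moreover have "B' \<subseteq> {p \<in> boundary n. pref p 1 = [a]}" unfolding B'_def by blast
  ultimately have "B' \<in> local_sets (Suc r) a" unfolding local_sets_def by blast
  moreover have "B' \<inter> crossing a = A \<inter> crossing a"
  proof -
    have "p \<in> B' \<longleftrightarrow> p \<in> A" if p: "p \<in> crossing a" for p
    proof -
      obtain q where q: "(p, q) \<in> \<Lambda>" "pref q 1 \<noteq> [a]" and p1: "p \<in> boundary n" "pref p 1 = [a]"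
        using p unfolding crossing_def by blast
      have "pref p 2 \<noteq> pref q 2"
        using pref1[OF p1(1)] pref1[OF pattern_boundary(2)[OF q(1)]] q(2) p1(2) by metis
      from B(3)[OF q(1) this] show ?thesis using p1 by (simp add: B'_def)
    qed
    then show ?thesis by blast
  qed
  ultimately show "X \<in> traces (Suc r) a"
    unfolding traces_def X by blast
qed

text \<open>One step of stability carries over only if it holds for every letter at once, so the
  pairs of a letter and a trace are collected in one increasing chain. There are
  \<open>2 * n\<close> letters and at most \<open>2 ^ card E\<close> traces, and a chain that stays
  constant after its first repetition is stationary after as many steps as there are pairs.\<close>

lemma traces_stable:
  assumes fin: "finite E" and cross: "\<And>a. fst a < n \<Longrightarrow> crossing a \<subseteq> E"
    and R: "2 * n * 2 ^ card E \<le> R"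
    and a: "fst a < n"
  shows "traces (Suc R) a \<subseteq> traces R a"
proof -
  define L where "L = ({..<n} \<times> UNIV :: letter set)"
  define S where "S = (\<lambda>r. {(a, X). a \<in> L \<and> X \<in> traces r a})"
  have L: "a \<in> L \<longleftrightarrow> fst a < n" for a by (cases a) (simp add: L_def)
  have sub: "S r \<subseteq> L \<times> Pow E" for r
    unfolding S_def traces_def using cross L by blast
  have finS: "finite (L \<times> Pow E)" unfolding L_def using fin by simp
  have mono: "mono S"
    unfolding mono_iff_le_Suc S_def using traces_mono by blast
  have "finite (range S)"
    by (rule finite_subset[of _ "Pow (L \<times> Pow E)"]) (use sub finS in auto)
  moreover have "\<forall>r. S r = S (Suc r) \<longrightarrow> S (Suc r) = S (Suc (Suc r))"
  proof (intro allI impI)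
    fix r assume eq: "S r = S (Suc r)"
    have "traces (Suc r) a \<subseteq> traces r a" if "fst a < n" for a
    proof
      fix X assume "X \<in> traces (Suc r) a"
      with that have "(a, X) \<in> S (Suc r)" by (simp add: S_def L)
      with eq have "(a, X) \<in> S r" by simp
      then show "X \<in> traces r a" by (simp add: S_def)
    qed
    then have "traces (Suc (Suc r)) a \<subseteq> traces (Suc r) a" if "fst a < n" for a
      using that by (rule traces_stable_step)
    then have "S (Suc (Suc r)) \<subseteq> S (Suc r)"
      unfolding S_def using L by blast
    moreover have "S (Suc r) \<subseteq> S (Suc (Suc r))"
      using mono unfolding mono_iff_le_Suc by blast
    ultimately show "S (Suc r) = S (Suc (Suc r))" by blast
  qed
  ultimately have "\<exists>N. (\<forall>n\<le>N. \<forall>m\<le>N. m < n \<longrightarrow> S m \<subset> S n) \<and> (\<forall>n\<ge>N. S N = S n)"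
    using mono by (intro finite_mono_remains_stable_implies_strict_prefix) auto
  from finite_mono_strict_prefix_implies_finite_fixpoint[OF sub finS this]
  have "S (card (L \<times> Pow E)) = (\<Union>r. S r)" .
  moreover have "card (L \<times> Pow E) = 2 * n * 2 ^ card E"
    using fin by (simp add: L_def card_cartesian_product card_Pow)
  ultimately have "S (2 * n * 2 ^ card E) = (\<Union>r. S r)" by simp
  moreover have "S (2 * n * 2 ^ card E) \<subseteq> S R"
    using mono R by (rule monoD)
  ultimately have "S (Suc R) \<subseteq> S R" by blast
  show ?thesis
  proof
    fix X assume "X \<in> traces (Suc R) a"
    with a have "(a, X) \<in> S (Suc R)" by (simp add: S_def L)
    with \<open>S (Suc R) \<subseteq> S R\<close> have "(a, X) \<in> S R" by blast
    then show "X \<in> traces R a" by (simp add: S_def)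
  qed
qed

section \<open>Generation by invariant functions of bounded depth\<close>

lemma depth_finite_range:
  assumes "depth n N f"
  shows "finite (f ` boundary n)"
proof -
  have "f ` boundary n \<subseteq> (\<lambda>u. f (SOME p. p \<in> boundary n \<and> pref p N = u)) ` sphere n N"
  proof
    fix z assume "z \<in> f ` boundary n"
    then obtain p where p: "p \<in> boundary n" "z = f p" by blast
    let ?q = "SOME q. q \<in> boundary n \<and> pref q N = pref p N"
    have "?q \<in> boundary n \<and> pref ?q N = pref p N"
      by (rule someI[of _ p]) (use p in simp)
    then have "f ?q = f p" using depthD[OF assms _ p(1)] by blast
    then show "z \<in> (\<lambda>u. f (SOME p. p \<in> boundary n \<and> pref p N = u)) ` sphere n N"
      using pref_sphere[OF p(1), of N] p(2) by (intro image_eqI[of _ _ "pref p N"]) auto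
  qed
  then show ?thesis by (rule finite_subset) (intro finite_imageI finite_sphere)
qed

text \<open>\<open>H\<close> stands for membership in the submodule generated by the functions of
  depth \<open>Suc R\<close>, given only by its closure properties. The induction removes one letter
  of excess depth: the shallower set \<open>B\<close> is covered by the induction hypothesis, and
  the difference of \<open>A\<close> and \<open>B\<close> splits into translates of functions of
  depth \<open>Suc R\<close>.\<close>

lemma indicator_generation:
  fixes H :: "(bpoint \<Rightarrow> int) \<Rightarrow> bool"
  assumes ext: "\<And>f g. (\<And>p. p \<in> boundary n \<Longrightarrow> f p = g p) \<Longrightarrow> H f \<Longrightarrow> H g"
    and zero: "H (\<lambda>p. 0)" and add: "\<And>f g. H f \<Longrightarrow> H g \<Longrightarrow> H (\<lambda>p. f p + g p)"
    and act: "\<And>f h. h \<in> rwords n \<Longrightarrow> H f \<Longrightarrow> H (\<lambda>p. f (boundary_act n h p))"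
    and base: "\<And>f. depth n (Suc R) f \<Longrightarrow> invariant f \<Longrightarrow> H f"
    and T: "\<And>a. fst a < n \<Longrightarrow> traces (Suc R) a \<subseteq> traces R a"
    and A: "depth n (Suc R + k) (\<lambda>p. p \<in> A)" "invariant (\<lambda>p. p \<in> A)"
  shows "H (\<lambda>p. c * of_bool (p \<in> A))"
  using A
proof (induction k arbitrary: A)
  case 0
  have "depth n (Suc R) (\<lambda>p. c * of_bool (p \<in> A))"
    using depth_comp[OF 0(1), of "\<lambda>z. c * of_bool z"] by simp
  moreover have "invariant (\<lambda>p. c * of_bool (p \<in> A))"
    by (rule invariant_comp[OF 0(2)])
  ultimately show ?case by (rule base)
next
  case (Suc k)
  let ?m = "Suc k"
  have m: "?m > 0" by simp
  have dA: "depth n (?m + Suc R) (\<lambda>p. p \<in> A)"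
    using Suc.prems(1) by (simp add: add.commute)
  have loc: "shadow_part A x \<in> local_sets (Suc R) (last x)" if x: "x \<in> sphere n ?m" for x
    by (rule shadow_part_local[OF x m dA]) (use invariantD[OF Suc.prems(2)] in blast)
  from gluing[OF m loc T] obtain B where B: "B \<subseteq> boundary n" "depth n (?m + R) (\<lambda>p. p \<in> B)"
    "\<And>p q. (p, q) \<in> \<Lambda> \<Longrightarrow> pref p ?m \<noteq> pref q ?m \<Longrightarrow> p \<in> B \<longleftrightarrow> p \<in> A"
    "\<And>p q. (p, q) \<in> \<Lambda> \<Longrightarrow> pref p ?m = pref q ?m \<Longrightarrow> p \<in> B \<longleftrightarrow> q \<in> B"
    by blast
  have B_inv: "p \<in> B \<longleftrightarrow> q \<in> B" if l: "(p, q) \<in> \<Lambda>" for p q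
  proof (cases "pref p ?m = pref q ?m")
    case True
    then show ?thesis by (rule B(4)[OF l])
  next
    case False
    then show ?thesis
      using B(3)[OF l False] B(3)[OF pattern_sym[OF l]] invariantD[OF Suc.prems(2) l] by simp
  qed
  have dB: "depth n (Suc R + k) (\<lambda>p. p \<in> B)"
    using B(2) by (simp add: add.commute)
  have HB: "H (\<lambda>p. c * of_bool (p \<in> B))"
    by (rule Suc.IH[OF dB]) (unfold invariant_def, intro allI impI B_inv)
  \<comment> \<open>The restriction of the difference to the shadow of \<open>x\<close>. Restricting
    \<open>A\<close> alone would not be invariant.\<close>
  define F where "F = (\<lambda>x p. if pref p ?m = x then c * of_bool (p \<in> A) - c * of_bool (p \<in> B) else 0)"
  have HF: "H (F x)" if x: "x \<in> sphere n ?m" for x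
  proof -
    have xr: "x \<in> rwords n" and wx: "winv x \<in> rwords n" and xne: "x \<noteq> []" and lx: "length x = ?m"
      using x by auto
    let ?G = "\<lambda>p. F x (boundary_act n x p)"
    have ab: "boundary_act n x p \<in> boundary n" if "p \<in> boundary n" for p
      by (rule boundary_act_closed[OF xr that])
    \<comment> \<open>If the ends lie in different shadows, \<open>A\<close> and \<open>B\<close>
      agree there and both values are 0. Otherwise both ends lie in the same shadow, and
      \<open>A\<close> and \<open>B\<close> are invariant.\<close>
    have F_inv: "F x p = F x q" if l: "(p, q) \<in> \<Lambda>" for p q
    proof -
      have AB: "(p \<in> A \<longleftrightarrow> q \<in> A)" "(p \<in> B \<longleftrightarrow> q \<in> B)"
        using invariantD[OF Suc.prems(2) l] B_inv[OF l] by simp_all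
      show ?thesis
      proof (cases "pref p ?m = pref q ?m")
        case True
        with AB show ?thesis by (simp add: F_def)
      next
        case False
        have "p \<in> B \<longleftrightarrow> p \<in> A" by (rule B(3)[OF l False])
        with AB show ?thesis by (simp add: F_def)
      qed
    qed
    have "invariant ?G"
      unfolding invariant_def using F_inv pattern_act[OF _ xr] by blast
    moreover have "depth n (Suc R) ?G"
    proof (rule depthI)
      fix p q assume pq: "p \<in> boundary n" "q \<in> boundary n" "pref p (Suc R) = pref q (Suc R)"
      have p1: "pref p 1 = pref q 1" using pref_mono[OF pq(3,1,2), of 1] by simp
      show "?G p = ?G q"
      proof (cases "pref q 1 = [flip (last x)]")
        case True
        \<comment> \<open>A point beginning with the inverse of the last letter of \<open>x\<close>
          is moved by \<open>x\<close> outside the shadow of \<open>x\<close>, where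
          \<open>F x\<close> vanishes.\<close>
        have "?G s = 0" if s: "s \<in> boundary n" "pref s 1 = [flip (last x)]" for s
        proof -
          have "pref (boundary_act n x s) ?m \<noteq> x"
          proof
            assume e: "pref (boundary_act n x s) ?m = x"
            have tk: "pref (boundary_act n x s) (length x + 1) = x @ drop ?m (pref (boundary_act n x s) (length x + 1))"
              using take_pref[OF ab[OF s(1)], of ?m "length x + 1"] e lx
                append_take_drop_id[of ?m "pref (boundary_act n x s) (length x + 1)"] by simp
            have "pref (boundary_act n (winv x) (boundary_act n x s)) 1 = drop ?m (pref (boundary_act n x s) (length x + 1))"
              by (rule pref_act_winv[OF ab[OF s(1)] tk])
            then have "drop ?m (pref (boundary_act n x s) (length x + 1)) = [flip (last x)]"
              using boundary_act_winv(2)[OF xr s(1)] s(2) by simp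
            then have "reduced (x @ [flip (last x)])"
              using tk pref_reduced[OF ab[OF s(1)], of "length x + 1"] by simp
            then show False using xne by (simp add: reduced_append)
          qed
          then show ?thesis by (simp add: F_def)
        qed
        from this[OF pq(1)] this[OF pq(2)] p1 True show ?thesis by simp
      next
        case False
        \<comment> \<open>Without cancellation, \<open>Suc R\<close> known letters become
          \<open>?m + Suc R\<close> known letters after translation by \<open>x\<close>, which is
          the depth of \<open>A\<close>.\<close>
        have pr: "pref (boundary_act n x s) (?m + Suc R) = x @ pref s (Suc R)"
          if s: "s \<in> boundary n" "pref s 1 \<noteq> [flip (last x)]" for s
        proof -
          have "pref s 1 = [hd (pref s (Suc R))]"
            using take_pref[OF s(1), of 1 "Suc R"] length_pref[OF s(1), of "Suc R"]
            by (cases "pref s (Suc R)") auto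
          with s(2) have "hd (pref s (Suc R)) \<noteq> flip (last x)" by simp
          then have "reduced (x @ pref s (Suc R))"
            using xr s(1) by (simp add: reduced_append)
          from pref_act[OF s(1) _ this] xr lx show ?thesis by simp
        qed
        have e: "pref (boundary_act n x p) (?m + Suc R) = pref (boundary_act n x q) (?m + Suc R)"
          using pr[OF pq(2) False] pr[OF pq(1)] p1 False pq(3) by simp
        note mono = pref_mono[OF e ab[OF pq(1)] ab[OF pq(2)]]
        have "pref (boundary_act n x p) ?m = pref (boundary_act n x q) ?m"
          by (rule mono) simp
        moreover have "boundary_act n x p \<in> A \<longleftrightarrow> boundary_act n x q \<in> A"
          by (rule depthD[OF dA ab[OF pq(1)] ab[OF pq(2)] e])
        moreover have "boundary_act n x p \<in> B \<longleftrightarrow> boundary_act n x q \<in> B"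
          by (rule depthD[OF B(2) ab[OF pq(1)] ab[OF pq(2)]]) (rule mono, simp)
        ultimately show ?thesis by (simp add: F_def)
      qed
    qed
    ultimately have "H ?G" by (intro base)
    from act[OF wx this] have "H (\<lambda>p. F x (boundary_act n x (boundary_act n (winv x) p)))" .
    then show ?thesis
      by (rule ext[rotated]) (simp add: boundary_act_winv(1)[OF xr])
  qed
  have "H (\<lambda>p. \<Sum>x\<in>S. F x p)" if "finite S" "S \<subseteq> sphere n ?m" for S
    using that
  proof (induction S rule: finite_induct)
    case empty
    then show ?case using zero by simp
  next
    case (insert x S)
    then show ?case using add[OF HF[of x], of "\<lambda>p. \<Sum>x\<in>S. F x p"] by simp
  qed
  from add[OF HB this[OF finite_sphere order_refl]]
  have "H (\<lambda>p. c * of_bool (p \<in> B) + (\<Sum>x\<in>sphere n ?m. F x p))" .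
  then show ?case
  proof (rule ext[rotated])
    fix p assume p: "p \<in> boundary n"
    have "(\<Sum>x\<in>sphere n ?m. F x p) = (\<Sum>x\<in>{pref p ?m}. F x p)"
      using pref_sphere[OF p, of ?m] by (intro sum.mono_neutral_right finite_sphere) (auto simp: F_def)
    then show "c * of_bool (p \<in> B) + (\<Sum>x\<in>sphere n ?m. F x p) = c * of_bool (p \<in> A)"
      by (simp add: F_def)
  qed
qed

text \<open>A function of finite depth has finitely many values and is the sum, over these, of the
  value times the indicator of its level set, which inherits depth and invariance.\<close>

lemma generation:
  fixes H :: "(bpoint \<Rightarrow> int) \<Rightarrow> bool"
  assumes ext: "\<And>f g. (\<And>p. p \<in> boundary n \<Longrightarrow> f p = g p) \<Longrightarrow> H f \<Longrightarrow> H g"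
    and zero: "H (\<lambda>p. 0)" and add: "\<And>f g. H f \<Longrightarrow> H g \<Longrightarrow> H (\<lambda>p. f p + g p)"
    and act: "\<And>f h. h \<in> rwords n \<Longrightarrow> H f \<Longrightarrow> H (\<lambda>p. f (boundary_act n h p))"
    and base: "\<And>f. depth n (Suc R) f \<Longrightarrow> invariant f \<Longrightarrow> H f"
    and T: "\<And>a. fst a < n \<Longrightarrow> traces (Suc R) a \<subseteq> traces R a"
    and f: "depth n N f" "invariant f"
  shows "H f"
proof -
  have lev: "H (\<lambda>p. c * of_bool (p \<in> {p. f p = c}))" for c
  proof (rule indicator_generation[where H = H and R = R and k = N and A = "{p. f p = c}" and c = c])
    show "depth n (Suc R + N) (\<lambda>p. p \<in> {p. f p = c})"
    proof (rule depth_mono)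
      show "depth n N (\<lambda>p. p \<in> {p. f p = c})"
        using depth_comp[OF f(1), of "\<lambda>z. z = c"] by simp
    qed simp
    show "invariant (\<lambda>p. p \<in> {p. f p = c})"
      using invariant_comp[OF f(2), of "\<lambda>z. z = c"] by simp
  qed (fact ext zero add act base T)+
  have "H (\<lambda>p. \<Sum>c\<in>S. c * of_bool (p \<in> {p. f p = c}))" if "finite S" for S
    using that
  proof (induction S rule: finite_induct)
    case empty
    then show ?case using zero by simp
  next
    case (insert c S)
    from add[OF lev[of c] insert.IH] show ?case by (simp only: sum.insert[OF insert.hyps])
  qed
  from this[OF depth_finite_range[OF f(1)]] show ?thesis
  proof (rule ext[rotated])
    fix p assume p: "p \<in> boundary n"
    have "(\<Sum>c\<in>f ` boundary n. c * of_bool (p \<in> {p. f p = c})) = (\<Sum>c\<in>{f p}. c * of_bool (p \<in> {p. f p = c}))"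
      using p by (intro sum.mono_neutral_right depth_finite_range[OF f(1)]) auto
    then show "(\<Sum>c\<in>f ` boundary n. c * of_bool (p \<in> {p. f p = c})) = f p"
      by simp
  qed
qed

end

section \<open>Free right modules\<close>

lemma free_right_module_simps [simp]:
  "mult (free_right_module G k) = (\<lambda>x y i h. x i h + y i h)"
  "one (free_right_module G k) = (\<lambda>i h. 0)"
  "act (free_right_module G k) x g = (\<lambda>i h. if h \<in> carrier G then x i (h \<otimes>\<^bsub>G\<^esub> inv\<^bsub>G\<^esub> g) else 0)"
  by (simp_all add: free_right_module_def)

text \<open>There are only \<open>k\<close> positions, so finiteness of the support may be stated
  for group elements alone, over which \<open>eval\<close> will sum.\<close>

lemma free_module_carrier_iff:
  "x \<in> carrier (free_right_module G k) \<longleftrightarrow>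
    (\<forall>i h. x i h \<noteq> 0 \<longrightarrow> i < k \<and> h \<in> carrier G) \<and> finite {h. \<exists>i. x i h \<noteq> 0}"
proof -
  have "finite {(i, h). x i h \<noteq> 0} \<longleftrightarrow> finite {h. \<exists>i. x i h \<noteq> 0}"
    if *: "\<forall>i h. x i h \<noteq> 0 \<longrightarrow> i < k \<and> h \<in> carrier G"
  proof
    assume "finite {(i, h). x i h \<noteq> 0}"
    then have "finite (snd ` {(i, h). x i h \<noteq> 0})" by (rule finite_imageI)
    moreover have "{h. \<exists>i. x i h \<noteq> 0} = snd ` {(i, h). x i h \<noteq> 0}" by force
    ultimately show "finite {h. \<exists>i. x i h \<noteq> 0}" by simp
  next
    assume "finite {h. \<exists>i. x i h \<noteq> 0}"
    then have "finite ({..<k} \<times> {h. \<exists>i. x i h \<noteq> 0})" by simp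
    moreover have "{(i, h). x i h \<noteq> 0} \<subseteq> {..<k} \<times> {h. \<exists>i. x i h \<noteq> 0}" using * by auto
    ultimately show "finite {(i, h). x i h \<noteq> 0}" by (rule rev_finite_subset)
  qed
  then show ?thesis unfolding free_right_module_def by auto
qed

lemma free_module_support:
  assumes "x \<in> carrier (free_right_module G k)"
  shows "finite {h. \<exists>i. x i h \<noteq> 0}" "x i h \<noteq> 0 \<Longrightarrow> i < k" "x i h \<noteq> 0 \<Longrightarrow> h \<in> carrier G"
  using assms unfolding free_module_carrier_iff by blast+

lemma free_module_add:
  assumes "x \<in> carrier (free_right_module G k)" "y \<in> carrier (free_right_module G k)"
  shows "(\<lambda>i h. x i h + y i h) \<in> carrier (free_right_module G k)"
  unfolding free_module_carrier_iff
proof (intro conjI allI impI)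
  fix i h assume "x i h + y i h \<noteq> 0"
  then have "x i h \<noteq> 0 \<or> y i h \<noteq> 0" by auto
  then show "i < k" "h \<in> carrier G"
    using free_module_support(2,3)[OF assms(1)] free_module_support(2,3)[OF assms(2)] by blast+
next
  have "{h. \<exists>i. x i h + y i h \<noteq> 0} \<subseteq> {h. \<exists>i. x i h \<noteq> 0} \<union> {h. \<exists>i. y i h \<noteq> 0}"
  proof
    fix h assume "h \<in> {h. \<exists>i. x i h + y i h \<noteq> 0}"
    then obtain i where "x i h + y i h \<noteq> 0" by blast
    then have "x i h \<noteq> 0 \<or> y i h \<noteq> 0" by auto
    then show "h \<in> {h. \<exists>i. x i h \<noteq> 0} \<union> {h. \<exists>i. y i h \<noteq> 0}" by blast
  qed
  then show "finite {h. \<exists>i. x i h + y i h \<noteq> 0}"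
    by (rule finite_subset) (simp add: free_module_support(1)[OF assms(1)] free_module_support(1)[OF assms(2)])
qed

lemma free_module_scale:
  assumes "x \<in> carrier (free_right_module G k)"
  shows "(\<lambda>i h. c * x i h) \<in> carrier (free_right_module G k)"
  unfolding free_module_carrier_iff
proof (intro conjI allI impI)
  fix i h assume "c * x i h \<noteq> 0"
  then have "x i h \<noteq> 0" by simp
  then show "i < k" "h \<in> carrier G" using free_module_support(2,3)[OF assms(1)] by blast+
next
  have "{h. \<exists>i. c * x i h \<noteq> 0} \<subseteq> {h. \<exists>i. x i h \<noteq> 0}" by auto
  then show "finite {h. \<exists>i. c * x i h \<noteq> 0}"
    by (rule finite_subset) (rule free_module_support(1)[OF assms(1)])
qed

lemma free_module_zero: "(\<lambda>i h. 0) \<in> carrier (free_right_module G k)"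
  unfolding free_module_carrier_iff by simp

lemma free_module_uminus:
  assumes "x \<in> carrier (free_right_module G k)"
  shows "(\<lambda>i h. - x i h) \<in> carrier (free_right_module G k)"
  using free_module_scale[OF assms, of "- 1"] by simp

lemma group_free_module: "group (free_right_module G k)"
proof (rule groupI)
  fix x assume x: "x \<in> carrier (free_right_module G k)"
  show "\<exists>y\<in>carrier (free_right_module G k). y \<otimes>\<^bsub>free_right_module G k\<^esub> x = \<one>\<^bsub>free_right_module G k\<^esub>"
    by (rule bexI[OF _ free_module_uminus[OF x]]) simp
qed (simp_all add: free_module_add free_module_zero add.assoc)

lemma inv_free_module:
  assumes "x \<in> carrier (free_right_module G k)"
  shows "inv\<^bsub>free_right_module G k\<^esub> x = (\<lambda>i h. - x i h)"
  using assms by (intro group.inv_equality[OF group_free_module]) (simp_all add: free_module_uminus)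

lemma free_module_act:
  assumes G: "group G" and x: "x \<in> carrier (free_right_module G k)" and g: "g \<in> carrier G"
  shows "act (free_right_module G k) x g \<in> carrier (free_right_module G k)"
proof -
  interpret group G by (rule G)
  have "{h. \<exists>i. act (free_right_module G k) x g i h \<noteq> 0} \<subseteq> (\<lambda>h. h \<otimes>\<^bsub>G\<^esub> g) ` {h. \<exists>i. x i h \<noteq> 0}"
  proof
    fix h assume "h \<in> {h. \<exists>i. act (free_right_module G k) x g i h \<noteq> 0}"
    then obtain i where i: "h \<in> carrier G" "x i (h \<otimes>\<^bsub>G\<^esub> inv\<^bsub>G\<^esub> g) \<noteq> 0"
      by (auto split: if_splits)
    have "h = (h \<otimes>\<^bsub>G\<^esub> inv\<^bsub>G\<^esub> g) \<otimes>\<^bsub>G\<^esub> g" using i(1) g by (simp add: m_assoc)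
    with i(2) show "h \<in> (\<lambda>h. h \<otimes>\<^bsub>G\<^esub> g) ` {h. \<exists>i. x i h \<noteq> 0}" by blast
  qed
  then have "finite {h. \<exists>i. act (free_right_module G k) x g i h \<noteq> 0}"
    by (rule finite_subset) (intro finite_imageI free_module_support(1)[OF x])
  moreover have "i < k \<and> h \<in> carrier G" if "act (free_right_module G k) x g i h \<noteq> 0" for i h
    using that free_module_support(2)[OF x] by (auto split: if_splits)
  ultimately show ?thesis unfolding free_module_carrier_iff by blast
qed

definition single :: "nat \<Rightarrow> 'g \<Rightarrow> nat \<Rightarrow> 'g \<Rightarrow> int" where
  "single i h = (\<lambda>i' h'. of_bool (i' = i \<and> h' = h))"

lemma single_carrier: "i < k \<Longrightarrow> h \<in> carrier G \<Longrightarrow> single i h \<in> carrier (free_right_module G k)"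
proof -
  assume "i < k" "h \<in> carrier G"
  moreover have "{h'. \<exists>i'. single i h i' h' \<noteq> 0} = {h}" by (auto simp: single_def)
  ultimately show ?thesis unfolding free_module_carrier_iff by (simp add: single_def)
qed

lemma act_single:
  assumes "group G" "h \<in> carrier G" "g \<in> carrier G"
  shows "act (free_right_module G k) (single i h) g = single i (h \<otimes>\<^bsub>G\<^esub> g)"
proof -
  interpret group G by (rule assms(1))
  have "h' \<otimes>\<^bsub>G\<^esub> inv\<^bsub>G\<^esub> g = h \<longleftrightarrow> h' = h \<otimes>\<^bsub>G\<^esub> g" if "h' \<in> carrier G" for h'
    using that assms(2,3) inv_solve_right[of h h' g] inv_solve_right'[of h h' g] by auto
  then show ?thesis
    using assms by (intro ext) (auto simp: single_def)
qed

locale generated_submodule =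
  fixes G :: "('g, 'c) monoid_scheme" and k :: nat and S :: "(nat \<Rightarrow> 'g \<Rightarrow> int) set"
  assumes group_G: "group G" and S_carrier: "S \<subseteq> carrier (free_right_module G k)"
begin

abbreviation FM where "FM \<equiv> free_right_module G k"

definition span where "span = submodule_generated G FM S"

lemma span_minimal:
  assumes "subgroup N FM" "S \<subseteq> N" "\<And>x g. x \<in> N \<Longrightarrow> g \<in> carrier G \<Longrightarrow> act FM x g \<in> N"
  shows "span \<subseteq> N"
  unfolding span_def submodule_generated_def using assms by blast

lemma spanI:
  assumes "\<And>N. subgroup N FM \<Longrightarrow> S \<subseteq> N \<Longrightarrow> (\<And>x g. x \<in> N \<Longrightarrow> g \<in> carrier G \<Longrightarrow> act FM x g \<in> N) \<Longrightarrow> x \<in> N"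
  shows "x \<in> span"
  unfolding span_def submodule_generated_def using assms by blast

lemma spanD:
  assumes "x \<in> span" "subgroup N FM" "S \<subseteq> N" "\<And>x g. x \<in> N \<Longrightarrow> g \<in> carrier G \<Longrightarrow> act FM x g \<in> N"
  shows "x \<in> N"
  using span_minimal[OF assms(2-4)] assms(1) by blast

lemma span_carrier: "x \<in> span \<Longrightarrow> x \<in> carrier FM"
  by (erule spanD, rule group.subgroup_self[OF group_free_module], rule S_carrier, rule free_module_act[OF group_G])

lemma span_base: "x \<in> S \<Longrightarrow> x \<in> span"
  by (rule spanI) blast

lemma span_zero: "(\<lambda>i h. 0) \<in> span"
proof (rule spanI)
  fix N assume "subgroup N FM"
  from subgroup.one_closed[OF this] show "(\<lambda>i h. 0) \<in> N" by simp
qed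

lemma span_add:
  assumes "x \<in> span" "y \<in> span"
  shows "(\<lambda>i h. x i h + y i h) \<in> span"
proof (rule spanI)
  fix N assume N: "subgroup N FM" "S \<subseteq> N" "\<And>x g. x \<in> N \<Longrightarrow> g \<in> carrier G \<Longrightarrow> act FM x g \<in> N"
  from subgroup.m_closed[OF N(1) spanD[OF assms(1) N] spanD[OF assms(2) N]]
  show "(\<lambda>i h. x i h + y i h) \<in> N" by simp
qed

lemma span_uminus:
  assumes "x \<in> span"
  shows "(\<lambda>i h. - x i h) \<in> span"
proof (rule spanI)
  fix N assume N: "subgroup N FM" "S \<subseteq> N" "\<And>x g. x \<in> N \<Longrightarrow> g \<in> carrier G \<Longrightarrow> act FM x g \<in> N"
  from subgroup.m_inv_closed[OF N(1) spanD[OF assms(1) N]]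
  show "(\<lambda>i h. - x i h) \<in> N" using inv_free_module[OF span_carrier[OF assms]] by simp
qed

lemma span_act:
  assumes "x \<in> span" "g \<in> carrier G"
  shows "act FM x g \<in> span"
proof (rule spanI)
  fix N assume N: "subgroup N FM" "S \<subseteq> N" "\<And>x g. x \<in> N \<Longrightarrow> g \<in> carrier G \<Longrightarrow> act FM x g \<in> N"
  show "act FM x g \<in> N" by (rule N(3)[OF spanD[OF assms(1) N] assms(2)])
qed

lemma span_diff: "x \<in> span \<Longrightarrow> y \<in> span \<Longrightarrow> (\<lambda>i h. x i h - y i h) \<in> span"
  using span_add[OF _ span_uminus, of x y] by simp

lemma span_scale:
  assumes "x \<in> span"
  shows "(\<lambda>i h. c * x i h) \<in> span"
proof (induction c rule: int_induct[where k = 0])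
  case base
  then show ?case using span_zero by simp
next
  case (step1 c)
  then show ?case using span_add[OF step1(2) assms] by (simp add: algebra_simps)
next
  case (step2 c)
  then show ?case using span_diff[OF step2(2) assms] by (simp add: algebra_simps)
qed

lemma span_sum:
  assumes "finite J" "\<And>j. j \<in> J \<Longrightarrow> X j \<in> span"
  shows "(\<lambda>i h. \<Sum>j\<in>J. X j i h) \<in> span"
  using assms
proof (induction J rule: finite_induct)
  case empty
  then show ?case using span_zero by simp
next
  case (insert j J)
  have "X j \<in> span" "(\<lambda>i h. \<Sum>j\<in>J. X j i h) \<in> span" using insert by auto
  from span_add[OF this] show ?case by (simp only: sum.insert[OF insert.hyps])
qed

end

lemma reduce_mult_winv:
  assumes "reduced h"
  shows "reduce (reduce (h @ g) @ winv g) = h" "reduce (reduce (h @ winv g) @ g) = h"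
  using assms reduce_append_right[of h "g @ winv g"] reduce_append_right[of h "winv g @ g"]
  by (simp_all add: reduce_append_left reduce_reduced)

section \<open>Presentation by clopen sets of bounded depth\<close>

text \<open>A clopen set of depth \<open>D\<close> is stored as the set of length \<open>D\<close>
  prefixes of its points. The enumeration \<open>A\<close> has to reach every invariant set but may
  list a set several times.\<close>

locale presentation = pattern +
  fixes D k :: nat and A :: "nat \<Rightarrow> word set"
  assumes D: "D > 0"
    and A_sphere: "i < k \<Longrightarrow> A i \<subseteq> sphere n D"
    and A_invariant: "i < k \<Longrightarrow> invariant (\<lambda>p. pref p D \<in> A i)"
    and A_all: "B \<subseteq> sphere n D \<Longrightarrow> invariant (\<lambda>p. pref p D \<in> B) \<Longrightarrow> \<exists>i<k. A i = B"
begin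

abbreviation \<Phi> where "\<Phi> \<equiv> free_right_module (free_group n) k"

text \<open>The sum of two indicators is an indicator exactly for disjoint sets, so one integer
  equation expresses that \<open>A l\<close> is the disjoint union of \<open>A i\<close> and
  \<open>A j\<close>.\<close>

definition additive_relators :: "(nat \<Rightarrow> word \<Rightarrow> int) set" where
  "additive_relators = {\<lambda>i' h. single i [] i' h + single j [] i' h - single l [] i' h | i j l.
     i < k \<and> j < k \<and> l < k \<and>
     (\<forall>u\<in>sphere n D. of_bool (u \<in> A i) + of_bool (u \<in> A j) = (of_bool (u \<in> A l) :: int))}"

text \<open>The set \<open>A j\<close> consists of the points that \<open>a\<close> moves into
  \<open>A i\<close>. Since \<open>a\<close> may cancel a letter, the first \<open>D\<close> letters
  after translation have to be read off from \<open>Suc D\<close> letters.\<close>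

definition shift_relators :: "(nat \<Rightarrow> word \<Rightarrow> int) set" where
  "shift_relators = {\<lambda>i' h. single i [a] i' h - single j [] i' h | i j a.
     i < k \<and> j < k \<and> fst a < n \<and>
     (\<forall>u\<in>sphere n (Suc D). take D (reduce (a # u)) \<in> A i \<longleftrightarrow> take D u \<in> A j)}"

text \<open>The basis vector \<open>i\<close> times \<open>h\<close> goes to the indicator of
  \<open>A i\<close> composed with the action of \<open>h\<close>. Precomposition reverses the order
  of products, in accordance with a right module.\<close>

definition eval :: "(nat \<Rightarrow> word \<Rightarrow> int) \<Rightarrow> bpoint \<Rightarrow> int" where
  "eval x p = (\<Sum>h\<in>{h. \<exists>i. x i h \<noteq> 0}. \<Sum>i<k. x i h * of_bool (pref (boundary_act n h p) D \<in> A i))"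

lemma single_word_carrier: "i < k \<Longrightarrow> h \<in> rwords n \<Longrightarrow> single i h \<in> carrier \<Phi>"
  by (rule single_carrier) simp_all

lemma additive_carrier: "additive_relators \<subseteq> carrier \<Phi>"
proof
  fix x assume "x \<in> additive_relators"
  then obtain i j l where x: "x = (\<lambda>i' h. single i [] i' h + single j [] i' h - single l [] i' h)" and "i < k" "j < k" "l < k"
    unfolding additive_relators_def by blast
  then have "single i [] \<in> carrier \<Phi>" "single j [] \<in> carrier \<Phi>" "single l [] \<in> carrier \<Phi>"
    by (simp_all add: single_word_carrier)
  from free_module_add[OF free_module_add[OF this(1,2)] free_module_uminus[OF this(3)]]
  show "x \<in> carrier \<Phi>" unfolding x by simp
qed

lemma shift_carrier: "shift_relators \<subseteq> carrier \<Phi>"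
proof
  fix x assume "x \<in> shift_relators"
  then obtain i j a where x: "x = (\<lambda>i' h. single i [a] i' h - single j [] i' h)" and "i < k" "j < k" "fst a < n"
    unfolding shift_relators_def by blast
  then have "single i [a] \<in> carrier \<Phi>" "single j [] \<in> carrier \<Phi>"
    by (simp_all add: single_word_carrier)
  from free_module_add[OF this(1) free_module_uminus[OF this(2)]]
  show "x \<in> carrier \<Phi>" unfolding x by simp
qed

sublocale generated_submodule "free_group n" k "additive_relators \<union> shift_relators"
  by (rule generated_submodule.intro[OF group_free_group]) (use additive_carrier shift_carrier in blast)

lemma eval_superset:
  assumes "finite T" "{h. \<exists>i. x i h \<noteq> 0} \<subseteq> T"
  shows "eval x p = (\<Sum>h\<in>T. \<Sum>i<k. x i h * of_bool (pref (boundary_act n h p) D \<in> A i))"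
  unfolding eval_def by (rule sum.mono_neutral_left[OF assms]) auto

lemma eval_add:
  assumes "x \<in> carrier \<Phi>" "y \<in> carrier \<Phi>"
  shows "eval (\<lambda>i h. x i h + y i h) p = eval x p + eval y p"
proof -
  let ?T = "{h. \<exists>i. x i h \<noteq> 0} \<union> {h. \<exists>i. y i h \<noteq> 0}"
  have fin: "finite ?T" using free_module_support(1)[OF assms(1)] free_module_support(1)[OF assms(2)] by simp
  have "{h. \<exists>i. x i h + y i h \<noteq> 0} \<subseteq> ?T"
  proof
    fix h assume "h \<in> {h. \<exists>i. x i h + y i h \<noteq> 0}"
    then obtain i where "x i h + y i h \<noteq> 0" by blast
    then have "x i h \<noteq> 0 \<or> y i h \<noteq> 0" by auto
    then show "h \<in> ?T" by blast
  qed
  from eval_superset[OF fin this, of p] show ?thesis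
    unfolding eval_superset[OF fin Un_upper1, of p] eval_superset[OF fin Un_upper2, of p]
    by (simp only: distrib_right sum.distrib)
qed

lemma eval_scale:
  assumes "x \<in> carrier \<Phi>"
  shows "eval (\<lambda>i h. c * x i h) p = c * eval x p"
proof -
  have "{h. \<exists>i. c * x i h \<noteq> 0} \<subseteq> {h. \<exists>i. x i h \<noteq> 0}" by auto
  from eval_superset[OF free_module_support(1)[OF assms] this, of p] show ?thesis
    unfolding eval_def[of x] by (simp only: mult.assoc sum_distrib_left)
qed

lemma eval_zero: "eval (\<lambda>i h. 0) p = 0"
  by (simp add: eval_def)

lemma eval_single:
  assumes "i < k"
  shows "eval (single i h) p = of_bool (pref (boundary_act n h p) D \<in> A i)"
proof -
  have "eval (single i h) p = (\<Sum>h'\<in>{h}. \<Sum>i'<k. single i h i' h' * of_bool (pref (boundary_act n h' p) D \<in> A i'))"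
    by (rule eval_superset) (auto simp: single_def)
  also have "\<dots> = (\<Sum>i'<k. single i h i' h * of_bool (pref (boundary_act n h p) D \<in> A i'))"
    by simp
  also have "\<dots> = (\<Sum>i'\<in>{i}. single i h i' h * of_bool (pref (boundary_act n h p) D \<in> A i'))"
    using assms by (intro sum.mono_neutral_right) (auto simp: single_def)
  finally show ?thesis by (simp add: single_def)
qed

text \<open>The coefficient of \<open>h\<close> times \<open>g\<close> in the translate is that of
  \<open>h\<close> in \<open>x\<close>, and \<open>h\<close> times \<open>g\<close> acts on
  \<open>p\<close> as \<open>h\<close> acts on the translate of \<open>p\<close> by
  \<open>g\<close>; so the sum is reindexed by right multiplication.\<close>

lemma eval_act:
  assumes x: "x \<in> carrier \<Phi>" and g: "g \<in> rwords n" and p: "p \<in> boundary n"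
  shows "eval (act \<Phi> x g) p = eval x (boundary_act n g p)"
proof -
  let ?T = "{h. \<exists>i. x i h \<noteq> 0}"
  let ?m = "\<lambda>h. reduce (h @ g)"
  have T: "?T \<subseteq> rwords n" using free_module_support(3)[OF x] by auto
  have inv: "?m h \<otimes>\<^bsub>free_group n\<^esub> inv\<^bsub>free_group n\<^esub> g = h" if "h \<in> rwords n" for h
    using that by (simp add: inv_free_group[OF g] reduce_mult_winv)
  have inj: "inj_on ?m ?T"
    by (rule inj_on_inverseI[of _ "\<lambda>h. h \<otimes>\<^bsub>free_group n\<^esub> inv\<^bsub>free_group n\<^esub> g"]) (use inv T in blast)
  have sub: "{h. \<exists>i. act \<Phi> x g i h \<noteq> 0} \<subseteq> ?m ` ?T"
  proof
    fix h assume "h \<in> {h. \<exists>i. act \<Phi> x g i h \<noteq> 0}"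
    then obtain i where "(if h \<in> carrier (free_group n) then x i (h \<otimes>\<^bsub>free_group n\<^esub> inv\<^bsub>free_group n\<^esub> g) else 0) \<noteq> 0"
      unfolding free_right_module_simps(3) by blast
    then have i: "h \<in> carrier (free_group n)" "x i (h \<otimes>\<^bsub>free_group n\<^esub> inv\<^bsub>free_group n\<^esub> g) \<noteq> 0"
      by (simp_all split: if_split_asm del: carrier_free_group mult_free_group)
    then have "h = ?m (h \<otimes>\<^bsub>free_group n\<^esub> inv\<^bsub>free_group n\<^esub> g)"
      by (simp add: inv_free_group[OF g] reduce_mult_winv)
    with i(2) show "h \<in> ?m ` ?T" by blast
  qed
  have val: "act \<Phi> x g i (?m h) = x i h" if "h \<in> ?T" for h i
  proof -
    have h: "h \<in> rwords n" using that T by blast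
    then have "?m h \<in> carrier (free_group n)" using g by (simp add: reduce_words reduced_reduce)
    then show ?thesis unfolding free_right_module_simps(3) inv[OF h] by simp
  qed
  have "eval (act \<Phi> x g) p = (\<Sum>h\<in>?m ` ?T. \<Sum>i<k. act \<Phi> x g i h * of_bool (pref (boundary_act n h p) D \<in> A i))"
    by (rule eval_superset[OF finite_imageI[OF free_module_support(1)[OF x]] sub])
  also have "\<dots> = (\<Sum>h\<in>?T. \<Sum>i<k. act \<Phi> x g i (?m h) * of_bool (pref (boundary_act n (?m h) p) D \<in> A i))"
    by (rule sum.reindex_cong[OF inj refl refl])
  also have "\<dots> = (\<Sum>h\<in>?T. \<Sum>i<k. x i h * of_bool (pref (boundary_act n h (boundary_act n g p)) D \<in> A i))"
  proof (intro sum.cong refl)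
    fix h i assume h: "h \<in> ?T"
    then have "h \<in> rwords n" using T by blast
    from val[OF h] boundary_act_mult[OF this g p]
    show "act \<Phi> x g i (?m h) * of_bool (pref (boundary_act n (?m h) p) D \<in> A i) =
      x i h * of_bool (pref (boundary_act n h (boundary_act n g p)) D \<in> A i)" by (simp only:)
  qed
  finally show ?thesis unfolding eval_def[of x] .
qed

lemma eval_diff:
  assumes "x \<in> carrier \<Phi>" "y \<in> carrier \<Phi>"
  shows "eval (\<lambda>i h. x i h - y i h) p = eval x p - eval y p"
  using eval_add[OF assms(1) free_module_uminus[OF assms(2)], of p] eval_scale[OF assms(2), of "- 1" p] by simp

text \<open>The kernel of evaluation is an invariant subgroup that contains both kinds of
  relators.\<close>

lemma eval_span:
  assumes "x \<in> span" "p \<in> boundary n"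
  shows "eval x p = 0"
proof -
  let ?N = "{x \<in> carrier \<Phi>. \<forall>p\<in>boundary n. eval x p = 0}"
  have "span \<subseteq> ?N"
  proof (rule span_minimal)
    show "subgroup ?N \<Phi>"
    proof (rule group.subgroupI[OF group_free_module])
      show "?N \<noteq> {}" using free_module_zero[of "free_group n" k] eval_zero by blast
    next
      fix x assume "x \<in> ?N"
      then have c: "x \<in> carrier \<Phi>" by blast
      from \<open>x \<in> ?N\<close> have "eval (\<lambda>i h. - x i h) p = 0" if "p \<in> boundary n" for p
        using eval_scale[OF c, of "- 1" p] that by simp
      with free_module_uminus[OF c] show "inv\<^bsub>\<Phi>\<^esub> x \<in> ?N"
        unfolding inv_free_module[OF c] by simp
    next
      fix x y assume "x \<in> ?N" "y \<in> ?N"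
      then have c: "x \<in> carrier \<Phi>" "y \<in> carrier \<Phi>" by blast+
      from \<open>x \<in> ?N\<close> \<open>y \<in> ?N\<close> have "eval (\<lambda>i h. x i h + y i h) p = 0" if "p \<in> boundary n" for p
        unfolding eval_add[OF c] using that by simp
      with free_module_add[OF c] show "x \<otimes>\<^bsub>\<Phi>\<^esub> y \<in> ?N" by simp
    qed blast
  next
    have unit: "boundary_act n [] p = p" if "p \<in> boundary n" for p
      by (rule boundary_act_one[OF that])
    show "additive_relators \<union> shift_relators \<subseteq> ?N"
    proof
      fix x assume x: "x \<in> additive_relators \<union> shift_relators"
      then have xc: "x \<in> carrier \<Phi>" using S_carrier by blast
      have "eval x p = 0" if p: "p \<in> boundary n" for p
      proof (cases "x \<in> additive_relators")
        case True
        then obtain i j l where x: "x = (\<lambda>i' h. single i [] i' h + single j [] i' h - single l [] i' h)"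
          and ijl: "i < k" "j < k" "l < k"
          and u: "\<And>u. u \<in> sphere n D \<Longrightarrow> of_bool (u \<in> A i) + of_bool (u \<in> A j) = (of_bool (u \<in> A l) :: int)"
          unfolding additive_relators_def by blast
        have c: "single i [] \<in> carrier \<Phi>" if "i < k" for i using that by (simp add: single_word_carrier)
        have "eval x p = eval (single i []) p + eval (single j []) p - eval (single l []) p"
          unfolding x using eval_diff[OF free_module_add[OF c[OF ijl(1)] c[OF ijl(2)]] c[OF ijl(3)], of p]
            eval_add[OF c[OF ijl(1)] c[OF ijl(2)], of p] by simp
        then show ?thesis
          using u[OF pref_sphere[OF p]] ijl by (simp add: eval_single unit[OF p])
      next
        case False
        with x obtain i j a where x: "x = (\<lambda>i' h. single i [a] i' h - single j [] i' h)"
          and ija: "i < k" "j < k" "fst a < n"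
          and u: "\<And>u. u \<in> sphere n (Suc D) \<Longrightarrow> take D (reduce (a # u)) \<in> A i \<longleftrightarrow> take D u \<in> A j"
          unfolding shift_relators_def by blast
        have "eval x p = eval (single i [a]) p - eval (single j []) p"
          unfolding x using ija by (intro eval_diff single_word_carrier) simp_all
        moreover have "pref (boundary_act n [a] p) D = take D (reduce (a # pref p (Suc D)))"
          using boundary_act_closed(2)[of "[a]" n p D] ija p by simp
        moreover have "take D (pref p (Suc D)) = pref p D"
          using take_pref[OF p] by simp
        ultimately show ?thesis
          using u[OF pref_sphere[OF p]] ija by (simp add: eval_single unit[OF p])
      qed
      with xc show "x \<in> ?N" by blast
    qed
  next
    fix x g assume x: "x \<in> ?N" and g: "g \<in> carrier (free_group n)"
    have g': "g \<in> rwords n" using g by simp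
    have "eval (act \<Phi> x g) p = 0" if p: "p \<in> boundary n" for p
    proof -
      from x have "x \<in> carrier \<Phi>" "eval x (boundary_act n g p) = 0"
        using boundary_act_closed(1)[OF g' p] by blast+
      with eval_act[OF this(1) g' p] show ?thesis by (simp only:)
    qed
    moreover have "act \<Phi> x g \<in> carrier \<Phi>"
      by (rule free_module_act[OF group_free_group _ g]) (use x in blast)
    ultimately show "act \<Phi> x g \<in> ?N"
      unfolding mem_Collect_eq by (intro conjI ballI)
  qed
  with assms show ?thesis by blast
qed

end

context presentation begin

section \<open>Relations supported at the identity\<close>

definition good :: "word set \<Rightarrow> bool" where
  "good B \<longleftrightarrow> B \<subseteq> sphere n D \<and> invariant (\<lambda>p. pref p D \<in> B)"

text \<open>Fixes one position for each set; other positions holding the same set are identified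
  with it by \<open>single_generator\<close>.\<close>

definition idx :: "word set \<Rightarrow> nat" where
  "idx B = (SOME i. i < k \<and> A i = B)"

abbreviation generator where
  "generator B \<equiv> single (idx B) []"

lemma idx: assumes "good B" shows "idx B < k" "A (idx B) = B"
proof -
  have "\<exists>i. i < k \<and> A i = B"
    using assms A_all[of B] unfolding good_def by blast
  from someI_ex[OF this] show "idx B < k" "A (idx B) = B"
    unfolding idx_def by blast+
qed

lemma good_A: "i < k \<Longrightarrow> good (A i)"
  unfolding good_def using A_sphere A_invariant by blast

lemma good_empty: "good {}"
  unfolding good_def invariant_def by simp

lemma good_Un:
  assumes "good B" "good C"
  shows "good (B \<union> C)"
proof -
  have "pref p D \<in> B \<union> C \<longleftrightarrow> pref q D \<in> B \<union> C" if "(p, q) \<in> \<Lambda>" for p q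
    using invariantD[OF _ that] assms unfolding good_def Un_iff by blast
  then show ?thesis using assms unfolding good_def invariant_def by blast
qed

lemma additive_span:
  assumes "i < k" "j < k" "l < k" "\<And>u. u \<in> sphere n D \<Longrightarrow> of_bool (u \<in> A i) + of_bool (u \<in> A j) = (of_bool (u \<in> A l) :: int)"
  shows "(\<lambda>i' h. single i [] i' h + single j [] i' h - single l [] i' h) \<in> span"
  by (rule span_base) (use assms in \<open>unfold additive_relators_def, blast\<close>)

lemma generator_Un:
  assumes "good B" "good C" "B \<inter> C = {}"
  shows "(\<lambda>i h. generator B i h + generator C i h - generator (B \<union> C) i h) \<in> span"
  by (rule additive_span) (use assms idx[OF assms(1)] idx[OF assms(2)] idx[OF good_Un[OF assms(1,2)]] in auto)

text \<open>Adding the empty set to itself shows that its generator is trivial, and adding it to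
  \<open>A i\<close> then identifies any two positions that hold the same set.\<close>

lemma single_generator:
  assumes "i < k"
  shows "(\<lambda>i' h. single i [] i' h - generator (A i) i' h) \<in> span"
proof -
  note z = idx[OF good_empty] and a = idx[OF good_A[OF assms]]
  have 1: "(\<lambda>i' h. generator {} i' h + single i [] i' h - generator (A i) i' h) \<in> span"
    by (rule additive_span[OF z(1) assms a(1)]) (simp add: z(2) a(2))
  have "(\<lambda>i' h. generator {} i' h + generator {} i' h - generator {} i' h) \<in> span"
    by (rule additive_span[OF z(1) z(1) z(1)]) (simp add: z(2))
  then have 2: "generator {} \<in> span" by simp
  from span_diff[OF 1 2] show ?thesis by simp
qed

text \<open>The classes of words that lie in the same invariant sets are the atoms of the Boolean
  algebra of invariant sets of depth \<open>D\<close>.\<close>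

definition atom :: "word \<Rightarrow> word set" where
  "atom u = {v \<in> sphere n D. \<forall>i<k. u \<in> A i \<longleftrightarrow> v \<in> A i}"

lemma good_atom: "good (atom u)"
proof -
  have "pref p D \<in> atom u \<longleftrightarrow> pref q D \<in> atom u" if l: "(p, q) \<in> \<Lambda>" for p q
  proof -
    have "pref p D \<in> A i \<longleftrightarrow> pref q D \<in> A i" if "i < k" for i
      by (rule invariantD[OF A_invariant[OF that] l])
    then show ?thesis
      using pref_sphere[OF pattern_boundary(1)[OF l], of D] pref_sphere[OF pattern_boundary(2)[OF l], of D]
      unfolding atom_def by blast
  qed
  then show ?thesis unfolding good_def invariant_def atom_def by blast
qed

lemma atom_self: "u \<in> sphere n D \<Longrightarrow> u \<in> atom u"
  unfolding atom_def by blast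

lemma atoms_disjoint: "atom u \<noteq> atom v \<Longrightarrow> atom u \<inter> atom v = {}"
  unfolding atom_def by blast

lemma generator_Union_atoms:
  assumes "finite Q" "Q \<subseteq> atom ` sphere n D"
  shows "good (\<Union>Q) \<and> (\<lambda>i h. (\<Sum>B\<in>Q. generator B i h) - generator (\<Union>Q) i h) \<in> span"
  using assms
proof (induction Q rule: finite_induct)
  case empty
  have "(\<lambda>i' h. generator {} i' h + generator {} i' h - generator {} i' h) \<in> span"
    by (rule additive_span[OF idx(1)[OF good_empty] idx(1)[OF good_empty] idx(1)[OF good_empty]])
      (simp add: idx(2)[OF good_empty])
  then have "generator {} \<in> span" by simp
  from span_uminus[OF this] show ?case by (simp add: good_empty)
next
  case (insert B Q)
  then obtain u where u: "B = atom u" by blast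
  have IH: "good (\<Union>Q)" "(\<lambda>i h. (\<Sum>B\<in>Q. generator B i h) - generator (\<Union>Q) i h) \<in> span"
    using insert by blast+
  have gB: "good B" unfolding u by (rule good_atom)
  have "B \<inter> C = {}" if "C \<in> Q" for C
  proof -
    from that insert.prems obtain v where v: "C = atom v" by blast
    have "B \<noteq> C" using that insert.hyps(2) by blast
    then show ?thesis unfolding u v by (rule atoms_disjoint)
  qed
  then have "B \<inter> \<Union>Q = {}" by blast
  from span_add[OF IH(2) generator_Un[OF gB IH(1) this]]
  have sp: "(\<lambda>i h. (\<Sum>B\<in>Q. generator B i h) - generator (\<Union>Q) i h + (generator B i h + generator (\<Union>Q) i h - generator (B \<union> \<Union>Q) i h)) \<in> span" .
  have eq: "(\<lambda>i h. (\<Sum>B\<in>Q. generator B i h) - generator (\<Union>Q) i h + (generator B i h + generator (\<Union>Q) i h - generator (B \<union> \<Union>Q) i h)) =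
    (\<lambda>i h. (\<Sum>B\<in>insert B Q. generator B i h) - generator (\<Union>(insert B Q)) i h)"
    by (simp only: sum.insert[OF insert.hyps] Union_insert) (simp add: algebra_simps)
  show ?case using sp[unfolded eq] good_Un[OF gB IH(1)] unfolding Union_insert by blast
qed

lemma A_Union_atoms:
  assumes "i < k"
  shows "\<Union>{B \<in> atom ` sphere n D. B \<subseteq> A i} = A i"
proof
  show "A i \<subseteq> \<Union>{B \<in> atom ` sphere n D. B \<subseteq> A i}"
  proof
    fix u assume u: "u \<in> A i"
    then have "u \<in> sphere n D" using A_sphere[OF assms] by blast
    moreover have "atom u \<subseteq> A i" using u assms unfolding atom_def by blast
    ultimately show "u \<in> \<Union>{B \<in> atom ` sphere n D. B \<subseteq> A i}" using atom_self by blast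
  qed
qed blast

text \<open>Modulo the additive relators every generator is the sum of the atoms it contains. Each
  atom contains the prefix of some boundary point, and evaluating there shows that the total
  coefficient of the atom is 0.\<close>

lemma kernel_unit:
  assumes x: "x \<in> carrier \<Phi>" and unit: "\<And>i h. x i h \<noteq> 0 \<Longrightarrow> h = []"
    and zero: "\<And>p. p \<in> boundary n \<Longrightarrow> eval x p = 0"
  shows "x \<in> span"
proof -
  let ?C = "atom ` sphere n D"
  have finC: "finite ?C" by (intro finite_imageI finite_sphere)
  have ev: "eval x p = (\<Sum>i<k. x i [] * of_bool (pref p D \<in> A i))" if "p \<in> boundary n" for p
  proof -
    have "{h. \<exists>i. x i h \<noteq> 0} \<subseteq> {[]}" using unit by blast
    from eval_superset[OF _ this, of p] show ?thesis by (simp add: boundary_act_one[OF that])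
  qed
  have coeff: "(\<Sum>i<k. x i [] * of_bool (B \<subseteq> A i)) = 0" if "B \<in> ?C" for B
  proof -
    from that obtain u where u: "u \<in> sphere n D" "B = atom u" by blast
    obtain p where p: "p \<in> boundary n" "pref p D = u" by (rule sphere_pref[OF u(1) D])
    have "B \<subseteq> A i \<longleftrightarrow> u \<in> A i" if "i < k" for i
      using that atom_self[OF u(1)] unfolding u(2) atom_def by blast
    then have "(\<Sum>i<k. x i [] * of_bool (B \<subseteq> A i)) = (\<Sum>i<k. x i [] * of_bool (pref p D \<in> A i))"
      unfolding p(2) by (intro sum.cong) simp_all
    with ev[OF p(1)] zero[OF p(1)] show ?thesis by simp
  qed
  have piece: "(\<lambda>i' h. single i [] i' h - (\<Sum>B\<in>?C. of_bool (B \<subseteq> A i) * generator B i' h)) \<in> span" if i: "i < k" for i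
  proof -
    let ?Q = "{B \<in> ?C. B \<subseteq> A i}"
    have "finite ?Q" "?Q \<subseteq> ?C" using finC by auto
    from generator_Union_atoms[OF this]
    have "(\<lambda>i' h. (\<Sum>B\<in>?Q. generator B i' h) - generator (A i) i' h) \<in> span"
      unfolding A_Union_atoms[OF i] by blast
    from span_diff[OF single_generator[OF i] this]
    have sp: "(\<lambda>i' h. single i [] i' h - (\<Sum>B\<in>?Q. generator B i' h)) \<in> span" by simp
    have eq: "(\<Sum>B\<in>?Q. generator B i' h) = (\<Sum>B\<in>?C. of_bool (B \<subseteq> A i) * generator B i' h)" for i' h
      by (rule sum.mono_neutral_cong_left[OF finC]) auto
    show ?thesis using sp unfolding eq .
  qed
  \<comment> \<open>The differences between generators and their atoms are weighted by the
    coefficients of \<open>x\<close>; after exchanging the two sums the atoms drop out by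
    \<open>coeff\<close>, and \<open>x\<close> remains.\<close>
  have "(\<lambda>i' h. \<Sum>i<k. x i [] * (single i [] i' h - (\<Sum>B\<in>?C. of_bool (B \<subseteq> A i) * generator B i' h))) \<in> span"
    by (rule span_sum[OF finite_lessThan]) (rule span_scale[OF piece], simp)
  moreover have "(\<Sum>i<k. x i [] * (single i [] i' h - (\<Sum>B\<in>?C. of_bool (B \<subseteq> A i) * generator B i' h))) = x i' h" for i' h
  proof -
    have "(\<Sum>i<k. x i [] * (\<Sum>B\<in>?C. of_bool (B \<subseteq> A i) * generator B i' h)) =
      (\<Sum>B\<in>?C. (\<Sum>i<k. x i [] * of_bool (B \<subseteq> A i)) * generator B i' h)"
      by (simp only: sum_distrib_left sum_distrib_right mult.assoc) (rule sum.swap)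
    also have "\<dots> = 0" by (intro sum.neutral ballI) (simp only: coeff mult_zero_left)
    finally have 0: "(\<Sum>i<k. x i [] * (\<Sum>B\<in>?C. of_bool (B \<subseteq> A i) * generator B i' h)) = 0" .
    have "(\<Sum>i<k. x i [] * single i [] i' h) = x i' h"
    proof (cases "i' < k \<and> h = []")
      case True
      then have "(\<Sum>i<k. x i [] * single i [] i' h) = (\<Sum>i\<in>{i'}. x i [] * single i [] i' h)"
        by (intro sum.mono_neutral_right) (auto simp: single_def)
      then show ?thesis using True by (simp add: single_def)
    next
      case False
      then have "x i' h = 0" using unit free_module_support(2)[OF x] by blast
      moreover have "(\<Sum>i<k. x i [] * single i [] i' h) = 0"
        using False by (intro sum.neutral) (auto simp: single_def)
      ultimately show ?thesis by simp
    qed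
    then show ?thesis
      by (simp only: right_diff_distrib sum_subtractf 0 diff_zero)
  qed
  ultimately show ?thesis by (simp only:)
qed

section \<open>Relations of arbitrary length\<close>

definition level :: "(bpoint \<Rightarrow> int) \<Rightarrow> int \<Rightarrow> word set" where
  "level f c = {u. \<exists>p\<in>boundary n. pref p D = u \<and> f p = c}"

lemma level_iff:
  assumes "depth n D f" "p \<in> boundary n"
  shows "pref p D \<in> level f c \<longleftrightarrow> f p = c"
proof
  assume "pref p D \<in> level f c"
  then obtain q where q: "q \<in> boundary n" "pref q D = pref p D" "f q = c"
    unfolding level_def by blast
  from depthD[OF assms(1) q(1) assms(2) q(2)] q(3) show "f p = c" by simp
next
  assume "f p = c"
  with assms(2) show "pref p D \<in> level f c" unfolding level_def by blast
qed

lemma good_level: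
  assumes "depth n D f" "invariant f"
  shows "good (level f c)"
proof -
  have "level f c \<subseteq> sphere n D" unfolding level_def using pref_sphere by blast
  moreover have "pref p D \<in> level f c \<longleftrightarrow> pref q D \<in> level f c" if l: "(p, q) \<in> \<Lambda>" for p q
    using level_iff[OF assms(1) pattern_boundary(1)[OF l]] level_iff[OF assms(1) pattern_boundary(2)[OF l]]
      invariantD[OF assms(2) l] by simp
  ultimately show ?thesis unfolding good_def invariant_def by blast
qed

text \<open>If the longest group elements in the support of a relation have length \<open>Suc l\<close>, the coefficient
  function of such an element \<open>b # h\<close> still has depth \<open>D\<close> after translation by \<open>b\<close>: on the points
  in question all other terms have the same value.\<close>

lemma leading_term_depth:
  assumes T: "finite T" "\<And>h. h \<in> T \<Longrightarrow> h \<in> rwords n \<and> length h \<le> Suc l"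
    and f: "\<And>h. depth n D (f h)"
    and zero: "\<And>p. p \<in> boundary n \<Longrightarrow> (\<Sum>h\<in>T. f h (boundary_act n h p)) = (0::int)"
    and h0: "b # h0 \<in> T" "length h0 = l"
  shows "depth n D (\<lambda>q. f (b # h0) (boundary_act n [b] q))"
proof (rule depthI)
  fix q1 q2 assume q: "q1 \<in> boundary n" "q2 \<in> boundary n" "pref q1 D = pref q2 D"
  have bh: "b # h0 \<in> rwords n" using T(2)[OF h0(1)] by blast
  then have b: "[b] \<in> rwords n" and h0r: "h0 \<in> rwords n" by (auto simp: reduced_Cons)
  let ?s = "pref q2 D"
  have sne: "?s \<noteq> []" using D length_pref[OF q(2), of D] by auto
  have ab: "boundary_act n [b] q \<in> boundary n" if "q \<in> boundary n" for q
    by (rule boundary_act_closed[OF b that])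
  show "f (b # h0) (boundary_act n [b] q1) = f (b # h0) (boundary_act n [b] q2)"
  proof (cases "hd ?s = flip b")
    case False
    \<comment> \<open>Without cancellation \<open>b\<close> merely adds a letter, and the depth of
      the coefficient function itself is enough.\<close>
    have *: "pref (boundary_act n [b] q) (1 + D) = [b] @ ?s" if "q \<in> boundary n" "pref q D = ?s" for q
      using pref_act[OF that(1), of "[b]" D] that b False D sne pref_reduced[OF q(2), of D] by (simp add: reduced_Cons)
    have "pref (boundary_act n [b] q1) (1 + D) = pref (boundary_act n [b] q2) (1 + D)"
      using *[OF q(1,3)] *[OF q(2) refl] by simp
    from pref_mono[OF this ab[OF q(1)] ab[OF q(2)], of D] have "pref (boundary_act n [b] q1) D = pref (boundary_act n [b] q2) D"
      by simp
    then show ?thesis by (rule depthD[OF f ab[OF q(1)] ab[OF q(2)]])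
  next
    case True
    \<comment> \<open>At \<open>p q\<close> the element \<open>b # h0\<close> acts as
      \<open>b\<close> does at \<open>q\<close>. As \<open>q\<close> begins with
      \<open>flip b\<close>, the \<open>l + D\<close> known letters of \<open>p q\<close> begin with
      the inverse of \<open>b # h0\<close>.\<close>
    define p where "p = (\<lambda>q. boundary_act n (winv h0) q)"
    have wh0: "winv h0 \<in> rwords n" using h0r by simp
    have pb: "p q \<in> boundary n" if "q \<in> boundary n" for q
      unfolding p_def by (rule boundary_act_closed[OF wh0 that])
    obtain s' where s_eq: "?s = flip b # s'" using sne True by (cases ?s) auto
    let ?P = "winv h0 @ ?s"
    have rP: "reduced ?P"
    proof -
      have "reduced (winv (b # h0))" using bh by (simp only: reduced_winv) simp
      then have "reduced (winv h0 @ [flip b])" by (simp add: winv_Cons)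
      from reduced_append_nonempty[OF this, of s'] pref_reduced[OF q(2), of D] show ?thesis
        unfolding s_eq by simp
    qed
    have lP: "length ?P = l + D" using h0(2) q(2) by simp
    have prefp: "pref (p q) (l + D) = ?P" if "q \<in> boundary n" "pref q D = ?s" for q
      using pref_act[OF that(1), of "winv h0" D] wh0 rP that(2) D h0(2) by (simp add: p_def)
    have bact: "boundary_act n (b # h0) (p q) = boundary_act n [b] q" if "q \<in> boundary n" for q
    proof -
      have "reduce ((b # h0) @ winv h0) = [b]"
        using reduce_append_right[of "[b]" "h0 @ winv h0"] by (simp add: reduce_reduced)
      then show ?thesis unfolding p_def using boundary_act_mult[OF bh wh0 that] by simp
    qed
    have other: "f h (boundary_act n h (p q1)) = f h (boundary_act n h (p q2))" if h: "h \<in> T" "h \<noteq> b # h0" for h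
    proof -
      have hr: "h \<in> rwords n" "length h \<le> Suc l" using T(2)[OF h(1)] by auto
      obtain c x y where c: "winv h = c @ x" "?P = c @ y" "x = [] \<or> y = [] \<or> hd x \<noteq> hd y"
        by (rule common_prefix_split)
      have h_eq: "h = winv x @ winv c" using c(1) by (metis winv_simps(2,3))
      \<comment> \<open>An element of length at most \<open>Suc l\<close> that cancels
        \<open>Suc l\<close> letters of \<open>?P\<close> is the inverse of those letters, that is,
        \<open>b # h0\<close>. Every other one leaves at least \<open>D\<close> of the known
        letters, which fixes the value of its term.\<close>
      have lc: "length c \<le> l"
      proof (rule ccontr)
        assume "\<not> length c \<le> l"
        moreover have "length c + length x = length h" unfolding h_eq by simp
        ultimately have "length x = 0" and lc: "length c = Suc l" using hr(2) by linarith+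
        then have "x = []" by simp
        have "c = take (Suc l) ?P" unfolding c(2) using lc by simp
        also have "\<dots> = winv h0 @ [flip b]"
          unfolding s_eq using h0(2) by simp
        also have "\<dots> = winv (b # h0)" by (simp add: winv_Cons)
        finally have "winv h = winv (b # h0)" using c(1) \<open>x = []\<close> by simp
        then have "h = b # h0" by (metis winv_simps(3))
        with h(2) show False by blast
      qed
      have ly: "length c + length y = l + D" using lP unfolding c(2) by simp
      then have ly': "D \<le> length y" "length y > 0" using lc D by linarith+
      have cr: "winv c \<in> rwords n" "winv x \<in> rwords n" "reduced x" "reduced y"
      proof -
        have "winv x @ winv c \<in> rwords n" using hr(1) h_eq by simp
        then show "winv c \<in> rwords n" "winv x \<in> rwords n" "reduced x" by (auto simp: reduced_append)
        show "reduced y" using rP unfolding c(2) by (simp add: reduced_append)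
      qed
      have "pref (boundary_act n h (p q)) (length x + length y) = winv x @ y" if qq: "q \<in> boundary n" "pref q D = ?s" for q
      proof -
        let ?r = "boundary_act n (winv c) (p q)"
        have r: "?r \<in> boundary n" by (rule boundary_act_closed[OF cr(1) pb[OF qq(1)]])
        have "pref (p q) (length c + length y) = c @ y"
          using prefp[OF qq] ly c(2) by simp
        from pref_act_winv[OF pb[OF qq(1)] this] have ry: "pref ?r (length y) = y" .
        have "reduced (winv x @ y)" by (rule reduced_winv_append[OF cr(3,4) c(3)])
        then have "pref (boundary_act n (winv x) ?r) (length (winv x) + length y) = winv x @ y"
          using pref_act[OF r, of "winv x" "length y"] cr(2) ry ly'(2) by simp
        moreover have "boundary_act n (winv x) ?r = boundary_act n h (p q)"
          using boundary_act_mult[OF cr(2,1) pb[OF qq(1)]] hr(1) h_eq by (simp add: reduce_reduced)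
        ultimately show ?thesis by simp
      qed
      from this[OF q(1,3)] this[OF q(2) refl]
      have e: "pref (boundary_act n h (p q1)) (length x + length y) = pref (boundary_act n h (p q2)) (length x + length y)" by simp
      have hb: "boundary_act n h (p q1) \<in> boundary n" "boundary_act n h (p q2) \<in> boundary n"
        using boundary_act_closed(1)[OF hr(1)] pb q(1,2) by blast+
      have "pref (boundary_act n h (p q1)) D = pref (boundary_act n h (p q2)) D"
        by (rule pref_mono[OF e hb]) (use ly' in linarith)
      then show ?thesis by (rule depthD[OF f hb])
    qed
    \<comment> \<open>The whole sum is 0 at both points and the remaining terms agree, hence so do
      the leading ones.\<close>
    have split: "(\<Sum>h\<in>T. f h (boundary_act n h (p q))) =
      f (b # h0) (boundary_act n (b # h0) (p q)) + (\<Sum>h\<in>T - {b # h0}. f h (boundary_act n h (p q)))" for q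
      by (rule sum.remove[OF T(1) h0(1)])
    have "(\<Sum>h\<in>T - {b # h0}. f h (boundary_act n h (p q1))) = (\<Sum>h\<in>T - {b # h0}. f h (boundary_act n h (p q2)))"
      by (rule sum.cong[OF refl]) (use other in blast)
    then show ?thesis
      using split[of q1] split[of q2] zero[OF pb[OF q(1)]] zero[OF pb[OF q(2)]]
      unfolding bact[OF q(1)] bact[OF q(2)] by linarith
  qed
qed

definition coefficient :: "(nat \<Rightarrow> word \<Rightarrow> int) \<Rightarrow> word \<Rightarrow> bpoint \<Rightarrow> int" where
  "coefficient x h p = (\<Sum>i<k. x i h * of_bool (pref p D \<in> A i))"

lemma coefficient_depth: "depth n D (coefficient x h)"
  by (rule depthI) (simp add: coefficient_def)

lemma coefficient_invariant: "invariant (coefficient x h)"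
  unfolding invariant_def
proof (intro allI impI)
  fix p q assume l: "(p, q) \<in> \<Lambda>"
  have "pref p D \<in> A i \<longleftrightarrow> pref q D \<in> A i" if "i < k" for i
    by (rule invariantD[OF A_invariant[OF that] l])
  then show "coefficient x h p = coefficient x h q"
    unfolding coefficient_def by (intro sum.cong) simp_all
qed

lemma eval_coefficient:
  assumes "finite T" "{h. \<exists>i. x i h \<noteq> 0} \<subseteq> T"
  shows "eval x p = (\<Sum>h\<in>T. coefficient x h (boundary_act n h p))"
  unfolding coefficient_def by (rule eval_superset[OF assms])

lemma eval_sum:
  assumes "finite J" "\<And>j. j \<in> J \<Longrightarrow> X j \<in> carrier \<Phi>"
  shows "(\<lambda>i h. \<Sum>j\<in>J. X j i h) \<in> carrier \<Phi> \<and> eval (\<lambda>i h. \<Sum>j\<in>J. X j i h) p = (\<Sum>j\<in>J. eval (X j) p)"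
  using assms
proof (induction J rule: finite_induct)
  case empty
  then show ?case by (simp add: free_module_zero eval_zero)
next
  case (insert j J)
  have X: "X j \<in> carrier \<Phi>" and IH: "(\<lambda>i h. \<Sum>j\<in>J. X j i h) \<in> carrier \<Phi>"
    "eval (\<lambda>i h. \<Sum>j\<in>J. X j i h) p = (\<Sum>j\<in>J. eval (X j) p)"
    using insert by auto
  from free_module_add[OF X IH(1)] eval_add[OF X IH(1), of p] IH(2) show ?case
    by (simp only: sum.insert[OF insert.hyps])
qed

text \<open>The sum ranges over a superset \<open>C\<close> of the values of \<open>f\<close>, so that the same \<open>C\<close>
  serves two functions.\<close>

definition level_vector :: "int set \<Rightarrow> (bpoint \<Rightarrow> int) \<Rightarrow> nat \<Rightarrow> word \<Rightarrow> int" where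
  "level_vector C f i h = (\<Sum>c\<in>C. c * generator (level f c) i h)"

lemma level_vector:
  assumes f: "depth n D f" "invariant f" and C: "finite C" "f ` boundary n \<subseteq> C"
  shows "level_vector C f \<in> carrier \<Phi>" "p \<in> boundary n \<Longrightarrow> eval (level_vector C f) p = f p"
    "level_vector C f i h \<noteq> 0 \<Longrightarrow> h = []"
proof -
  note good = good_level[OF f]
  have c: "(\<lambda>i h. c * generator (level f c) i h) \<in> carrier \<Phi>" for c
    by (intro free_module_scale single_word_carrier idx(1) good) simp
  note s = eval_sum[OF C(1), of "\<lambda>c i h. c * generator (level f c) i h", OF c]
  have lv: "level_vector C f = (\<lambda>i h. \<Sum>c\<in>C. c * generator (level f c) i h)"
    by (intro ext) (rule level_vector_def)
  show "level_vector C f \<in> carrier \<Phi>"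
    unfolding lv by (rule s[THEN conjunct1])
  show "eval (level_vector C f) p = f p" if p: "p \<in> boundary n"
  proof -
    have "eval (level_vector C f) p = (\<Sum>c\<in>C. eval (\<lambda>i h. c * generator (level f c) i h) p)"
      unfolding lv by (rule s[THEN conjunct2])
    also have "\<dots> = (\<Sum>c\<in>C. c * of_bool (f p = c))"
    proof (rule sum.cong[OF refl])
      fix c
      have "eval (\<lambda>i h. c * generator (level f c) i h) p = c * eval (generator (level f c)) p"
        by (intro eval_scale single_word_carrier idx(1) good) simp
      also have "eval (generator (level f c)) p = of_bool (pref p D \<in> level f c)"
        using eval_single[OF idx(1)[OF good[of c]], of "[]" p] idx(2)[OF good[of c]] boundary_act_one[OF p] by simp
      finally show "eval (\<lambda>i h. c * generator (level f c) i h) p = c * of_bool (f p = c)"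
        unfolding level_iff[OF f(1) p] .
    qed
    also have "\<dots> = (\<Sum>c\<in>{f p}. c * of_bool (f p = c))"
      using p C by (intro sum.mono_neutral_right) auto
    finally show ?thesis by simp
  qed
  show "h = []" if "level_vector C f i h \<noteq> 0"
  proof (rule ccontr)
    assume "h \<noteq> []"
    then have "level_vector C f i h = 0"
      unfolding level_vector_def single_def by (intro sum.neutral) simp
    with that show False ..
  qed
qed

lemma act_word: "act \<Phi> x g i h = (if h \<in> rwords n then x i (h \<otimes>\<^bsub>free_group n\<^esub> inv\<^bsub>free_group n\<^esub> g) else 0)"
  by (simp only: free_right_module_simps(3) carrier_free_group)

text \<open>A level set of the translated function is the preimage of a level set of
  \<open>f\<close> under \<open>b\<close>. It is one of the enumerated sets because the translated
  function still has depth \<open>D\<close>, so a shift relator compares the two.\<close>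

lemma shift_level:
  assumes f: "depth n D f" "invariant f" and b: "fst b < n"
    and g: "depth n D (\<lambda>q. f (boundary_act n [b] q))"
  shows "(\<lambda>i h. single (idx (level f c)) [b] i h - generator (level (\<lambda>q. f (boundary_act n [b] q)) c) i h) \<in> span"
proof -
  let ?g = "\<lambda>q. f (boundary_act n [b] q)"
  have br: "[b] \<in> rwords n" using b by simp
  have gi: "invariant ?g"
    unfolding invariant_def using invariantD[OF f(2) pattern_act[OF _ br]] by blast
  note i = idx[OF good_level[OF f, of c]] and j = idx[OF good_level[OF g gi, of c]]
  have "take D (reduce (b # u)) \<in> level f c \<longleftrightarrow> take D u \<in> level ?g c" if u: "u \<in> sphere n (Suc D)" for u
  proof -
    obtain p where p: "p \<in> boundary n" "pref p (Suc D) = u"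
      by (rule sphere_pref[OF u]) auto
    have "take D (reduce (b # u)) = pref (boundary_act n [b] p) D"
      using boundary_act_closed(2)[OF br p(1), of D] p(2) by simp
    moreover have "take D u = pref p D" using take_pref[OF p(1), of D "Suc D"] p(2) by simp
    ultimately show ?thesis
      using level_iff[OF f(1) boundary_act_closed(1)[OF br p(1)], of c] level_iff[OF g p(1), of c] by simp
  qed
  then have *: "\<forall>u\<in>sphere n (Suc D). take D (reduce (b # u)) \<in> A (idx (level f c)) \<longleftrightarrow> take D u \<in> A (idx (level ?g c))"
    unfolding i(2) j(2) by blast
  have "(\<lambda>i h. single (idx (level f c)) [b] i h - generator (level ?g c) i h) \<in> shift_relators"
    unfolding shift_relators_def
    by (rule CollectI, rule exI[of _ "idx (level f c)"], rule exI[of _ "idx (level ?g c)"], rule exI[of _ b])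
      (intro conjI refl i(1) j(1) b *)
  then show ?thesis by (intro span_base) blast
qed

lemma mult_inv_eq_one:
  assumes "h' \<in> rwords n" "g \<in> rwords n"
  shows "h' \<otimes>\<^bsub>free_group n\<^esub> inv\<^bsub>free_group n\<^esub> g = [] \<longleftrightarrow> h' = g"
proof
  assume "h' \<otimes>\<^bsub>free_group n\<^esub> inv\<^bsub>free_group n\<^esub> g = []"
  then have "reduce (reduce (h' @ winv g) @ g) = reduce g"
    using inv_free_group[OF assms(2)] by simp
  then show "h' = g" using reduce_mult_winv(2)[of h' g] assms by (simp add: reduce_reduced)
next
  assume "h' = g"
  then show "h' \<otimes>\<^bsub>free_group n\<^esub> inv\<^bsub>free_group n\<^esub> g = []"
    using inv_free_group[OF assms(2)] by simp
qed

lemma act_unit_support: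
  assumes "\<And>i h. x i h \<noteq> 0 \<Longrightarrow> h = []" "g \<in> rwords n" "act \<Phi> x g i h \<noteq> 0"
  shows "h = g"
proof -
  have "(if h \<in> rwords n then x i (h \<otimes>\<^bsub>free_group n\<^esub> inv\<^bsub>free_group n\<^esub> g) else 0) \<noteq> 0"
    using assms(3) unfolding act_word .
  then have h: "h \<in> rwords n" "x i (h \<otimes>\<^bsub>free_group n\<^esub> inv\<^bsub>free_group n\<^esub> g) \<noteq> 0"
    by (simp_all split: if_split_asm del: mult_free_group)
  from assms(1)[OF h(2)] show ?thesis unfolding mult_inv_eq_one[OF h(1) assms(2)] .
qed

lemma act_diff: "act \<Phi> (\<lambda>i h. x i h - y i h) g = (\<lambda>i h. act \<Phi> x g i h - act \<Phi> y g i h)"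
proof (intro ext)
  fix i h
  show "act \<Phi> (\<lambda>i h. x i h - y i h) g i h = act \<Phi> x g i h - act \<Phi> y g i h"
    by (cases "h \<in> rwords n") (simp_all only: act_word if_True if_False diff_self)
qed

lemma act_level_vector:
  "act \<Phi> (level_vector C f) g i h = (\<Sum>c\<in>C. c * act \<Phi> (generator (level f c)) g i h)"
  by (cases "h \<in> rwords n") (simp_all only: act_word level_vector_def if_True if_False mult_zero_right sum.neutral_const)

text \<open>Modulo the relators, a term carried by \<open>b # h\<close> is moved to the shorter
  \<open>h\<close> at the price of translating its function by \<open>b\<close>.\<close>

lemma shift_level_vector:
  assumes f: "depth n D f" "invariant f" and h: "b # h \<in> rwords n"
    and g: "depth n D (\<lambda>q. f (boundary_act n [b] q))"
    and C: "finite C"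
  shows "(\<lambda>i h'. act \<Phi> (level_vector C f) (b # h) i h' -
    act \<Phi> (level_vector C (\<lambda>q. f (boundary_act n [b] q))) h i h') \<in> span"
proof -
  let ?lf = "\<lambda>c. level f c" and ?lg = "\<lambda>c. level (\<lambda>q. f (boundary_act n [b] q)) c"
  have hc: "h \<in> carrier (free_group n)" "[b] \<in> carrier (free_group n)" "b # h \<in> carrier (free_group n)" "fst b < n"
    using h by (auto simp: reduced_Cons)
  have rel: "(\<lambda>i h'. act \<Phi> (generator (?lf c)) (b # h) i h' - act \<Phi> (generator (?lg c)) h i h') \<in> span" for c
  proof -
    have "act \<Phi> (single (idx (?lf c)) [b]) h = single (idx (?lf c)) (b # h)"
      using act_single[OF group_free_group hc(2,1), of k "idx (?lf c)"] h unfolding mult_free_group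
      by (simp add: reduce_reduced del: free_right_module_simps)
    moreover have "act \<Phi> (generator (?lf c)) (b # h) = single (idx (?lf c)) (b # h)"
      using act_single[OF group_free_group _ hc(3), of "[]" k "idx (?lf c)"] h unfolding mult_free_group
      by (simp add: reduce_reduced del: free_right_module_simps)
    ultimately show ?thesis
      using span_act[OF shift_level[OF f hc(4) g, of c] hc(1)] unfolding act_diff by (simp only:)
  qed
  have "(\<lambda>i h'. \<Sum>c\<in>C. c * (act \<Phi> (generator (?lf c)) (b # h) i h' - act \<Phi> (generator (?lg c)) h i h')) \<in> span"
    by (intro span_sum[OF C] span_scale rel)
  then show ?thesis
    unfolding act_level_vector right_diff_distrib sum_subtractf .
qed

definition slice :: "(nat \<Rightarrow> word \<Rightarrow> int) \<Rightarrow> word \<Rightarrow> nat \<Rightarrow> word \<Rightarrow> int" where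
  "slice x h = (\<lambda>i h'. if h' = h then x i h else 0)"

text \<open>Moved to the identity, the slice and the level vector evaluate to the same function, so
  \<open>kernel_unit\<close> puts their difference in \<open>span\<close>; acting by
  \<open>h\<close> moves it back.\<close>

lemma slice_level_vector:
  assumes x: "x \<in> carrier \<Phi>" and h: "h \<in> rwords n"
    and C: "finite C" "coefficient x h ` boundary n \<subseteq> C"
  shows "(\<lambda>i h'. slice x h i h' - act \<Phi> (level_vector C (coefficient x h)) h i h') \<in> span"
proof -
  let ?f = "coefficient x h"
  let ?z = "\<lambda>i (h' :: word). if h' = [] then x i h else 0"
  note lf = level_vector[OF coefficient_depth[of x h] coefficient_invariant[of x h] C]
  have zs: "{h'. \<exists>i. ?z i h' \<noteq> 0} \<subseteq> {[]}" by auto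
  have zc: "?z \<in> carrier \<Phi>"
    unfolding free_module_carrier_iff
  proof (intro conjI allI impI)
    show "finite {h'. \<exists>i. ?z i h' \<noteq> 0}" by (rule finite_subset[OF zs]) simp
    fix i h' assume "?z i h' \<noteq> 0"
    then have "h' = []" "x i h \<noteq> 0" by (auto split: if_split_asm)
    then show "i < k" "h' \<in> carrier (free_group n)" using free_module_support(2)[OF x] by auto
  qed
  have ze: "eval ?z p = ?f p" if "p \<in> boundary n" for p
    using eval_superset[OF _ zs, of p] boundary_act_one[OF that] by (simp add: coefficient_def)
  have "(\<lambda>i h'. ?z i h' - level_vector C ?f i h') \<in> span"
  proof (rule kernel_unit)
    show "(\<lambda>i h'. ?z i h' - level_vector C ?f i h') \<in> carrier \<Phi>"
      using free_module_add[OF zc free_module_uminus[OF lf(1)]] by simp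
    show "h' = []" if "?z i h' - level_vector C ?f i h' \<noteq> 0" for i h'
    proof (rule ccontr)
      assume ne: "h' \<noteq> []"
      with lf(3)[of i h'] have "level_vector C ?f i h' = 0" by blast
      with that ne show False by simp
    qed
    show "eval (\<lambda>i h'. ?z i h' - level_vector C ?f i h') p = 0" if "p \<in> boundary n" for p
      using eval_diff[OF zc lf(1), of p] ze[OF that] lf(2)[OF that] by simp
  qed
  from span_act[OF this, of h]
  have "(\<lambda>i h'. act \<Phi> ?z h i h' - act \<Phi> (level_vector C ?f) h i h') \<in> span"
    unfolding act_diff using h by (simp only: carrier_free_group simp_thms)
  moreover have "act \<Phi> ?z h i h' = slice x h i h'" for i h'
  proof (cases "h' \<in> rwords n")
    case True
    then show ?thesis
      unfolding act_word slice_def mult_inv_eq_one[OF True h] by (simp only: if_True)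
  next
    case False
    then have "h' \<noteq> h" using h by blast
    with False show ?thesis unfolding act_word slice_def by (simp only: if_False)
  qed
  ultimately show ?thesis by (simp only:)
qed

lemma reduce_support_length:
  assumes x: "x \<in> carrier \<Phi>" and zero: "\<And>p. p \<in> boundary n \<Longrightarrow> eval x p = 0"
    and len: "\<And>i h. x i h \<noteq> 0 \<Longrightarrow> length h \<le> Suc l"
  shows "\<exists>y\<in>span. \<forall>i h. x i h - y i h \<noteq> 0 \<longrightarrow> length h \<le> l"
proof -
  define T where "T = {h. \<exists>i. x i h \<noteq> 0}"
  have T: "finite T" "h \<in> T \<Longrightarrow> h \<in> rwords n \<and> length h \<le> Suc l" for h
  proof -
    show "finite T" unfolding T_def by (rule free_module_support(1)[OF x])
    assume "h \<in> T"
    then obtain i where "x i h \<noteq> 0" unfolding T_def by blast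
    with free_module_support(3)[OF x this] len[OF this] show "h \<in> rwords n \<and> length h \<le> Suc l"
      by simp
  qed
  define L where "L = {h \<in> T. length h = Suc l}"
  have finL: "finite L" unfolding L_def using T(1) by simp
  let ?f = "coefficient x"
  let ?g = "\<lambda>h q. ?f h (boundary_act n [hd h] q)"
  have L: "hd h # tl h = h" "length (tl h) = l" "h \<in> T" "h \<in> rwords n" "tl h \<in> rwords n" "[hd h] \<in> rwords n"
    if "h \<in> L" for h
  proof -
    show "h \<in> T" and hr: "h \<in> rwords n" using that T(2) unfolding L_def by blast+
    have ne: "h \<noteq> []" using that unfolding L_def by auto
    then show h: "hd h # tl h = h" by simp
    show "length (tl h) = l" using that unfolding L_def by simp
    have "hd h # tl h \<in> rwords n" using hr unfolding h .
    then show "tl h \<in> rwords n" "[hd h] \<in> rwords n" by (auto simp: reduced_Cons)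
  qed
  have sum_zero: "(\<Sum>h\<in>T. ?f h (boundary_act n h p)) = 0" if "p \<in> boundary n" for p
    using eval_coefficient[OF T(1), of x p] zero[OF that] unfolding T_def by simp
  have gd: "depth n D (?g h)" if h: "h \<in> L" for h
    using leading_term_depth[where f = "coefficient x" and b = "hd h" and ?h0.0 = "tl h",
        OF T coefficient_depth sum_zero] L(2,3)[OF h] unfolding L(1)[OF h] by blast
  have gi: "invariant (?g h)" if h: "h \<in> L" for h
    unfolding invariant_def using invariantD[OF coefficient_invariant pattern_act[OF _ L(6)[OF h]]] by blast
  define C where "C = (\<lambda>h. ?f h ` boundary n)"
  \<comment> \<open>The substitute for the slice at \<open>h\<close>: modulo \<open>span\<close> the
    same element, but supported at the shorter word \<open>tl h\<close>.\<close>
  define Y where "Y = (\<lambda>h. act \<Phi> (level_vector (C h) (?g h)) (tl h))"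
  have finC: "finite (C h)" for h unfolding C_def by (rule depth_finite_range[OF coefficient_depth])
  have subC: "?g h ` boundary n \<subseteq> C h" if "h \<in> L" for h
    unfolding C_def using boundary_act_closed(1)[OF L(6)[OF that]] by blast
  have Y: "h' = tl h" if "h \<in> L" "Y h i h' \<noteq> 0" for h i h'
  proof -
    have "h' = []" if "level_vector (C h) (?g h) i h' \<noteq> 0" for i h'
      by (rule level_vector(3)[OF gd[OF \<open>h \<in> L\<close>] gi[OF \<open>h \<in> L\<close>] finC subC[OF \<open>h \<in> L\<close>] that])
    from act_unit_support[where x = "level_vector (C h) (?g h)", OF this L(5)[OF that(1)] that(2)[unfolded Y_def]]
    show ?thesis .
  qed
  have piece: "(\<lambda>i h'. slice x h i h' - Y h i h') \<in> span" if h: "h \<in> L" for h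
  proof -
    have "hd h # tl h \<in> rwords n" using L(4)[OF h] unfolding L(1)[OF h] .
    from shift_level_vector[OF coefficient_depth coefficient_invariant this gd[OF h] finC[of h]]
    have "(\<lambda>i h'. act \<Phi> (level_vector (C h) (?f h)) h i h' - Y h i h') \<in> span"
      unfolding L(1)[OF h] Y_def .
    moreover have "(\<lambda>i h'. slice x h i h' - act \<Phi> (level_vector (C h) (?f h)) h i h') \<in> span"
      by (rule slice_level_vector[OF x L(4)[OF h] finC]) (simp add: C_def)
    ultimately have sp: "(\<lambda>i h'. (slice x h i h' - act \<Phi> (level_vector (C h) (?f h)) h i h') +
        (act \<Phi> (level_vector (C h) (?f h)) h i h' - Y h i h')) \<in> span"
      by (intro span_add)
    have eq: "(slice x h i h' - act \<Phi> (level_vector (C h) (?f h)) h i h') +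
        (act \<Phi> (level_vector (C h) (?f h)) h i h' - Y h i h') = slice x h i h' - Y h i h'" for i h'
      by linarith
    show ?thesis using sp unfolding eq .
  qed
  show ?thesis
  proof (rule bexI)
    show "(\<lambda>i h'. \<Sum>h\<in>L. slice x h i h' - Y h i h') \<in> span"
      by (rule span_sum[OF finL piece])
    show "\<forall>i h'. x i h' - (\<Sum>h\<in>L. slice x h i h' - Y h i h') \<noteq> 0 \<longrightarrow> length h' \<le> l"
    proof (intro allI impI, rule ccontr)
      fix i h' assume ne: "x i h' - (\<Sum>h\<in>L. slice x h i h' - Y h i h') \<noteq> 0" and "\<not> length h' \<le> l"
      then have len': "length h' > l" by simp
      have "Y h i h' = 0" if "h \<in> L" for h
      proof (rule ccontr)
        assume "Y h i h' \<noteq> 0"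
        from Y[OF that this] L(2)[OF that] len' show False by simp
      qed
      then have eq: "(\<Sum>h\<in>L. slice x h i h' - Y h i h') = (\<Sum>h\<in>L. slice x h i h')"
        by (intro sum.cong) simp_all
      show False
      proof (cases "h' \<in> L")
        case True
        have "(\<Sum>h\<in>L. slice x h i h') = (\<Sum>h\<in>{h'}. slice x h i h')"
          using True finL by (intro sum.mono_neutral_right) (auto simp: slice_def)
        with ne eq show False by (simp add: slice_def)
      next
        case False
        have "x i h' = 0"
        proof (rule ccontr)
          assume "x i h' \<noteq> 0"
          with len[OF this] len' False show False unfolding L_def T_def by auto
        qed
        moreover have "(\<Sum>h\<in>L. slice x h i h') = 0"
          using False by (intro sum.neutral) (auto simp: slice_def)
        ultimately show False using ne eq by simp
      qed
    qed
  qed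
qed

text \<open>Subtracting elements of \<open>span\<close> shortens the longest group elements step by
  step until only the identity is left, where \<open>kernel_unit\<close> applies.\<close>

lemma kernel_span:
  assumes "x \<in> carrier \<Phi>" "\<And>p. p \<in> boundary n \<Longrightarrow> eval x p = 0"
  shows "x \<in> span"
proof -
  have *: "x \<in> span" if "x \<in> carrier \<Phi>" "\<And>p. p \<in> boundary n \<Longrightarrow> eval x p = 0"
    "\<And>i h. x i h \<noteq> 0 \<Longrightarrow> length h \<le> l" for x l
    using that
  proof (induction l arbitrary: x)
    case 0
    have "h = []" if "x i h \<noteq> 0" for i h
      using 0(3)[OF that] by simp
    from kernel_unit[OF 0(1) this 0(2)] show ?case .
  next
    case (Suc l)
    have "\<exists>y\<in>span. \<forall>i h. x i h - y i h \<noteq> 0 \<longrightarrow> length h \<le> l"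
      by (rule reduce_support_length[where x = x]) (fact Suc.prems)+
    then obtain y where y: "y \<in> span" "\<And>i h. x i h - y i h \<noteq> 0 \<Longrightarrow> length h \<le> l"
      by blast
    have yc: "y \<in> carrier \<Phi>" by (rule span_carrier[OF y(1)])
    have "(\<lambda>i h. x i h - y i h) \<in> span"
    proof (rule Suc.IH)
      show "(\<lambda>i h. x i h - y i h) \<in> carrier \<Phi>"
        using free_module_add[OF Suc.prems(1) free_module_uminus[OF yc]] by simp
      show "eval (\<lambda>i h. x i h - y i h) p = 0" if "p \<in> boundary n" for p
        using eval_diff[OF Suc.prems(1) yc, of p] Suc.prems(2)[OF that] eval_span[OF y(1) that] by simp
    qed (rule y(2))
    from span_add[OF this y(1)] show ?case by simp
  qed
  have fin: "finite {h. \<exists>i. x i h \<noteq> 0}" by (rule free_module_support(1)[OF assms(1)])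
  let ?l = "Max (insert 0 (length ` {h. \<exists>i. x i h \<noteq> 0}))"
  have "length h \<le> ?l" if "x i h \<noteq> 0" for i h
    using fin that by (intro Max_ge finite.insertI finite_imageI insertI2 imageI) blast+
  from *[OF assms this] show ?thesis .
qed

end

section \<open>Functions on the decomposition space\<close>

context presentation begin

lemma eval_invariant:
  assumes "x \<in> carrier \<Phi>"
  shows "invariant (eval x)"
  unfolding invariant_def
proof (intro allI impI)
  fix p q assume l: "(p, q) \<in> \<Lambda>"
  let ?T = "{h. \<exists>i. x i h \<noteq> 0}"
  have fin: "finite ?T" by (rule free_module_support(1)[OF assms])
  have "coefficient x h (boundary_act n h p) = coefficient x h (boundary_act n h q)" if "h \<in> ?T" for h
  proof -
    have "h \<in> rwords n" using that free_module_support(3)[OF assms] by auto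
    from invariantD[OF coefficient_invariant pattern_act[OF l this]] show ?thesis .
  qed
  then show "eval x p = eval x q"
    unfolding eval_coefficient[OF fin order_refl] by (rule sum.cong[OF refl])
qed

lemma eval_depth:
  assumes "x \<in> carrier \<Phi>"
  shows "\<exists>N. depth n N (eval x)"
proof -
  let ?T = "{h. \<exists>i. x i h \<noteq> 0}"
  have fin: "finite ?T" by (rule free_module_support(1)[OF assms])
  define M where "M = Max (insert 0 (length ` ?T))"
  have "depth n (D + M) (eval x)"
  proof (rule depthI)
    fix p q assume pq: "p \<in> boundary n" "q \<in> boundary n" "pref p (D + M) = pref q (D + M)"
    have "coefficient x h (boundary_act n h p) = coefficient x h (boundary_act n h q)" if h: "h \<in> ?T" for h
    proof -
      have hr: "h \<in> rwords n" using h free_module_support(3)[OF assms] by auto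
      have "length h \<le> M" unfolding M_def using fin h by (intro Max_ge finite.insertI finite_imageI insertI2 imageI)
      then have "pref p (D + length h) = pref q (D + length h)"
        by (intro pref_mono[OF pq(3,1,2)]) simp
      then have "pref (boundary_act n h p) D = pref (boundary_act n h q) D"
        unfolding boundary_act_closed(2)[OF hr pq(1)] boundary_act_closed(2)[OF hr pq(2)] by simp
      from depthD[OF coefficient_depth boundary_act_closed(1)[OF hr pq(1)] boundary_act_closed(1)[OF hr pq(2)] this]
      show ?thesis .
    qed
    then show "eval x p = eval x q"
      unfolding eval_coefficient[OF fin order_refl] by (rule sum.cong[OF refl])
  qed
  then show ?thesis ..
qed

lemma eval_surjective:
  assumes T: "\<And>a. fst a < n \<Longrightarrow> traces (Suc R) a \<subseteq> traces R a" and D_eq: "D = Suc R"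
    and f: "depth n N f" "invariant f"
  shows "\<exists>x\<in>carrier \<Phi>. \<forall>p\<in>boundary n. eval x p = f p"
proof (rule generation[where H = "\<lambda>f. \<exists>x\<in>carrier \<Phi>. \<forall>p\<in>boundary n. eval x p = f p" and R = R])
  show "\<exists>x\<in>carrier \<Phi>. \<forall>p\<in>boundary n. eval x p = 0"
    using free_module_zero eval_zero by blast
next
  fix f g :: "bpoint \<Rightarrow> int"
  assume "\<exists>x\<in>carrier \<Phi>. \<forall>p\<in>boundary n. eval x p = f p" "\<exists>x\<in>carrier \<Phi>. \<forall>p\<in>boundary n. eval x p = g p"
  then obtain x y where x: "x \<in> carrier \<Phi>" "\<forall>p\<in>boundary n. eval x p = f p"
    and y: "y \<in> carrier \<Phi>" "\<forall>p\<in>boundary n. eval y p = g p" by blast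
  show "\<exists>x\<in>carrier \<Phi>. \<forall>p\<in>boundary n. eval x p = f p + g p"
    using eval_add[OF x(1) y(1)] x(2) y(2)
    by (intro bexI[OF _ free_module_add[OF x(1) y(1)]]) simp
next
  fix f :: "bpoint \<Rightarrow> int" and h assume h: "h \<in> rwords n" and "\<exists>x\<in>carrier \<Phi>. \<forall>p\<in>boundary n. eval x p = f p"
  then obtain x where x: "x \<in> carrier \<Phi>" "\<forall>p\<in>boundary n. eval x p = f p" by blast
  have "act \<Phi> x h \<in> carrier \<Phi>" by (rule free_module_act[OF group_free_group x(1)]) (simp add: h[simplified])
  moreover have "\<forall>p\<in>boundary n. eval (act \<Phi> x h) p = f (boundary_act n h p)"
    using eval_act[OF x(1) h] x(2) boundary_act_closed(1)[OF h] by (simp del: free_right_module_simps)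
  ultimately show "\<exists>x\<in>carrier \<Phi>. \<forall>p\<in>boundary n. eval x p = f (boundary_act n h p)" by blast
next
  fix f :: "bpoint \<Rightarrow> int" assume f: "depth n (Suc R) f" "invariant f"
  note lv = level_vector[OF f[folded D_eq] depth_finite_range[OF f(1)] order_refl]
  show "\<exists>x\<in>carrier \<Phi>. \<forall>p\<in>boundary n. eval x p = f p"
    using lv(1,2) by blast
next
  fix f g :: "bpoint \<Rightarrow> int"
  assume "\<And>p. p \<in> boundary n \<Longrightarrow> f p = g p" "\<exists>x\<in>carrier \<Phi>. \<forall>p\<in>boundary n. eval x p = f p"
  then show "\<exists>x\<in>carrier \<Phi>. \<forall>p\<in>boundary n. eval x p = g p" by simp
qed (fact T f)+

end

text \<open>Surjectivity enters as an assumption, which separates the topology of the quotient from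
  the choice of the depth.\<close>

locale decomposition = presentation +
  fixes ws :: "word list"
  assumes pattern_lines: "\<Lambda> = line_pattern n ws \<union> (line_pattern n ws)\<inverse>"
    and eval_onto: "depth n N f \<Longrightarrow> invariant f \<Longrightarrow> \<exists>x\<in>carrier \<Phi>. \<forall>p\<in>boundary n. eval x p = f p"
begin

abbreviation "X \<equiv> decomposition_space n ws"
abbreviation "R \<equiv> decomp_rel n ws"

lemma openin_X: "openin X U \<longleftrightarrow> U \<subseteq> boundary n // R \<and> openin (boundary_topology n) (\<Union>U)"
proof -
  have "istopology (\<lambda>U. U \<subseteq> topspace (boundary_topology n) // R \<and> openin (boundary_topology n) (\<Union>U))"
    by (rule istopology_quotient) (simp add: equiv_decomp_rel)
  then show ?thesis
    unfolding decomposition_space_def quotient_topology_def by (simp add: topology_inverse')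
qed

lemma topspace_X: "topspace X = boundary n // R"
proof
  show "topspace X \<subseteq> boundary n // R"
    using openin_X[of "topspace X"] by simp
  have "\<Union>(boundary n // R) = boundary n" by (rule Union_quotient[OF equiv_decomp_rel])
  then have "openin X (boundary n // R)"
    unfolding openin_X using openin_topspace[of "boundary_topology n"] by simp
  then show "boundary n // R \<subseteq> topspace X" by (rule openin_subset)
qed

lemma rel_iff: "(p, q) \<in> R \<longleftrightarrow> (p, q) \<in> \<Lambda>\<^sup>* \<and> p \<in> boundary n \<and> q \<in> boundary n"
  unfolding decomp_rel_def pattern_lines by blast

lemma invariant_rel:
  assumes "invariant f" "(p, q) \<in> R"
  shows "f p = f q"
proof -
  have "(p, q) \<in> \<Lambda>\<^sup>*" using assms(2) unfolding rel_iff by blast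
  then show ?thesis
  proof (induction rule: rtrancl_induct)
    case (step y z)
    with invariantD[OF assms(1) step(2)] show ?case by simp
  qed simp
qed

lemma rel_act:
  assumes "(p, q) \<in> R" "g \<in> rwords n"
  shows "(boundary_act n g p, boundary_act n g q) \<in> R"
proof -
  have "(p, q) \<in> \<Lambda>\<^sup>*" and pq: "p \<in> boundary n" "q \<in> boundary n" using assms(1) unfolding rel_iff by blast+
  from this(1) have "(boundary_act n g p, boundary_act n g q) \<in> \<Lambda>\<^sup>*"
  proof (induction rule: rtrancl_induct)
    case (step y z)
    from step(3) pattern_act[OF step(2) assms(2)] show ?case by (rule rtrancl.rtrancl_into_rtrancl)
  qed simp
  with boundary_act_closed(1)[OF assms(2)] pq show ?thesis unfolding rel_iff by blast
qed

lemma classE: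
  assumes "P \<in> boundary n // R"
  obtains p where "p \<in> P" "p \<in> boundary n" "P = R `` {p}"
proof -
  from assms obtain p where p: "p \<in> boundary n" "P = R `` {p}" by (rule quotientE)
  moreover have "p \<in> P" using p equiv_class_self[OF equiv_decomp_rel] by blast
  ultimately show ?thesis using that by blast
qed

lemma class_of:
  assumes "p \<in> boundary n"
  shows "R `` {p} \<in> boundary n // R" "p \<in> R `` {p}"
  using assms by (rule quotientI, intro equiv_class_self[OF equiv_decomp_rel])

lemma class_member:
  assumes "P \<in> boundary n // R" "p \<in> P"
  shows "p \<in> boundary n \<and> P = R `` {p}"
proof -
  obtain q where q: "P = R `` {q}" using assms(1) by (rule classE)
  with assms(2) have l: "(q, p) \<in> R" by blast
  then have "p \<in> boundary n" unfolding rel_iff by blast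
  with equiv_class_eq[OF equiv_decomp_rel l] q show ?thesis by simp
qed

text \<open>For invariant \<open>f\<close> any member of the class gives the same value; the default
  0 agrees with the convention of \<open>lc_functions\<close>.\<close>

definition descend :: "(bpoint \<Rightarrow> int) \<Rightarrow> bpoint set \<Rightarrow> int" where
  "descend f P = (if P \<in> boundary n // R then f (SOME p. p \<in> P) else 0)"

lemma descend_eq:
  assumes "invariant f" "P \<in> boundary n // R" "p \<in> P"
  shows "descend f P = f p"
proof -
  have s: "(SOME q. q \<in> P) \<in> P" by (rule someI[of _ p]) (rule assms(3))
  have "P = R `` {p}" using class_member[OF assms(2,3)] by blast
  with s have "(p, SOME q. q \<in> P) \<in> R" by blast
  from invariant_rel[OF assms(1) this] assms(2) show ?thesis by (simp add: descend_def)
qed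

lemma descend_lc:
  assumes f: "depth n N f" "invariant f"
  shows "descend f \<in> lc_functions X"
proof -
  have "openin X {P \<in> topspace X. descend f P = z}" for z
  proof -
    have eq: "\<Union>{P \<in> boundary n // R. descend f P = z} = {p \<in> boundary n. f p \<in> {z}}"
    proof (intro Set.set_eqI iffI)
      fix p assume "p \<in> \<Union>{P \<in> boundary n // R. descend f P = z}"
      then obtain P where P: "P \<in> boundary n // R" "descend f P = z" "p \<in> P"
        by (elim UnionE CollectE conjE)
      have "f p = z" using descend_eq[OF f(2) P(1,3)] P(2) by simp
      with class_member[OF P(1,3)] show "p \<in> {p \<in> boundary n. f p \<in> {z}}" by simp
    next
      fix p assume p: "p \<in> {p \<in> boundary n. f p \<in> {z}}"
      then have pb: "p \<in> boundary n" by blast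
      note P = class_of[OF pb]
      have "descend f (R `` {p}) = z" using descend_eq[OF f(2) P] p by simp
      with P(1) have "R `` {p} \<in> {P \<in> boundary n // R. descend f P = z}" by simp
      with P(2) show "p \<in> \<Union>{P \<in> boundary n // R. descend f P = z}" by (rule UnionI[rotated])
    qed
    show ?thesis
      unfolding openin_X topspace_X eq by (rule conjI[OF _ depth_openin[OF f(1)]]) (rule Collect_subset)
  qed
  moreover have "descend f P = 0" if "P \<notin> topspace X" for P
    using that unfolding topspace_X descend_def by simp
  ultimately show ?thesis unfolding lc_functions_def by simp
qed

text \<open>The pullback to the boundary is locally constant by the definition of the quotient
  topology, and compactness turns this into a finite depth. It is invariant since the ends of a line
  lie in one class.\<close>

lemma lc_descend:
  assumes F: "F \<in> lc_functions X"
  obtains f N where "depth n N f" "invariant f" "descend f = F"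
proof -
  define f where "f = (\<lambda>p. F (R `` {p}))"
  have "openin (boundary_topology n) {p \<in> boundary n. f p = z}" for z
  proof -
    have "{p \<in> boundary n. f p = z} = \<Union>{P \<in> boundary n // R. F P = z}"
    proof (intro Set.set_eqI iffI)
      fix p assume "p \<in> \<Union>{P \<in> boundary n // R. F P = z}"
      then obtain P where P: "P \<in> boundary n // R" "F P = z" "p \<in> P"
        by (elim UnionE CollectE conjE)
      have "f p = z" unfolding f_def using class_member[OF P(1,3)] P(2) by simp
      with class_member[OF P(1,3)] show "p \<in> {p \<in> boundary n. f p = z}" by simp
    next
      fix p assume p: "p \<in> {p \<in> boundary n. f p = z}"
      then have pb: "p \<in> boundary n" by blast
      have "F (R `` {p}) = z" using p by (simp add: f_def)
      with class_of(1)[OF pb] have "R `` {p} \<in> {P \<in> boundary n // R. F P = z}" by simp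
      with class_of(2)[OF pb] show "p \<in> \<Union>{P \<in> boundary n // R. F P = z}" by (rule UnionI[rotated])
    qed
    moreover have "openin X {P \<in> topspace X. F P = z}" using F unfolding lc_functions_def by simp
    ultimately show ?thesis unfolding openin_X topspace_X by (simp only:)
  qed
  from locally_constant_depth[OF this] obtain N where N: "depth n N f" by blast
  have inv: "invariant f"
    unfolding invariant_def
  proof (intro allI impI)
    fix p q assume l: "(p, q) \<in> \<Lambda>"
    then have "(p, q) \<in> R" using pattern_boundary[OF l] unfolding rel_iff by blast
    then show "f p = f q" unfolding f_def by (intro arg_cong[of _ _ F] equiv_class_eq[OF equiv_decomp_rel])
  qed
  have "descend f P = F P" for P
  proof (cases "P \<in> boundary n // R")
    case True
    then obtain p where p: "p \<in> P" "P = R `` {p}" by (rule classE)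
    show ?thesis using descend_eq[OF inv True p(1)] p(2) by (simp add: f_def)
  next
    case False
    with F show ?thesis unfolding lc_functions_def topspace_X by (simp add: descend_def)
  qed
  then have "descend f = F" by (rule ext)
  from that[OF N inv this] show ?thesis .
qed

text \<open>The image of a class is a whole class because the inverse preserves the relation as
  well.\<close>

lemma decomp_act_class:
  assumes g: "g \<in> rwords n" and p: "p \<in> boundary n"
  shows "decomp_act n g (R `` {p}) = R `` {boundary_act n g p}"
proof (intro Set.set_eqI iffI)
  fix q assume "q \<in> decomp_act n g (R `` {p})"
  then obtain r where "(p, r) \<in> R" "q = boundary_act n g r" unfolding decomp_act_def by blast
  with rel_act[OF _ g] show "q \<in> R `` {boundary_act n g p}" by blast
next
  fix q assume "q \<in> R `` {boundary_act n g p}"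
  then have l: "(boundary_act n g p, q) \<in> R" by blast
  then have q: "q \<in> boundary n" unfolding rel_iff by blast
  have g': "winv g \<in> rwords n" using g by simp
  from rel_act[OF l g'] have "(p, boundary_act n (winv g) q) \<in> R"
    unfolding boundary_act_winv(2)[OF g p] .
  moreover have "q = boundary_act n g (boundary_act n (winv g) q)"
    by (rule boundary_act_winv(1)[OF g q, symmetric])
  ultimately show "q \<in> decomp_act n g (R `` {p})" unfolding decomp_act_def by blast
qed

lemma descend_act:
  assumes g: "g \<in> rwords n" and f: "invariant f"
  shows "(\<lambda>P. if P \<in> topspace X then descend f (decomp_act n g P) else 0) = descend (\<lambda>p. f (boundary_act n g p))"
    "decomp_act n g ` topspace X \<subseteq> topspace X"
proof -
  have fg: "invariant (\<lambda>p. f (boundary_act n g p))"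
    unfolding invariant_def using invariantD[OF f pattern_act[OF _ g]] by blast
  have cl: "decomp_act n g P \<in> boundary n // R \<and> boundary_act n g p \<in> decomp_act n g P"
    if "P \<in> boundary n // R" "p \<in> P" for P p
  proof -
    from class_member[OF that] have p: "p \<in> boundary n" and P: "P = R `` {p}" by blast+
    have e: "decomp_act n g P = R `` {boundary_act n g p}" unfolding P by (rule decomp_act_class[OF g p])
    have "boundary_act n g p \<in> boundary n" using boundary_act_closed(1)[OF g] p by blast
    then show ?thesis unfolding e by (intro conjI class_of)
  qed
  show "(\<lambda>P. if P \<in> topspace X then descend f (decomp_act n g P) else 0) = descend (\<lambda>p. f (boundary_act n g p))"
  proof
    fix P
    show "(if P \<in> topspace X then descend f (decomp_act n g P) else 0) = descend (\<lambda>p. f (boundary_act n g p)) P"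
    proof (cases "P \<in> boundary n // R")
      case True
      then obtain p where p: "p \<in> P" by (rule classE)
      from descend_eq[OF f cl[OF True p, THEN conjunct1] cl[OF True p, THEN conjunct2]] descend_eq[OF fg True p] True
      show ?thesis unfolding topspace_X by simp
    next
      case False
      then show ?thesis unfolding topspace_X descend_def by simp
    qed
  qed
  show "decomp_act n g ` topspace X \<subseteq> topspace X"
    unfolding topspace_X
  proof
    fix Q assume "Q \<in> decomp_act n g ` (boundary n // R)"
    then obtain P where P: "P \<in> boundary n // R" "Q = decomp_act n g P" by blast
    obtain p where "p \<in> P" by (rule classE[OF P(1)])
    from cl[OF P(1) this] P(2) show "Q \<in> boundary n // R" by blast
  qed
qed

section \<open>The isomorphism\<close>

definition realize :: "(nat \<Rightarrow> word \<Rightarrow> int) \<Rightarrow> bpoint set cech_class" where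
  "realize x = cech_class X (descend (eval x))"

lemma descend_eval_lc: "x \<in> carrier \<Phi> \<Longrightarrow> descend (eval x) \<in> lc_functions X"
  using eval_depth eval_invariant descend_lc by blast

lemma descend_add: "descend (\<lambda>p. f p + g p) P = descend f P + descend g P"
  by (simp add: descend_def)

lemma descend_cong: "(\<And>p. p \<in> boundary n \<Longrightarrow> f p = g p) \<Longrightarrow> descend f = descend g"
proof
  fix P assume eq: "\<And>p. p \<in> boundary n \<Longrightarrow> f p = g p"
  show "descend f P = descend g P"
  proof (cases "P \<in> boundary n // R")
    case True
    then obtain p where "p \<in> P" by (rule classE)
    then have "(SOME p. p \<in> P) \<in> P" by (rule someI[of "\<lambda>p. p \<in> P"])
    then show ?thesis using eq class_member[OF True] by (simp add: descend_def)
  qed (simp add: descend_def)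
qed

lemma realize_hom: "realize \<in> hom \<Phi> (cech_cohomology X 0)"
proof (rule homI)
  fix x assume "x \<in> carrier \<Phi>"
  then show "realize x \<in> carrier (cech_cohomology X 0)"
    unfolding realize_def carrier_cech_0 using descend_eval_lc by blast
next
  fix x y assume xy: "x \<in> carrier \<Phi>" "y \<in> carrier \<Phi>"
  have "descend (eval (\<lambda>i h. x i h + y i h)) = (\<lambda>P. descend (eval x) P + descend (eval y) P)"
    unfolding descend_add[symmetric] using eval_add[OF xy] by (intro descend_cong)
  then show "realize (x \<otimes>\<^bsub>\<Phi>\<^esub> y) = realize x \<otimes>\<^bsub>cech_cohomology X 0\<^esub> realize y"
    unfolding realize_def cech_class_mult[OF descend_eval_lc[OF xy(1)] descend_eval_lc[OF xy(2)]] by simp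
qed

lemma realize_onto: "realize ` carrier \<Phi> = carrier (cech_cohomology X 0)"
proof
  show "realize ` carrier \<Phi> \<subseteq> carrier (cech_cohomology X 0)"
    using realize_hom unfolding hom_def by blast
  show "carrier (cech_cohomology X 0) \<subseteq> realize ` carrier \<Phi>"
  proof
    fix B assume "B \<in> carrier (cech_cohomology X 0)"
    then obtain F where F: "F \<in> lc_functions X" "B = cech_class X F" unfolding carrier_cech_0 by blast
    obtain f N where f: "depth n N f" "invariant f" "descend f = F" by (rule lc_descend[OF F(1)])
    from eval_onto[OF f(1,2)] obtain x where x: "x \<in> carrier \<Phi>" "\<forall>p\<in>boundary n. eval x p = f p" by blast
    have "descend (eval x) = F" unfolding f(3)[symmetric] using x(2) by (intro descend_cong) blast
    with x(1) F(2) show "B \<in> realize ` carrier \<Phi>" unfolding realize_def by blast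
  qed
qed

lemma realize_kernel: "kernel \<Phi> (cech_cohomology X 0) realize = span"
proof (intro Set.set_eqI iffI)
  fix x assume x: "x \<in> span"
  have xc: "x \<in> carrier \<Phi>" by (rule span_carrier[OF x])
  have "descend (eval x) = descend (\<lambda>p. 0)" using eval_span[OF x] by (intro descend_cong)
  also have "\<dots> = (\<lambda>P. 0)" by (simp add: descend_def fun_eq_iff)
  finally show "x \<in> kernel \<Phi> (cech_cohomology X 0) realize"
    unfolding kernel_def cech_class_one realize_def using xc by simp
next
  fix x assume "x \<in> kernel \<Phi> (cech_cohomology X 0) realize"
  then have xc: "x \<in> carrier \<Phi>" and e: "cech_class X (descend (eval x)) = cech_class X (\<lambda>P. 0)"
    unfolding kernel_def cech_class_one realize_def by blast+
  from inj_onD[OF inj_on_cech_class e descend_eval_lc[OF xc] lc_functions_zero]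
  have 0: "descend (eval x) = (\<lambda>P. 0)" .
  have "eval x p = 0" if p: "p \<in> boundary n" for p
  proof -
    from descend_eq[OF eval_invariant[OF xc] class_of[OF p]] 0 show ?thesis by simp
  qed
  with xc show "x \<in> span" by (rule kernel_span)
qed

lemma realize_act:
  assumes x: "x \<in> carrier \<Phi>" and g: "g \<in> rwords n"
  shows "realize (act \<Phi> x g) = cech_pullback X 0 (decomp_act n g) (realize x)"
proof -
  have gc: "g \<in> carrier (free_group n)" using g by simp
  note inv = eval_invariant[OF x]
  have e: "descend (eval (act \<Phi> x g)) = descend (\<lambda>p. eval x (boundary_act n g p))"
    by (rule descend_cong) (rule eval_act[OF x g])
  have lc: "(\<lambda>P. if P \<in> topspace X then descend (eval x) (decomp_act n g P) else 0) \<in> lc_functions X"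
    unfolding descend_act(1)[OF g inv] e[symmetric]
    by (rule descend_eval_lc[OF free_module_act[OF group_free_group x gc]])
  from cech_class_pullback[OF descend_eval_lc[OF x] descend_act(2)[OF g inv] lc]
  show ?thesis unfolding realize_def descend_act(1)[OF g inv] e by simp
qed

lemma act_act_inverse:
  assumes "y \<in> carrier \<Phi>" "g \<in> rwords n"
  shows "act \<Phi> (act \<Phi> y (winv g)) g = y" "act \<Phi> (act \<Phi> y g) (winv g) = y"
proof -
  have *: "act \<Phi> (act \<Phi> y (winv g)) g = y" if g: "g \<in> rwords n" for g
  proof (intro ext)
    fix i h
    have g': "winv g \<in> rwords n" using g by simp
    show "act \<Phi> (act \<Phi> y (winv g)) g i h = y i h"
    proof (cases "h \<in> rwords n")
      case True
      have "h \<otimes>\<^bsub>free_group n\<^esub> inv\<^bsub>free_group n\<^esub> g \<in> rwords n"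
        using True g' by (simp add: inv_free_group[OF g] reduce_words reduced_reduce)
      moreover have "h \<otimes>\<^bsub>free_group n\<^esub> inv\<^bsub>free_group n\<^esub> g \<otimes>\<^bsub>free_group n\<^esub> inv\<^bsub>free_group n\<^esub> (winv g) = h"
        using True by (simp add: inv_free_group[OF g] inv_free_group[OF g'] reduce_mult_winv)
      ultimately show ?thesis using True unfolding act_word by (simp only: if_True)
    next
      case False
      moreover have "y i h = 0" using free_module_support(3)[OF assms(1), of i h] False by auto
      ultimately show ?thesis unfolding act_word by (simp only: if_False)
    qed
  qed
  show "act \<Phi> (act \<Phi> y (winv g)) g = y" by (rule *[OF assms(2)])
  have "winv g \<in> rwords n" using assms(2) by simp
  from *[OF this] show "act \<Phi> (act \<Phi> y g) (winv g) = y" by simp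
qed

lemma realize_eq_iff:
  assumes "x \<in> carrier \<Phi>" "y \<in> carrier \<Phi>"
  shows "realize x = realize y \<longleftrightarrow> (\<lambda>i h. x i h - y i h) \<in> span"
proof -
  have c: "(\<lambda>i h. x i h - y i h) \<in> carrier \<Phi>"
    using free_module_add[OF assms(1) free_module_uminus[OF assms(2)]] by simp
  interpret H: group "cech_cohomology X 0" by (rule group_cech_0)
  have "x = (\<lambda>i h. x i h - y i h) \<otimes>\<^bsub>\<Phi>\<^esub> y" by simp
  then have "realize x = realize (\<lambda>i h. x i h - y i h) \<otimes>\<^bsub>cech_cohomology X 0\<^esub> realize y"
    unfolding hom_mult[OF realize_hom c assms(2), symmetric] by (rule arg_cong)
  moreover have "realize z \<in> carrier (cech_cohomology X 0)" if "z \<in> carrier \<Phi>" for z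
    using realize_hom that unfolding hom_def by blast
  ultimately have "realize x = realize y \<longleftrightarrow> realize (\<lambda>i h. x i h - y i h) = \<one>\<^bsub>cech_cohomology X 0\<^esub>"
    using H.r_cancel_one[of "realize y" "realize (\<lambda>i h. x i h - y i h)"] c assms(2) by simp
  also have "\<dots> \<longleftrightarrow> (\<lambda>i h. x i h - y i h) \<in> span"
    unfolding realize_kernel[symmetric] kernel_def using c by blast
  finally show ?thesis .
qed

text \<open>The first isomorphism theorem for groups supplies the bijection from cosets to classes.
  Equivariance remains, and for it the inverse is made explicit: the image of
  \<open>realize x\<close> is the fibre of \<open>realize\<close> through \<open>x\<close>.\<close>

theorem cech_module_presented:
  "right_module_isomorphic (free_group n) (cech_module n ws 0) (quotient_module \<Phi> span)"
proof -
  let ?H = "cech_cohomology X 0"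
  interpret gh: group_hom \<Phi> ?H realize
    using realize_hom group_free_module group_cech_0 by (intro group_hom.intro group_hom_axioms.intro)
  let ?\<theta> = "\<lambda>C. the_elem (realize ` C)"
  have iso: "?\<theta> \<in> iso (\<Phi> Mod span) ?H"
    using gh.FactGroup_iso_set[OF realize_onto] unfolding realize_kernel .
  have "group (\<Phi> Mod span)"
    using normal.factorgroup_is_group[OF gh.normal_kernel] unfolding realize_kernel .
  define \<psi> where "\<psi> = inv_into (carrier (\<Phi> Mod span)) ?\<theta>"
  have psi: "\<psi> \<in> iso ?H (\<Phi> Mod span)"
    unfolding \<psi>_def by (rule group.iso_set_sym[OF \<open>group (\<Phi> Mod span)\<close> iso])
  have val: "\<psi> (realize x) = {y \<in> carrier \<Phi>. realize y = realize x}" if x: "x \<in> carrier \<Phi>" for x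
  proof -
    let ?C = "{y \<in> carrier \<Phi>. realize y = realize x}"
    have "?C = span #>\<^bsub>\<Phi>\<^esub> x"
    proof (intro Set.set_eqI iffI)
      fix y assume "y \<in> ?C"
      then have y: "y \<in> carrier \<Phi>" "realize y = realize x" by blast+
      then have d: "(\<lambda>i h. y i h - x i h) \<in> span" using realize_eq_iff[OF y(1) x] by blast
      have "y = (\<lambda>i h. y i h - x i h) \<otimes>\<^bsub>\<Phi>\<^esub> x" by simp
      with d show "y \<in> span #>\<^bsub>\<Phi>\<^esub> x" unfolding r_coset_def by blast
    next
      fix y assume "y \<in> span #>\<^bsub>\<Phi>\<^esub> x"
      then obtain z where z: "z \<in> span" "y = z \<otimes>\<^bsub>\<Phi>\<^esub> x" unfolding r_coset_def by blast
      then have y: "y = (\<lambda>i h. z i h + x i h)" by simp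
      have yc: "y \<in> carrier \<Phi>" unfolding y by (rule free_module_add[OF span_carrier[OF z(1)] x])
      have "(\<lambda>i h. y i h - x i h) = z" unfolding y by simp
      with z(1) realize_eq_iff[OF yc x] yc show "y \<in> ?C" by simp
    qed
    then have C: "?C \<in> carrier (\<Phi> Mod span)"
      unfolding FactGroup_def RCOSETS_def using x by auto
    have "realize ` ?C = {realize x}" using x by auto
    then have "?\<theta> ?C = realize x" by simp
    moreover have "inj_on ?\<theta> (carrier (\<Phi> Mod span))"
      using iso unfolding iso_def bij_betw_def by blast
    ultimately show ?thesis
      unfolding \<psi>_def using inv_into_f_f[OF _ C, of ?\<theta>] by simp
  qed
  have "\<psi> (act (cech_module n ws 0) m g) = act (quotient_module \<Phi> span) (\<psi> m) g"
    if m: "m \<in> carrier (cech_module n ws 0)" and g: "g \<in> carrier (free_group n)" for m g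
  proof -
    have gr: "g \<in> rwords n" "winv g \<in> rwords n" and gc: "winv g \<in> carrier (free_group n)" using g by simp_all
    have "m \<in> carrier ?H" using m by (simp add: cech_module_def Let_def)
    then obtain x where x: "x \<in> carrier \<Phi>" "m = realize x" using realize_onto by blast
    note xg = free_module_act[OF group_free_group x(1) g]
    have "act (cech_module n ws 0) m g = realize (act \<Phi> x g)"
      unfolding x(2) realize_act[OF x(1) gr(1)] by (simp add: cech_module_def Let_def)
    then have "\<psi> (act (cech_module n ws 0) m g) = {y \<in> carrier \<Phi>. realize y = realize (act \<Phi> x g)}"
      using val[OF xg] by simp
    \<comment> \<open>Acting by \<open>g\<close> maps the fibre through \<open>x\<close> into the
      fibre through its translate; acting by \<open>winv g\<close> shows that every element is
      reached.\<close>
    also have "\<dots> = (\<lambda>y. act \<Phi> y g) ` {y \<in> carrier \<Phi>. realize y = realize x}"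
    proof (intro Set.set_eqI iffI)
      fix y assume "y \<in> {y \<in> carrier \<Phi>. realize y = realize (act \<Phi> x g)}"
      then have y: "y \<in> carrier \<Phi>" "realize y = realize (act \<Phi> x g)" by blast+
      then have "realize (act \<Phi> y (winv g)) = realize (act \<Phi> (act \<Phi> x g) (winv g))"
        unfolding realize_act[OF y(1) gr(2)] realize_act[OF xg gr(2)] by (simp only:)
      then have "realize (act \<Phi> y (winv g)) = realize x" unfolding act_act_inverse(2)[OF x(1) gr(1)] .
      moreover have "act \<Phi> y (winv g) \<in> carrier \<Phi>" by (rule free_module_act[OF group_free_group y(1) gc])
      moreover have "y = act \<Phi> (act \<Phi> y (winv g)) g" by (rule act_act_inverse(1)[OF y(1) gr(1), symmetric])
      ultimately show "y \<in> (\<lambda>y. act \<Phi> y g) ` {y \<in> carrier \<Phi>. realize y = realize x}" by blast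
    next
      fix z assume "z \<in> (\<lambda>y. act \<Phi> y g) ` {y \<in> carrier \<Phi>. realize y = realize x}"
      then obtain y where y: "y \<in> carrier \<Phi>" "realize y = realize x" "z = act \<Phi> y g" by blast
      have "realize z = realize (act \<Phi> x g)"
        unfolding y(3) realize_act[OF y(1) gr(1)] realize_act[OF x(1) gr(1)] y(2) ..
      moreover have "z \<in> carrier \<Phi>" unfolding y(3) by (rule free_module_act[OF group_free_group y(1) g])
      ultimately show "z \<in> {y \<in> carrier \<Phi>. realize y = realize (act \<Phi> x g)}" by blast
    qed
    also have "\<dots> = act (quotient_module \<Phi> span) (\<psi> m) g"
      unfolding x(2) val[OF x(1)] by (simp only: quotient_module_def right_module.select_convs)
    finally show ?thesis .
  qed
  moreover have "\<psi> \<in> iso (cech_module n ws 0) (quotient_module \<Phi> span)"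
    using psi by (simp add: iso_def hom_def cech_module_def quotient_module_def Let_def)
  ultimately show ?thesis unfolding right_module_isomorphic_def by blast
qed

end

section \<open>The algorithm\<close>

definition letters :: "nat \<Rightarrow> letter list" where
  "letters n = concat (map (\<lambda>i. [(i, True), (i, False)]) [0..<n])"

text \<open>The test \<open>red_Cons a w = a # w\<close> retains exactly the letters that do not
  cancel against \<open>w\<close>.\<close>

definition sphere_list :: "nat \<Rightarrow> nat \<Rightarrow> word list" where
  "sphere_list n k = rec_nat [[]] (\<lambda>_ S. concat (map (\<lambda>w. map (\<lambda>a. a # w)
     (filter (\<lambda>a. red_Cons a w = a # w) (letters n))) S)) k"

definition ball_list :: "nat \<Rightarrow> nat \<Rightarrow> word list" where
  "ball_list n k = concat (map (sphere_list n) [0..<Suc k])"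

text \<open>The exponent bounds the number of crossing points. Each is an end of a line with a base
  point of length at most 1 plus the length of its word, and its word is one of
  \<open>2 * length ws\<close> words and inverses. The total length of \<open>ws\<close> is a
  convenient bound for every single word.\<close>

definition depth_bound :: "nat \<Rightarrow> word list \<Rightarrow> nat" where
  "depth_bound n ws = 2 * n * 2 ^ (length (ball_list n (Suc (length (concat ws)))) * (2 * length ws))"

text \<open>Finitely many base points suffice: a line on which the test could fail has ends with
  different prefixes of length \<open>D\<close>, and by \<open>line_end_near\<close> such a line has
  a base point in this ball.\<close>

definition invariant_list :: "nat \<Rightarrow> word list \<Rightarrow> nat \<Rightarrow> word list \<Rightarrow> bool" where
  "invariant_list n ws D A = list_all (\<lambda>w. list_all (\<lambda>g.
     (ray_prefix D g w \<in> set A) = (ray_prefix D g (winv w) \<in> set A)) (ball_list n (D + length (concat ws)))) ws"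

definition generators :: "nat \<Rightarrow> word list \<Rightarrow> nat \<Rightarrow> word list list" where
  "generators n ws D = filter (invariant_list n ws D) (subseqs (sphere_list n D))"

text \<open>Entries with equal index are added up by \<open>vector_of\<close>, which covers relators
  in which indices coincide.\<close>

definition sparse_vector :: "nat \<Rightarrow> (nat \<times> int \<times> word) list \<Rightarrow> ring_expr list" where
  "sparse_vector k es = map (\<lambda>i. map snd (filter (\<lambda>e. fst e = i) es)) [0..<k]"

definition additive_list :: "nat \<Rightarrow> nat \<Rightarrow> word list list \<Rightarrow> ring_expr list list" where
  "additive_list n D gens = concat (map (\<lambda>x. concat (map (\<lambda>y.
     map (\<lambda>z. sparse_vector (length gens) [(fst x, 1, []), (fst y, 1, []), (fst z, - 1, [])])
       (filter (\<lambda>z. list_all (\<lambda>u. \<not> (u \<in> set (snd x) \<and> u \<in> set (snd y)) \<and>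
            (u \<in> set (snd z)) = (u \<in> set (snd x) \<or> u \<in> set (snd y))) (sphere_list n D))
         (List.enumerate 0 gens)))
     (List.enumerate 0 gens))) (List.enumerate 0 gens))"

definition shift_list :: "nat \<Rightarrow> nat \<Rightarrow> word list list \<Rightarrow> ring_expr list list" where
  "shift_list n D gens = concat (map (\<lambda>x. concat (map (\<lambda>y.
     map (\<lambda>a. sparse_vector (length gens) [(fst x, 1, [a]), (fst y, - 1, [])])
       (filter (\<lambda>a. list_all (\<lambda>u. (take D (reduce (a # u)) \<in> set (snd x)) = (take D u \<in> set (snd y)))
         (sphere_list n (Suc D))) (letters n)))
     (List.enumerate 0 gens))) (List.enumerate 0 gens))"

definition present :: "nat \<Rightarrow> nat \<Rightarrow> word list list \<Rightarrow> nat \<times> ring_expr list list" where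
  "present n D gens = (length gens, additive_list n D gens @ shift_list n D gens)"

text \<open>The successor appears because traces that are stable at \<open>R\<close> yield
  generators of depth \<open>Suc R\<close>.\<close>

definition presentation_of :: "nat \<times> word list \<Rightarrow> nat \<times> ring_expr list list" where
  "presentation_of inp = (let n = fst inp; ws = map reduce (snd inp); D = Suc (depth_bound n ws)
     in present n D (generators n ws D))"

text \<open>Proving computability once for projections turns a named function of two arguments into
  a composition rule, so its body need not be unfolded at each use.\<close>

lemma computable2:
  assumes "computable (\<lambda>p. h (fst p) (snd p))" "computable f" "computable g"
  shows "computable (\<lambda>x. h (f x) (g x))"
  using computable_comp[OF assms(1) computable_Pair[OF assms(2,3)]] by simp

lemma computable3:
  assumes "computable (\<lambda>p. h (fst p) (fst (snd p)) (snd (snd p)))" "computable f" "computable g" "computable k"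
  shows "computable (\<lambda>x. h (f x) (g x) (k x))"
  using computable_comp[OF assms(1) computable_Pair[OF assms(2) computable_Pair[OF assms(3,4)]]] by simp

lemma computable_flip [computable_intros]: "computable f \<Longrightarrow> computable (\<lambda>x. flip (f x))"
  unfolding flip_def by (intro computable_intros)

lemma red_Cons_case:
  "red_Cons a w = (case w of [] \<Rightarrow> [a] | b # v \<Rightarrow> if b = flip a then v else a # b # v)"
  by (cases w) auto

lemma computable_red_Cons [computable_intros]:
  "computable f \<Longrightarrow> computable g \<Longrightarrow> computable (\<lambda>x. red_Cons (f x) (g x))"
  by (rule computable2) (unfold red_Cons_case, intro computable_intros)

lemma computable_reduce [computable_intros]: "computable f \<Longrightarrow> computable (\<lambda>x. reduce (f x))"
  unfolding reduce_def by (intro computable_intros)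

lemma computable_winv [computable_intros]: "computable f \<Longrightarrow> computable (\<lambda>x. winv (f x))"
  unfolding winv_def by (intro computable_intros)

lemma computable_ray_prefix [computable_intros]:
  "computable f \<Longrightarrow> computable g \<Longrightarrow> computable h \<Longrightarrow> computable (\<lambda>x. ray_prefix (f x) (g x) (h x))"
  by (rule computable3) (unfold ray_prefix_def, intro computable_intros)

lemma computable_letters [computable_intros]: "computable f \<Longrightarrow> computable (\<lambda>x. letters (f x))"
  unfolding letters_def by (intro computable_intros)

lemma computable_sphere_list [computable_intros]:
  "computable f \<Longrightarrow> computable g \<Longrightarrow> computable (\<lambda>x. sphere_list (f x) (g x))"
  by (rule computable2) (unfold sphere_list_def, intro computable_intros)

lemma computable_ball_list [computable_intros]:
  "computable f \<Longrightarrow> computable g \<Longrightarrow> computable (\<lambda>x. ball_list (f x) (g x))"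
  by (rule computable2) (unfold ball_list_def, intro computable_intros)

lemma computable_depth_bound [computable_intros]:
  "computable f \<Longrightarrow> computable g \<Longrightarrow> computable (\<lambda>x. depth_bound (f x) (g x))"
  by (rule computable2) (unfold depth_bound_def, intro computable_intros)

lemma computable_generators [computable_intros]:
  "computable f \<Longrightarrow> computable g \<Longrightarrow> computable h \<Longrightarrow> computable (\<lambda>x. generators (f x) (g x) (h x))"
  by (rule computable3) (unfold generators_def invariant_list_def, intro computable_intros)

lemma computable_sparse_vector [computable_intros]:
  "computable f \<Longrightarrow> computable g \<Longrightarrow> computable (\<lambda>x. sparse_vector (f x) (g x))"
  by (rule computable2) (unfold sparse_vector_def, intro computable_intros)

lemma computable_present [computable_intros]:
  "computable f \<Longrightarrow> computable g \<Longrightarrow> computable h \<Longrightarrow> computable (\<lambda>x. present (f x) (g x) (h x))"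
  by (rule computable3) (unfold present_def additive_list_def shift_list_def, intro computable_intros)

lemma computable_presentation_of: "computable presentation_of"
proof -
  have "computable (\<lambda>inp. present (fst inp) (Suc (depth_bound (fst inp) (map reduce (snd inp))))
      (generators (fst inp) (map reduce (snd inp)) (Suc (depth_bound (fst inp) (map reduce (snd inp))))))"
    by (intro computable_intros)
  then show ?thesis unfolding presentation_of_def Let_def .
qed

section \<open>Agreement of the encodings with the prescribed codes\<close>

lemma enc_list_map: "(\<And>x. enc x = f x) \<Longrightarrow> enc xs = list_encode (map f xs)"
proof -
  assume "\<And>x. enc x = f x"
  then have "enc = f" by (rule ext)
  then show ?thesis by (simp add: enc_list_def)
qed

lemma enc_word: "enc w = word_code w" for w :: word
  unfolding word_code_def by (rule enc_list_map) (simp add: enc_prod_def case_prod_beta)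

lemma enc_input: "enc (n, ws) = input_code n ws"
  by (simp add: input_code_def enc_list_map[OF enc_word])

lemma enc_ring_expr: "enc e = ring_expr_code e" for e :: ring_expr
  unfolding ring_expr_code_def
  by (rule enc_list_map) (simp add: enc_prod_def case_prod_beta enc_word enc_int_def)

lemma enc_presentation: "enc (k, rels) = presentation_code k rels" for rels :: "ring_expr list list"
  by (simp add: presentation_code_def enc_list_map[OF enc_list_map[OF enc_ring_expr]])

section \<open>Correctness\<close>

lemma set_letters: "a \<in> set (letters n) \<longleftrightarrow> fst a < n"
  by (cases a) (auto simp: letters_def)

lemma set_sphere_list: "set (sphere_list n k) = sphere n k"
proof (induction k)
  case 0
  then show ?case by (auto simp: sphere_list_def)
next
  case (Suc k)
  have red: "red_Cons a w = a # w \<longleftrightarrow> w = [] \<or> hd w \<noteq> flip a" for a w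
    by (cases w) auto
  have "set (sphere_list n (Suc k)) = {a # w | a w. w \<in> set (sphere_list n k) \<and> fst a < n \<and> (w = [] \<or> hd w \<noteq> flip a)}"
    unfolding sphere_list_def by (auto simp: red set_letters)
  also have "\<dots> = sphere n (Suc k)"
  proof (intro Set.set_eqI iffI)
    fix v assume "v \<in> sphere n (Suc k)"
    then show "v \<in> {a # w | a w. w \<in> set (sphere_list n k) \<and> fst a < n \<and> (w = [] \<or> hd w \<noteq> flip a)}"
      unfolding Suc by (cases v) (auto simp: reduced_Cons)
  qed (unfold Suc, auto simp: reduced_Cons)
  finally show ?case .
qed

lemma set_ball_list: "set (ball_list n k) = {w \<in> rwords n. length w \<le> k}"
  unfolding ball_list_def by (auto simp: set_sphere_list)

lemma vector_of_sparse:
  "vector_of (sparse_vector k es) i h =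
    (if i < k then \<Sum>e\<leftarrow>es. if fst e = i \<and> reduce (snd (snd e)) = h then fst (snd e) else 0 else 0)"
proof -
  have "(\<Sum>(c, u)\<leftarrow>map snd (filter (\<lambda>e. fst e = i) es). if reduce u = h then c else 0) =
    (\<Sum>e\<leftarrow>es. if fst e = i \<and> reduce (snd (snd e)) = h then fst (snd e) else 0)"
    by (induction es) (auto simp: case_prod_beta)
  then show ?thesis unfolding vector_of_def sparse_vector_def by simp
qed

lemma in_enumerate: "x \<in> set (List.enumerate 0 xs) \<longleftrightarrow> (\<exists>i<length xs. x = (i, xs ! i))"
  by (cases x) (auto simp: in_set_enumerate_eq)

lemma set_nested_filter:
  "set (concat (map (\<lambda>x. concat (map (\<lambda>y. map (F x y) (filter (P x y) zs)) ys)) xs)) =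
    {F x y z | x y z. x \<in> set xs \<and> y \<in> set ys \<and> z \<in> set zs \<and> P x y z}"
  by auto

locale pattern_words =
  fixes n :: nat and ws :: "word list"
  assumes ws: "set ws \<subseteq> rwords n" "[] \<notin> set ws"
begin

definition \<L> where "\<L> = line_pattern n ws \<union> (line_pattern n ws)\<inverse>"

lemma w: "w \<in> set ws \<Longrightarrow> w \<in> rwords n" "w \<in> set ws \<Longrightarrow> w \<noteq> []"
  using ws by blast+

text \<open>Reversing a line amounts to replacing its word by the inverse, so the symmetric closure
  is covered by admitting inverses of the given words.\<close>

lemma line_iff:
  "(p, q) \<in> \<L> \<longleftrightarrow> (\<exists>g v. g \<in> rwords n \<and> (v \<in> set ws \<or> winv v \<in> set ws) \<and>
    p = line_end n g v \<and> q = line_end n g (winv v))"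
proof
  assume "(p, q) \<in> \<L>"
  then have "(p, q) \<in> line_pattern n ws \<or> (q, p) \<in> line_pattern n ws" unfolding \<L>_def by blast
  then show "\<exists>g v. g \<in> rwords n \<and> (v \<in> set ws \<or> winv v \<in> set ws) \<and> p = line_end n g v \<and> q = line_end n g (winv v)"
  proof
    assume "(p, q) \<in> line_pattern n ws"
    then obtain g w where "g \<in> rwords n" "w \<in> set ws" "p = line_end n g w" "q = line_end n g (winv w)"
      unfolding line_pattern_eq[OF ws(1)] by blast
    then show ?thesis by blast
  next
    assume "(q, p) \<in> line_pattern n ws"
    then obtain g w where "g \<in> rwords n" "w \<in> set ws" "q = line_end n g w" "p = line_end n g (winv w)"
      unfolding line_pattern_eq[OF ws(1)] by blast
    then show ?thesis by (intro exI[of _ g] exI[of _ "winv w"]) simp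
  qed
next
  assume "\<exists>g v. g \<in> rwords n \<and> (v \<in> set ws \<or> winv v \<in> set ws) \<and> p = line_end n g v \<and> q = line_end n g (winv v)"
  then obtain g v where gv: "g \<in> rwords n" "v \<in> set ws \<or> winv v \<in> set ws" "p = line_end n g v" "q = line_end n g (winv v)"
    by blast
  from gv(2) show "(p, q) \<in> \<L>"
  proof
    assume "v \<in> set ws"
    then have "(p, q) \<in> line_pattern n ws" unfolding line_pattern_eq[OF ws(1)] using gv by blast
    then show ?thesis unfolding \<L>_def by blast
  next
    assume v: "winv v \<in> set ws"
    have "(q, p) = (line_end n g (winv v), line_end n g (winv (winv v)))" using gv by simp
    then have "(q, p) \<in> line_pattern n ws" unfolding line_pattern_eq[OF ws(1)] using gv(1) v by blast
    then show ?thesis unfolding \<L>_def by blast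
  qed
qed

lemma v:
  assumes "v \<in> set ws \<or> winv v \<in> set ws"
  shows "v \<in> rwords n" "v \<noteq> []" "winv v \<in> rwords n" "winv v \<noteq> []" "length v \<le> length (concat ws)"
proof -
  have "length u \<le> length (concat ws)" if "u \<in> set ws" for u
    using that by (induction ws) auto
  from this[of v] this[of "winv v"] assms show "length v \<le> length (concat ws)" by auto
  from assms w[of v] w[of "winv v"] show "v \<in> rwords n" "v \<noteq> []" "winv v \<in> rwords n" "winv v \<noteq> []" by auto
qed

sublocale pattern n \<L>
proof
  fix p q assume "(p, q) \<in> \<L>"
  then obtain g u where gu: "g \<in> rwords n" "u \<in> set ws \<or> winv u \<in> set ws" "p = line_end n g u" "q = line_end n g (winv u)"
    unfolding line_iff by blast
  note u = v[OF gu(2)]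
  show "p \<in> boundary n" "q \<in> boundary n"
    unfolding gu(3,4) by (rule line_end_boundary(1)[OF gu(1) u(1,2)], rule line_end_boundary(1)[OF gu(1) u(3,4)])
  show "(q, p) \<in> \<L>" using \<open>(p, q) \<in> \<L>\<close> unfolding \<L>_def by blast
  show "(boundary_act n h p, boundary_act n h q) \<in> \<L>" if h: "h \<in> rwords n" for h
  proof -
    have "boundary_act n h p = line_end n (reduce (h @ g)) u" "boundary_act n h q = line_end n (reduce (h @ g)) (winv u)"
      unfolding gu(3,4) by (rule boundary_act_line_end[OF h gu(1) u(1,2)], rule boundary_act_line_end[OF h gu(1) u(3,4)])
    moreover have "reduce (h @ g) \<in> rwords n" using h gu(1) by (intro reduce_mult_words) auto
    ultimately show ?thesis unfolding line_iff using gu(2) by blast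
  qed
qed

text \<open>The ends of a crossing line differ in their first letter, so
  \<open>line_end_near\<close> with prefix length 1 gives each of them a base point in the ball;
  pairing base points with words bounds their number.\<close>

lemma traces_depth_bound:
  assumes "fst a < n"
  shows "traces (Suc (depth_bound n ws)) a \<subseteq> traces (depth_bound n ws) a"
proof (rule traces_stable[OF _ _ _ assms])
  let ?B = "ball_list n (Suc (length (concat ws)))" and ?V = "ws @ map winv ws"
  define E where "E = (\<lambda>(g, v). line_end n g v) ` (set ?B \<times> set ?V)"
  show "finite E" unfolding E_def by simp
  have "card E \<le> card (set ?B \<times> set ?V)" unfolding E_def by (rule card_image_le) simp
  also have "\<dots> \<le> length ?B * (2 * length ws)"
    unfolding card_cartesian_product using card_length[of ?B] card_length[of ?V]
    by (intro mult_le_mono) simp_all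
  finally show "2 * n * 2 ^ card E \<le> depth_bound n ws"
    unfolding depth_bound_def by (intro mult_le_mono2 power_increasing) simp_all
  show "crossing b \<subseteq> E" if "fst b < n" for b
  proof
    fix p assume "p \<in> crossing b"
    then obtain q where q: "pref p 1 = [b]" "(p, q) \<in> \<L>" "pref q 1 \<noteq> [b]" unfolding crossing_def by blast
    from q(2) obtain g u where gu: "g \<in> rwords n" "u \<in> set ws \<or> winv u \<in> set ws" "p = line_end n g u" "q = line_end n g (winv u)"
      unfolding line_iff by blast
    note u = v[OF gu(2)]
    have "pref (line_end n g u) 1 \<noteq> pref (line_end n g (winv u)) 1" using q(1,3) unfolding gu(3,4) by simp
    then obtain g' where g': "g' \<in> rwords n" "length g' \<le> 1 + length u" "line_end n g' u = line_end n g u"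
      by (rule line_end_near[OF gu(1) u(1,2)]) blast
    have "g' \<in> set ?B" using g'(1,2) u(5) unfolding set_ball_list by simp
    moreover have "u \<in> set ?V"
    proof -
      have "u \<in> winv ` set ws" if "winv u \<in> set ws" using that by (rule image_eqI[rotated]) simp
      with gu(2) show ?thesis by auto
    qed
    ultimately have "(g', u) \<in> set ?B \<times> set ?V" by blast
    then have "line_end n g' u \<in> E" unfolding E_def by (rule image_eqI[rotated]) simp
    then show "p \<in> E" unfolding g'(3) gu(3) .
  qed
qed

text \<open>Ends with equal prefixes of length \<open>D\<close> cannot be told apart by the set. All
  other lines have a base point in the finite ball that is searched.\<close>

lemma invariant_list_iff:
  "invariant_list n ws D A \<longleftrightarrow> invariant (\<lambda>p. pref p D \<in> set A)"
proof
  assume inv: "invariant (\<lambda>p. pref p D \<in> set A)"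
  have "(ray_prefix D g w \<in> set A) = (ray_prefix D g (winv w) \<in> set A)" if "w \<in> set ws" "g \<in> rwords n" for w g
  proof -
    have u: "w \<in> set ws \<or> winv w \<in> set ws" using that by blast
    have "(line_end n g w, line_end n g (winv w)) \<in> \<L>" unfolding line_iff using that by blast
    from invariantD[OF inv this] show ?thesis
      unfolding line_end_boundary(2)[OF that(2) v(1,2)[OF u]] line_end_boundary(2)[OF that(2) v(3,4)[OF u]] .
  qed
  then show "invariant_list n ws D A"
    unfolding invariant_list_def list_all_iff set_ball_list by blast
next
  assume inv: "invariant_list n ws D A"
  have *: "(pref (line_end n g w) D \<in> set A) = (pref (line_end n g (winv w)) D \<in> set A)" if w: "w \<in> set ws" and g: "g \<in> rwords n" for w g
  proof (cases "pref (line_end n g w) D = pref (line_end n g (winv w)) D")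
    case False
    have u: "w \<in> set ws \<or> winv w \<in> set ws" using w by blast
    obtain g' where g': "g' \<in> rwords n" "length g' \<le> D + length w"
      "line_end n g' w = line_end n g w" "line_end n g' (winv w) = line_end n g (winv w)"
      by (rule line_end_near[OF g v(1,2)[OF u] False])
    have "g' \<in> set (ball_list n (D + length (concat ws)))"
      using g'(1,2) v(5)[OF u] unfolding set_ball_list by simp
    then have "(ray_prefix D g' w \<in> set A) = (ray_prefix D g' (winv w) \<in> set A)"
      using inv w unfolding invariant_list_def list_all_iff by blast
    then show ?thesis
      unfolding g'(3,4)[symmetric] line_end_boundary(2)[OF g'(1) v(1,2)[OF u]] line_end_boundary(2)[OF g'(1) v(3,4)[OF u]] .
  qed simp
  show "invariant (\<lambda>p. pref p D \<in> set A)"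
    unfolding invariant_def
  proof (intro allI impI)
    fix p q assume "(p, q) \<in> \<L>"
    then have "(p, q) \<in> line_pattern n ws \<or> (q, p) \<in> line_pattern n ws" unfolding \<L>_def by blast
    then show "(pref p D \<in> set A) = (pref q D \<in> set A)"
    proof
      assume "(p, q) \<in> line_pattern n ws"
      then obtain g w where "g \<in> rwords n" "w \<in> set ws" "p = line_end n g w" "q = line_end n g (winv w)"
        unfolding line_pattern_eq[OF ws(1)] by blast
      with * show ?thesis by simp
    next
      assume "(q, p) \<in> line_pattern n ws"
      then obtain g w where "g \<in> rwords n" "w \<in> set ws" "q = line_end n g w" "p = line_end n g (winv w)"
        unfolding line_pattern_eq[OF ws(1)] by blast
      with * show ?thesis by simp
    qed
  qed
qed

abbreviation "\<D> \<equiv> Suc (depth_bound n ws)"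
abbreviation "\<G> \<equiv> generators n ws \<D>"

sublocale presentation n \<L> \<D> "length \<G>" "\<lambda>i. set (\<G> ! i)"
proof
  have mem: "\<G> ! i \<in> set (subseqs (sphere_list n \<D>))" "invariant_list n ws \<D> (\<G> ! i)" if "i < length \<G>" for i
    using nth_mem[OF that] unfolding generators_def set_filter by blast+
  show "set (\<G> ! i) \<subseteq> sphere n \<D>" if "i < length \<G>" for i
  proof -
    have "set (\<G> ! i) \<in> Pow (set (sphere_list n \<D>))"
      unfolding subseqs_powset[symmetric] using mem(1)[OF that] by (rule imageI)
    then show ?thesis unfolding set_sphere_list by blast
  qed
  show "invariant (\<lambda>p. pref p \<D> \<in> set (\<G> ! i))" if "i < length \<G>" for i
    using mem(2)[OF that] unfolding invariant_list_iff .
  show "\<exists>i<length \<G>. set (\<G> ! i) = B" if B: "B \<subseteq> sphere n \<D>" "invariant (\<lambda>p. pref p \<D> \<in> B)" for B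
  proof -
    have "B \<in> set ` set (subseqs (sphere_list n \<D>))"
      unfolding subseqs_powset set_sphere_list using B(1) by blast
    then obtain xs where xs: "xs \<in> set (subseqs (sphere_list n \<D>))" "B = set xs" by blast
    then have "invariant_list n ws \<D> xs" unfolding invariant_list_iff using B(2) by simp
    with xs(1) have "xs \<in> set \<G>" unfolding generators_def set_filter by blast
    then show ?thesis unfolding in_set_conv_nth xs(2) by blast
  qed
qed simp

sublocale decomposition n \<L> \<D> "length \<G>" "\<lambda>i. set (\<G> ! i)" ws
proof
  show "\<L> = line_pattern n ws \<union> (line_pattern n ws)\<inverse>" by (rule \<L>_def)
  fix N and f :: "bpoint \<Rightarrow> int" assume f: "depth n N f" "invariant f"
  show "\<exists>x\<in>carrier \<Phi>. \<forall>p\<in>boundary n. eval x p = f p"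
    by (rule eval_surjective[OF _ refl f]) (rule traces_depth_bound)
qed

lemma vector_of_additive:
  assumes "i < length \<G>" "j < length \<G>" "l < length \<G>"
  shows "vector_of (sparse_vector (length \<G>) [(i, 1, []), (j, 1, []), (l, - 1, [])]) =
    (\<lambda>i' h. single i [] i' h + single j [] i' h - single l [] i' h)"
  using assms by (intro ext) (auto simp: vector_of_sparse single_def)

lemma vector_of_shift:
  assumes "i < length \<G>" "j < length \<G>"
  shows "vector_of (sparse_vector (length \<G>) [(i, 1, [a]), (j, - 1, [])]) =
    (\<lambda>i' h. single i [a] i' h - single j [] i' h)"
  using assms by (intro ext) (auto simp: vector_of_sparse single_def reduce_def)

lemma additive_list_relators: "vector_of ` set (additive_list n \<D> \<G>) = additive_relators"
proof -
  define P where "P = (\<lambda>A B C. \<forall>u\<in>sphere n \<D>. of_bool (u \<in> A) + of_bool (u \<in> B) = (of_bool (u \<in> C) :: int))"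
  \<comment> \<open>For values 0 and 1, the equation says that the first two are not both 1 and that
    the third is their disjunction, which is the executable test.\<close>
  have test: "list_all (\<lambda>u. \<not> (u \<in> A \<and> u \<in> B) \<and> (u \<in> C) = (u \<in> A \<or> u \<in> B)) (sphere_list n \<D>) \<longleftrightarrow> P A B C" for A B C
    unfolding list_all_iff set_sphere_list P_def by (rule ball_cong[OF refl]) auto
  let ?V = "\<lambda>i j l. sparse_vector (length \<G>) [(i, 1, []), (j, 1, []), (l, - 1, [])]"
  let ?E = "set (List.enumerate 0 \<G>)"
  have eq: "set (additive_list n \<D> \<G>) =
      {?V (fst x) (fst y) (fst z) | x y z. x \<in> ?E \<and> y \<in> ?E \<and> z \<in> ?E \<and> P (set (snd x)) (set (snd y)) (set (snd z))}"
    unfolding additive_list_def test set_nested_filter ..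
  show ?thesis
  proof (intro Set.set_eqI iffI)
    fix r assume "r \<in> vector_of ` set (additive_list n \<D> \<G>)"
    then obtain x y z where xyz: "x \<in> ?E" "y \<in> ?E" "z \<in> ?E" "P (set (snd x)) (set (snd y)) (set (snd z))"
      "r = vector_of (?V (fst x) (fst y) (fst z))" unfolding eq by blast
    then obtain i j l where ijl: "i < length \<G>" "x = (i, \<G> ! i)" "j < length \<G>" "y = (j, \<G> ! j)" "l < length \<G>" "z = (l, \<G> ! l)"
      unfolding in_enumerate by blast
    have "r = (\<lambda>i' h. single i [] i' h + single j [] i' h - single l [] i' h)"
      using xyz(5) vector_of_additive[OF ijl(1,3,5)] unfolding ijl(2,4,6) by simp
    moreover have "P (set (\<G> ! i)) (set (\<G> ! j)) (set (\<G> ! l))" using xyz(4) unfolding ijl(2,4,6) by simp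
    ultimately show "r \<in> additive_relators"
      unfolding additive_relators_def using ijl(1,3,5) unfolding P_def by blast
  next
    fix r assume "r \<in> additive_relators"
    then obtain i j l where r: "r = (\<lambda>i' h. single i [] i' h + single j [] i' h - single l [] i' h)"
      and ijl: "i < length \<G>" "j < length \<G>" "l < length \<G>" and P: "P (set (\<G> ! i)) (set (\<G> ! j)) (set (\<G> ! l))"
      unfolding additive_relators_def P_def by blast
    have "(i, \<G> ! i) \<in> ?E" "(j, \<G> ! j) \<in> ?E" "(l, \<G> ! l) \<in> ?E"
      unfolding in_enumerate using ijl by blast+
    moreover have "?V i j l = ?V (fst (i, \<G> ! i)) (fst (j, \<G> ! j)) (fst (l, \<G> ! l))" by simp
    moreover have "P (set (snd (i, \<G> ! i))) (set (snd (j, \<G> ! j))) (set (snd (l, \<G> ! l)))" using P by simp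
    ultimately have "?V i j l \<in> set (additive_list n \<D> \<G>)" unfolding eq by blast
    then have "vector_of (?V i j l) \<in> vector_of ` set (additive_list n \<D> \<G>)" by (rule imageI)
    then show "r \<in> vector_of ` set (additive_list n \<D> \<G>)" unfolding vector_of_additive[OF ijl] r .
  qed
qed

lemma shift_list_relators: "vector_of ` set (shift_list n \<D> \<G>) = shift_relators"
proof -
  define P where "P = (\<lambda>A B a. \<forall>u\<in>sphere n (Suc \<D>). take \<D> (reduce (a # u)) \<in> A \<longleftrightarrow> take \<D> u \<in> B)"
  have test: "list_all (\<lambda>u. (take \<D> (reduce (a # u)) \<in> A) = (take \<D> u \<in> B)) (sphere_list n (Suc \<D>)) \<longleftrightarrow> P A B a" for A B a
    unfolding list_all_iff set_sphere_list P_def ..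
  let ?V = "\<lambda>i j a. sparse_vector (length \<G>) [(i, 1, [a]), (j, - 1, [])]"
  let ?E = "set (List.enumerate 0 \<G>)"
  have eq: "set (shift_list n \<D> \<G>) =
      {?V (fst x) (fst y) a | x y a. x \<in> ?E \<and> y \<in> ?E \<and> a \<in> set (letters n) \<and> P (set (snd x)) (set (snd y)) a}"
    unfolding shift_list_def test set_nested_filter ..
  show ?thesis
  proof (intro Set.set_eqI iffI)
    fix r assume "r \<in> vector_of ` set (shift_list n \<D> \<G>)"
    then obtain x y a where xya: "x \<in> ?E" "y \<in> ?E" "a \<in> set (letters n)" "P (set (snd x)) (set (snd y)) a"
      "r = vector_of (?V (fst x) (fst y) a)" unfolding eq by blast
    then obtain i j where ij: "i < length \<G>" "x = (i, \<G> ! i)" "j < length \<G>" "y = (j, \<G> ! j)"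
      unfolding in_enumerate by blast
    have "r = (\<lambda>i' h. single i [a] i' h - single j [] i' h)"
      using xya(5) vector_of_shift[OF ij(1,3)] unfolding ij(2,4) by simp
    moreover have "P (set (\<G> ! i)) (set (\<G> ! j)) a" using xya(4) unfolding ij(2,4) by simp
    moreover have "fst a < n" using xya(3) unfolding set_letters .
    ultimately show "r \<in> shift_relators"
      unfolding shift_relators_def using ij(1,3) unfolding P_def by blast
  next
    fix r assume "r \<in> shift_relators"
    then obtain i j a where r: "r = (\<lambda>i' h. single i [a] i' h - single j [] i' h)"
      and ij: "i < length \<G>" "j < length \<G>" and a: "fst a < n" and P: "P (set (\<G> ! i)) (set (\<G> ! j)) a"
      unfolding shift_relators_def P_def by blast
    have "(i, \<G> ! i) \<in> ?E" "(j, \<G> ! j) \<in> ?E"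
      unfolding in_enumerate using ij by blast+
    moreover have "a \<in> set (letters n)" using a unfolding set_letters .
    moreover have "?V i j a = ?V (fst (i, \<G> ! i)) (fst (j, \<G> ! j)) a" by simp
    moreover have "P (set (snd (i, \<G> ! i))) (set (snd (j, \<G> ! j))) a" using P by simp
    ultimately have "?V i j a \<in> set (shift_list n \<D> \<G>)" unfolding eq by blast
    then have "vector_of (?V i j a) \<in> vector_of ` set (shift_list n \<D> \<G>)" by (rule imageI)
    then show "r \<in> vector_of ` set (shift_list n \<D> \<G>)" unfolding vector_of_shift[OF ij] r .
  qed
qed

lemma sparse_vector_exprs:
  assumes "\<And>e. e \<in> set es \<Longrightarrow> snd (snd e) \<in> words n"
  shows "sparse_vector k es \<in> vector_exprs n k"
  using assms unfolding vector_exprs_def sparse_vector_def by (auto simp: case_prod_beta)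

lemma present_correct:
  defines "P \<equiv> present n \<D> \<G>"
  shows "set (snd P) \<subseteq> vector_exprs n (fst P)"
    and "right_module_isomorphic (free_group n) (cech_module n ws 0) (presented_module n (fst P) (snd P))"
proof -
  show "set (snd P) \<subseteq> vector_exprs n (fst P)"
  proof
    fix r assume "r \<in> set (snd P)"
    then have "r \<in> set (additive_list n \<D> \<G>) \<or> r \<in> set (shift_list n \<D> \<G>)"
      unfolding P_def present_def by simp
    then show "r \<in> vector_exprs n (fst P)"
    proof
      assume "r \<in> set (additive_list n \<D> \<G>)"
      then obtain i j l where "r = sparse_vector (length \<G>) [(i, 1, []), (j, 1, []), (l, - 1, [])]"
        unfolding additive_list_def set_nested_filter by blast
      then show ?thesis unfolding P_def present_def fst_conv by (auto intro!: sparse_vector_exprs)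
    next
      assume "r \<in> set (shift_list n \<D> \<G>)"
      then obtain i j a where r: "r = sparse_vector (length \<G>) [(i, 1, [a]), (j, - 1, [])]" and "a \<in> set (letters n)"
        unfolding shift_list_def set_nested_filter by blast
      then have "fst a < n" unfolding set_letters by blast
      then show ?thesis unfolding P_def present_def fst_conv r by (auto intro!: sparse_vector_exprs)
    qed
  qed
  have "vector_of ` set (snd P) = additive_relators \<union> shift_relators"
    unfolding P_def present_def snd_conv set_append image_Un additive_list_relators shift_list_relators ..
  then have "presented_module n (fst P) (snd P) = quotient_module \<Phi> span"
    unfolding presented_module_def span_def by (simp add: P_def present_def del: free_right_module_simps)
  then show "right_module_isomorphic (free_group n) (cech_module n ws 0) (presented_module n (fst P) (snd P))"
    using cech_module_presented by simp
qed

end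

theorem corollary4:
  shows "\<exists>f. partial_recursive f \<and>
    (\<forall>n ws. set ws \<subseteq> words n \<and> malnormal_cyclic_family (free_group n) (map reduce ws) \<longrightarrow>
      (\<exists>k rels. f (input_code n ws) = Some (presentation_code k rels) \<and>
         set rels \<subseteq> vector_exprs n k \<and>
         right_module_isomorphic (free_group n)
           (cech_module n (map reduce ws) 0) (presented_module n k rels)))"
proof -
  obtain g where g: "recursive g" "\<And>x. g (enc x) = enc (presentation_of x)"
    using computable_presentation_of unfolding computable_def by blast
  have "\<exists>k rels. Some (g (input_code n ws)) = Some (presentation_code k rels) \<and>
      set rels \<subseteq> vector_exprs n k \<and>
      right_module_isomorphic (free_group n) (cech_module n (map reduce ws) 0) (presented_module n k rels)"
    if mal: "malnormal_cyclic_family (free_group n) (map reduce ws)" for n ws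
  proof -
    \<comment> \<open>Malnormality includes that no reduced input word is empty, so the powers of
      each word converge to an end point.\<close>
    have c: "\<forall>w\<in>set (map reduce ws). w \<in> carrier (free_group n) \<and> w \<noteq> \<one>\<^bsub>free_group n\<^esub>"
      using mal unfolding malnormal_cyclic_family_def by (rule conjunct1)
    interpret pattern_words n "map reduce ws"
    proof
      show "set (map reduce ws) \<subseteq> rwords n" using c unfolding carrier_free_group by blast
      show "[] \<notin> set (map reduce ws)" using c unfolding one_free_group by blast
    qed
    let ?P = "presentation_of (n, ws)"
    have P: "?P = present n \<D> \<G>" unfolding presentation_of_def Let_def by simp
    have "g (input_code n ws) = presentation_code (fst ?P) (snd ?P)"
      unfolding enc_input[symmetric] enc_presentation[symmetric] g(2) prod.collapse ..
    with present_correct show ?thesis unfolding P by blast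
  qed
  then show ?thesis
    using g(1) unfolding recursive_def by (intro exI[of _ "\<lambda>x. Some (g x)"]) blast
qed

end
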